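(* Let $C$ be a cocommutative rack bialgebra over a field $k$, with universal enveloping algebra $U(C)=T/J$ and canonical map $q\colon C\to U(C)$. Then: (1) The coproduct and counit of the bialgebra $T$ descend to $U(C)$, so that $U(C)$ is a bialgebra, and the right action of $T$ on $C$ descends to a right action $\cdot_{U(C)}$ of $U(C)$ on $C$; with this action and the map $q\colon C\to U(C)$, $C$ is a Yetter-Drinfel'd rack over $U(C)$. (2) If $H$ is any bialgebra and $C$ carries a structure of a Yetter-Drinfel'd rack over $H$, given by a right $H$-module structure $\cdot_H$ on $C$ and a map $q_H\colon C\to H$, then there exists a unique morphism of bialgebras $u\colon U(C)\to H$ such that $u\circ q=q_H$, and hence $$x\cdot_{U(C)} s = x\cdot_H u(s)$$ holds for all $x\in C$ and $s\in U(C)$.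
   Context: All vector spaces, coalgebras, etc. are over a field $k$; Sweedler notation $\triangle(z)=z_{(1)}\otimes z_{(2)}$ is used. A rack bialgebra is a coassociative counital coalgebra $(C,\triangle,\epsilon)$ with a distinguished group-like element $1\in C$ ($\triangle(1)=1\otimes 1$, $\epsilon(1)=1$) together with a morphism of coalgebras $\lhd\colon C\otimes C\to C$ such that for all $x,y,z\in C$: $(x\lhd y)\lhd z=(x\lhd z_{(1)})\lhd(y\lhd z_{(2)})$, $x\lhd 1=x$, $1\lhd x=\epsilon(x)1$, $\epsilon(x\lhd y)=\epsilon(x)\epsilon(y)$. It is cocommutative if its underlying coalgebra is. Let $H$ be a bialgebra. A Yetter-Drinfel'd rack over $H$ is a rack bialgebra $C$ together with a right $H$-module structure $\cdot\colon C\otimes H\to C$ making $C$ an $H$-module coalgebra (i.e. the action is a morphism of counital coalgebras), and a morphism $q\colon C\to H$ of counital coaugmented coalgebras (so $q(1)=1_H$), such that $a\lhd b=a\cdot q(b)$ and $h_{(1)}\,q(a\cdot h_{(2)})=q(a)\,h$ for all $h\in H$, $a,b\in C$. For a rack bialgebra $C$, put $\check C=\ker\epsilon$, so $C=k1\oplus\check C$. Let $T=\bigoplus_{n\ge 0}\check C^{\otimes n}$ be the tensor algebra of $\check C$, with product denoted by a dot, and let $i\colon C\to T$ be the inclusion that is the identity on $\check C$ and sends $1\in C$ to $1\in k=\check C^{\otimes 0}$. $T$ is a bialgebra whose coproduct $\triangle_T\colon T\to T\otimes T$ is the unique algebra map with $\triangle_T(i(x))=i(x_{(1)})\otimes i(x_{(2)})$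 for $x\in\check C$, and whose counit is the algebra map vanishing on $\check C$. $C$ is a right $T$-module via the unique right action $\cdot$ with $y\cdot i(x)=y\lhd x$ for $x\in\check C$, $y\in C$. Let $J\subset T$ be the two-sided ideal generated by all elements $i(y_{(1)}).i(x\lhd y_{(2)})-i(x).i(y)$ with $x,y\in C$. The universal enveloping algebra of $C$ is $U(C):=T/J$, and $q\colon C\to U(C)$ is the composition of $i$ with the quotient map. *)

theory Defs
  imports "HOL-Algebra.Module" "HOL-Algebra.QuotRing" "HOL.Hull"
begin

section \<open>Linear algebra over a field\<close>

text \<open>
  Vector spaces, algebras, coalgebras and bialgebras over a field \<open>K\<close> are all modules over \<open>K\<close> in
  the sense of \<^locale>\<open>module\<close>.  The fields \<^const>\<open>monoid.mult\<close> and \<^const>\<open>one\<close> of the record are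
  meaningful only where an algebra structure (or, for \<^const>\<open>one\<close>, a distinguished element) is
  present.
\<close>

definition lin :: "('k, 'r) ring_scheme \<Rightarrow> ('k, 'a, 'm) module_scheme \<Rightarrow> ('k, 'b, 'n) module_scheme
    \<Rightarrow> ('a \<Rightarrow> 'b) set" where
  "lin K V W = {f \<in> carrier V \<rightarrow> carrier W.
     (\<forall>x\<in>carrier V. \<forall>y\<in>carrier V. f (x \<oplus>\<^bsub>V\<^esub> y) = f x \<oplus>\<^bsub>W\<^esub> f y) \<and>
     (\<forall>a\<in>carrier K. \<forall>x\<in>carrier V. f (a \<odot>\<^bsub>V\<^esub> x) = a \<odot>\<^bsub>W\<^esub> f x)}"

definition bilin :: "('k, 'r) ring_scheme \<Rightarrow> ('k, 'a, 'm) module_scheme \<Rightarrow> ('k, 'b, 'n) module_scheme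
    \<Rightarrow> ('k, 'c, 'o) module_scheme \<Rightarrow> ('a \<Rightarrow> 'b \<Rightarrow> 'c) set" where
  "bilin K V W P = {\<beta>. (\<forall>v\<in>carrier V. (\<lambda>w. \<beta> v w) \<in> lin K W P) \<and>
                       (\<forall>w\<in>carrier W. (\<lambda>v. \<beta> v w) \<in> lin K V P)}"

definition base_alg :: "('k, 'r) ring_scheme \<Rightarrow> ('k, 'k) module" where
  "base_alg K = \<lparr>carrier = carrier K, monoid.mult = monoid.mult K, one = \<one>\<^bsub>K\<^esub>, ring.zero = \<zero>\<^bsub>K\<^esub>, add = add K,
                 smult = monoid.mult K\<rparr>"

definition span_in :: "('k, 'r) ring_scheme \<Rightarrow> ('k, 'a, 'm) module_scheme \<Rightarrow> 'a set \<Rightarrow> 'a set" where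
  "span_in K V S = (\<lambda>N. submodule N K V) hull S"

text \<open>
  The quotient by a subspace or an ideal: \<^const>\<open>FactRing\<close> together with scalar multiplication.
\<close>

definition quot_mod :: "('k, 'a, 'm) module_scheme \<Rightarrow> 'a set \<Rightarrow> ('k, 'a set) module" where
  "quot_mod V N = ring.extend (V Quot N)
     (module.fields (\<lambda>a X. \<Union>x\<in>X. N +>\<^bsub>V\<^esub> (a \<odot>\<^bsub>V\<^esub> x)))"

text \<open>
  The monoid algebra of \<open>G\<close>, i.e. the vector space with basis \<open>carrier G\<close>, realised by finitely
  supported functions with convolution.
\<close>

definition monoid_algebra :: "('k, 'r) ring_scheme \<Rightarrow> ('g, 'm) monoid_scheme \<Rightarrow> ('k, 'g \<Rightarrow> 'k) module"
  where
  "monoid_algebra K G =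
    \<lparr>carrier = {f. range f \<subseteq> carrier K \<and> {x. f x \<noteq> \<zero>\<^bsub>K\<^esub>} \<subseteq> carrier G \<and> finite {x. f x \<noteq> \<zero>\<^bsub>K\<^esub>}},
     monoid.mult = (\<lambda>f g z. \<Oplus>\<^bsub>K\<^esub>p\<in>{(x, y). f x \<noteq> \<zero>\<^bsub>K\<^esub> \<and> g y \<noteq> \<zero>\<^bsub>K\<^esub> \<and> x \<otimes>\<^bsub>G\<^esub> y = z}.
                       f (fst p) \<otimes>\<^bsub>K\<^esub> g (snd p)),
     one = (\<lambda>x. if x = \<one>\<^bsub>G\<^esub> then \<one>\<^bsub>K\<^esub> else \<zero>\<^bsub>K\<^esub>),
     ring.zero = (\<lambda>x. \<zero>\<^bsub>K\<^esub>),
     add = (\<lambda>f g x. f x \<oplus>\<^bsub>K\<^esub> g x),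
     smult = (\<lambda>a f x. a \<otimes>\<^bsub>K\<^esub> f x)\<rparr>"

definition basis_elt :: "('k, 'r) ring_scheme \<Rightarrow> 'g \<Rightarrow> 'g \<Rightarrow> 'k" where
  "basis_elt K x = (\<lambda>y. if y = x then \<one>\<^bsub>K\<^esub> else \<zero>\<^bsub>K\<^esub>)"


section \<open>Tensor products\<close>

text \<open>
  \<open>V \<otimes> W\<close> is the vector space with basis \<open>V \<times> W\<close> modulo the bilinearity relations.  If \<open>V\<close> and \<open>W\<close>
  are algebras, the multiplication of the record is
  \<open>(v \<otimes> w) (v' \<otimes> w') = v v' \<otimes> w w'\<close>, inherited from the monoid algebra of \<open>V \<times>\<times> W\<close>.
\<close>

definition bilinearity_rels :: "('k, 'r) ring_scheme \<Rightarrow> ('k, 'a, 'm) module_scheme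
    \<Rightarrow> ('k, 'b, 'n) module_scheme \<Rightarrow> ('a \<times> 'b \<Rightarrow> 'k) set" where
  "bilinearity_rels K V W = (let F = monoid_algebra K (V \<times>\<times> W); e = basis_elt K in
     {e (v \<oplus>\<^bsub>V\<^esub> v', w) \<ominus>\<^bsub>F\<^esub> (e (v, w) \<oplus>\<^bsub>F\<^esub> e (v', w)) | v v' w.
        v \<in> carrier V \<and> v' \<in> carrier V \<and> w \<in> carrier W} \<union>
     {e (v, w \<oplus>\<^bsub>W\<^esub> w') \<ominus>\<^bsub>F\<^esub> (e (v, w) \<oplus>\<^bsub>F\<^esub> e (v, w')) | v w w'.
        v \<in> carrier V \<and> w \<in> carrier W \<and> w' \<in> carrier W} \<union>
     {e (a \<odot>\<^bsub>V\<^esub> v, w) \<ominus>\<^bsub>F\<^esub> (a \<odot>\<^bsub>F\<^esub> e (v, w)) | a v w.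
        a \<in> carrier K \<and> v \<in> carrier V \<and> w \<in> carrier W} \<union>
     {e (v, a \<odot>\<^bsub>W\<^esub> w) \<ominus>\<^bsub>F\<^esub> (a \<odot>\<^bsub>F\<^esub> e (v, w)) | a v w.
        a \<in> carrier K \<and> v \<in> carrier V \<and> w \<in> carrier W})"

definition tensor_null :: "('k, 'r) ring_scheme \<Rightarrow> ('k, 'a, 'm) module_scheme
    \<Rightarrow> ('k, 'b, 'n) module_scheme \<Rightarrow> ('a \<times> 'b \<Rightarrow> 'k) set" where
  "tensor_null K V W = span_in K (monoid_algebra K (V \<times>\<times> W)) (bilinearity_rels K V W)"

definition tensor :: "('k, 'r) ring_scheme \<Rightarrow> ('k, 'a, 'm) module_scheme
    \<Rightarrow> ('k, 'b, 'n) module_scheme \<Rightarrow> ('k, ('a \<times> 'b \<Rightarrow> 'k) set) module" where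
  "tensor K V W = quot_mod (monoid_algebra K (V \<times>\<times> W)) (tensor_null K V W)"

definition tens :: "('k, 'r) ring_scheme \<Rightarrow> ('k, 'a, 'm) module_scheme
    \<Rightarrow> ('k, 'b, 'n) module_scheme \<Rightarrow> 'a \<Rightarrow> 'b \<Rightarrow> ('a \<times> 'b \<Rightarrow> 'k) set" where
  "tens K V W v w = tensor_null K V W +>\<^bsub>monoid_algebra K (V \<times>\<times> W)\<^esub> basis_elt K (v, w)"

text \<open>
  The linear map \<open>V \<otimes> W \<rightarrow> P\<close> induced by a bilinear map \<open>\<beta>\<close>, computed on a representative.  For
  bilinear \<open>\<beta>\<close> the value does not depend on the representative.
\<close>

definition tlift :: "('k, 'r) ring_scheme \<Rightarrow> ('k, 'p, 'o) module_scheme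
    \<Rightarrow> ('a \<Rightarrow> 'b \<Rightarrow> 'p) \<Rightarrow> ('a \<times> 'b \<Rightarrow> 'k) set \<Rightarrow> 'p" where
  "tlift K P \<beta> X = (let f = (SOME f. f \<in> X) in
     \<Oplus>\<^bsub>P\<^esub>p\<in>{p. f p \<noteq> \<zero>\<^bsub>K\<^esub>}. f p \<odot>\<^bsub>P\<^esub> \<beta> (fst p) (snd p))"

definition tmap :: "('k, 'r) ring_scheme \<Rightarrow> ('k, 'c, 'm) module_scheme \<Rightarrow> ('k, 'd, 'n) module_scheme
    \<Rightarrow> ('a \<Rightarrow> 'c) \<Rightarrow> ('b \<Rightarrow> 'd) \<Rightarrow> ('a \<times> 'b \<Rightarrow> 'k) set \<Rightarrow> ('c \<times> 'd \<Rightarrow> 'k) set" where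
  "tmap K V' W' f g = tlift K (tensor K V' W') (\<lambda>v w. tens K V' W' (f v) (g w))"


section \<open>Algebras, coalgebras and bialgebras\<close>

text \<open>Unlike \<^locale>\<open>algebra\<close>, no commutativity is required.\<close>

locale k_algebra =
  fixes K (structure) and A (structure)
  assumes alg_module: "module K A"
    and alg_ring: "ring A"
    and smult_mult_left: "\<lbrakk>a \<in> carrier K; x \<in> carrier A; y \<in> carrier A\<rbrakk>
      \<Longrightarrow> (a \<odot>\<^bsub>A\<^esub> x) \<otimes>\<^bsub>A\<^esub> y = a \<odot>\<^bsub>A\<^esub> (x \<otimes>\<^bsub>A\<^esub> y)"
    and smult_mult_right: "\<lbrakk>a \<in> carrier K; x \<in> carrier A; y \<in> carrier A\<rbrakk>
      \<Longrightarrow> x \<otimes>\<^bsub>A\<^esub> (a \<odot>\<^bsub>A\<^esub> y) = a \<odot>\<^bsub>A\<^esub> (x \<otimes>\<^bsub>A\<^esub> y)"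

definition alg_hom :: "('k, 'r) ring_scheme \<Rightarrow> ('k, 'a, 'm) module_scheme
    \<Rightarrow> ('k, 'b, 'n) module_scheme \<Rightarrow> ('a \<Rightarrow> 'b) set" where
  "alg_hom K A B = ring_hom A B \<inter> lin K A B"

record ('k, 'a) coalg = "('k, 'a) module" +
  comult :: "'a \<Rightarrow> ('a \<times> 'a \<Rightarrow> 'k) set"
  counit :: "'a \<Rightarrow> 'k"

text \<open>\<open>sweedler K C P (\<lambda>x1 x2. \<beta> x1 x2) x\<close> is \<open>\<beta>(x\<^sub>(\<^sub>1\<^sub>), x\<^sub>(\<^sub>2\<^sub>))\<close>.\<close>

definition sweedler :: "('k, 'r) ring_scheme \<Rightarrow> ('k, 'a, 'm) coalg_scheme
    \<Rightarrow> ('k, 'p, 'o) module_scheme \<Rightarrow> ('a \<Rightarrow> 'a \<Rightarrow> 'p) \<Rightarrow> 'a \<Rightarrow> 'p" where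
  "sweedler K C P \<beta> x = tlift K P \<beta> (comult C x)"

locale coalgebra =
  fixes K (structure) and C :: "('k, 'a, 'm) coalg_scheme" (structure)
  assumes coalg_module: "module K C"
    and comult_lin: "comult C \<in> lin K C (tensor K C C)"
    and counit_lin: "counit C \<in> lin K C (base_alg K)"
    and coassoc: "x \<in> carrier C \<Longrightarrow>
      sweedler K C (tensor K C (tensor K C C))
        (\<lambda>x1 x2. sweedler K C (tensor K C (tensor K C C))
           (\<lambda>x11 x12. tens K C (tensor K C C) x11 (tens K C C x12 x2)) x1) x
      = sweedler K C (tensor K C (tensor K C C)) (\<lambda>x1 x2. tens K C (tensor K C C) x1 (comult C x2)) x"
    and counit_left: "x \<in> carrier C \<Longrightarrow> sweedler K C C (\<lambda>x1 x2. counit C x1 \<odot>\<^bsub>C\<^esub> x2) x = x"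
    and counit_right: "x \<in> carrier C \<Longrightarrow> sweedler K C C (\<lambda>x1 x2. counit C x2 \<odot>\<^bsub>C\<^esub> x1) x = x"

definition cocommutative :: "('k, 'r) ring_scheme \<Rightarrow> ('k, 'a, 'm) coalg_scheme \<Rightarrow> bool" where
  "cocommutative K C \<longleftrightarrow>
     (\<forall>x\<in>carrier C. sweedler K C (tensor K C C) (\<lambda>x1 x2. tens K C C x2 x1) x = comult C x)"

text \<open>Morphisms of coalgebras are required to preserve the counit.\<close>

definition coalg_hom :: "('k, 'r) ring_scheme \<Rightarrow> ('k, 'a, 'm) coalg_scheme
    \<Rightarrow> ('k, 'b, 'n) coalg_scheme \<Rightarrow> ('a \<Rightarrow> 'b) set" where
  "coalg_hom K C D = {f \<in> lin K C D. \<forall>x\<in>carrier C.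
     comult D (f x) = tmap K D D f f (comult C x) \<and> counit D (f x) = counit C x}"

definition with_coalg :: "('k, 'a) module \<Rightarrow> ('a \<Rightarrow> ('a \<times> 'a \<Rightarrow> 'k) set) \<Rightarrow> ('a \<Rightarrow> 'k) \<Rightarrow> ('k, 'a) coalg"
  where "with_coalg A \<Delta> \<epsilon> = module.extend A (coalg.fields \<Delta> \<epsilon>)"

text \<open>
  The tensor product of coalgebras: \<open>\<Delta>(c \<otimes> d) = (c\<^sub>(\<^sub>1\<^sub>) \<otimes> d\<^sub>(\<^sub>1\<^sub>)) \<otimes> (c\<^sub>(\<^sub>2\<^sub>) \<otimes> d\<^sub>(\<^sub>2\<^sub>))\<close>
  and \<open>\<epsilon>(c \<otimes> d) = \<epsilon>(c) \<epsilon>(d)\<close>.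
\<close>

definition tensor_coalg :: "('k, 'r) ring_scheme \<Rightarrow> ('k, 'a, 'm) coalg_scheme
    \<Rightarrow> ('k, 'b, 'n) coalg_scheme \<Rightarrow> ('k, ('a \<times> 'b \<Rightarrow> 'k) set) coalg" where
  "tensor_coalg K C D = (let CD = tensor K C D; CDCD = tensor K CD CD in
     with_coalg CD
       (tlift K CDCD (\<lambda>c d.
          sweedler K C CDCD (\<lambda>c1 c2.
            sweedler K D CDCD (\<lambda>d1 d2.
              tens K CD CD (tens K C D c1 d1) (tens K C D c2 d2)) d) c))
       (tlift K (base_alg K) (\<lambda>c d. counit C c \<otimes>\<^bsub>K\<^esub> counit D d)))"

locale bialgebra = k_algebra K H + coalgebra K H
  for K (structure) and H :: "('k, 'h, 'm) coalg_scheme" (structure) +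
  assumes comult_alg_hom: "comult H \<in> alg_hom K H (tensor K H H)"
    and counit_alg_hom: "counit H \<in> alg_hom K H (base_alg K)"

definition bialg_hom :: "('k, 'r) ring_scheme \<Rightarrow> ('k, 'a, 'm) coalg_scheme
    \<Rightarrow> ('k, 'b, 'n) coalg_scheme \<Rightarrow> ('a \<Rightarrow> 'b) set" where
  "bialg_hom K A B = alg_hom K A B \<inter> coalg_hom K A B"

locale right_module =
  fixes K (structure) and A (structure) and M (structure)
    and act :: "'b \<Rightarrow> 'a \<Rightarrow> 'b"
  assumes alg: "k_algebra K A"
    and act_module: "module K M"
    and act_bilin: "act \<in> bilin K M A M"
    and act_one: "x \<in> carrier M \<Longrightarrow> act x \<one>\<^bsub>A\<^esub> = x"
    and act_mult: "\<lbrakk>x \<in> carrier M; s \<in> carrier A; t \<in> carrier A\<rbrakk>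
      \<Longrightarrow> act x (s \<otimes>\<^bsub>A\<^esub> t) = act (act x s) t"


section \<open>Rack bialgebras and Yetter-Drinfel'd racks\<close>

text \<open>
  The distinguished group-like element of a rack bialgebra is \<open>\<one>\<^bsub>C\<^esub>\<close>; \<^const>\<open>monoid.mult\<close> is not used.
  The coalgebra morphism \<open>C \<otimes> C \<rightarrow> C\<close> is given by the bilinear map \<^term>\<open>rack\<close> inducing it.
\<close>

record ('k, 'a) rack_coalg = "('k, 'a) coalg" +
  rack :: "'a \<Rightarrow> 'a \<Rightarrow> 'a"  (infixl \<open>\<lhd>\<index>\<close> 70)

locale rack_bialgebra = coalgebra K C
  for K (structure) and C :: "('k, 'a, 'm) rack_coalg_scheme" (structure) +
  assumes one_closed: "\<one>\<^bsub>C\<^esub> \<in> carrier C"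
    and comult_one: "comult C \<one>\<^bsub>C\<^esub> = tens K C C \<one>\<^bsub>C\<^esub> \<one>\<^bsub>C\<^esub>"
    and counit_one: "counit C \<one>\<^bsub>C\<^esub> = \<one>\<^bsub>K\<^esub>"
    and rack_bilin: "rack C \<in> bilin K C C C"
    and rack_coalg_hom: "tlift K C (rack C) \<in> coalg_hom K (tensor_coalg K C C) C"
    and self_distrib: "\<lbrakk>x \<in> carrier C; y \<in> carrier C; z \<in> carrier C\<rbrakk> \<Longrightarrow>
      (x \<lhd>\<^bsub>C\<^esub> y) \<lhd>\<^bsub>C\<^esub> z = sweedler K C C (\<lambda>z1 z2. (x \<lhd>\<^bsub>C\<^esub> z1) \<lhd>\<^bsub>C\<^esub> (y \<lhd>\<^bsub>C\<^esub> z2)) z"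
    and rack_one: "x \<in> carrier C \<Longrightarrow> x \<lhd>\<^bsub>C\<^esub> \<one>\<^bsub>C\<^esub> = x"
    and one_rack: "x \<in> carrier C \<Longrightarrow> \<one>\<^bsub>C\<^esub> \<lhd>\<^bsub>C\<^esub> x = counit C x \<odot>\<^bsub>C\<^esub> \<one>\<^bsub>C\<^esub>"
    and counit_rack: "\<lbrakk>x \<in> carrier C; y \<in> carrier C\<rbrakk> \<Longrightarrow>
      counit C (x \<lhd>\<^bsub>C\<^esub> y) = counit C x \<otimes>\<^bsub>K\<^esub> counit C y"

locale yetter_drinfeld_rack = rack_bialgebra K C + bialgebra K H + right_module K H C act
  for K (structure) and H :: "('k, 'h, 'n) coalg_scheme" (structure)
    and C :: "('k, 'a, 'm) rack_coalg_scheme" (structure)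
    and act :: "'a \<Rightarrow> 'h \<Rightarrow> 'a" and q :: "'a \<Rightarrow> 'h" +
  assumes act_coalg_hom: "tlift K C act \<in> coalg_hom K (tensor_coalg K C H) C"
    and q_coalg_hom: "q \<in> coalg_hom K C H"
    and q_one: "q \<one>\<^bsub>C\<^esub> = \<one>\<^bsub>H\<^esub>"
    and rack_act: "\<lbrakk>a \<in> carrier C; b \<in> carrier C\<rbrakk> \<Longrightarrow> a \<lhd>\<^bsub>C\<^esub> b = act a (q b)"
    and yetter_drinfeld: "\<lbrakk>a \<in> carrier C; h \<in> carrier H\<rbrakk> \<Longrightarrow>
      sweedler K H H (\<lambda>h1 h2. h1 \<otimes>\<^bsub>H\<^esub> q (act a h2)) h = q a \<otimes>\<^bsub>H\<^esub> h"


section \<open>The universal enveloping algebra\<close>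

text \<open>
  The tensor algebra \<open>\<Oplus>\<^sub>n V\<^sup>\<otimes>\<^sup>n\<close>: the vector space whose basis consists of all tuples (lists) of
  vectors, modulo the multilinearity relations in each length; the product is concatenation.
\<close>

definition list_monoid :: "('a, 'm) partial_object_scheme \<Rightarrow> 'a list monoid" where
  "list_monoid V = \<lparr>carrier = lists (carrier V), monoid.mult = (@), one = []\<rparr>"

definition multilinearity_rels :: "('k, 'r) ring_scheme \<Rightarrow> ('k, 'a, 'm) module_scheme
    \<Rightarrow> ('a list \<Rightarrow> 'k) set" where
  "multilinearity_rels K V = (let F = monoid_algebra K (list_monoid V); e = basis_elt K in
     {e (xs @ [v \<oplus>\<^bsub>V\<^esub> w] @ ys) \<ominus>\<^bsub>F\<^esub> (e (xs @ [v] @ ys) \<oplus>\<^bsub>F\<^esub> e (xs @ [w] @ ys)) | xs ys v w.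
        xs \<in> lists (carrier V) \<and> ys \<in> lists (carrier V) \<and> v \<in> carrier V \<and> w \<in> carrier V} \<union>
     {e (xs @ [a \<odot>\<^bsub>V\<^esub> v] @ ys) \<ominus>\<^bsub>F\<^esub> (a \<odot>\<^bsub>F\<^esub> e (xs @ [v] @ ys)) | xs ys a v.
        xs \<in> lists (carrier V) \<and> ys \<in> lists (carrier V) \<and> a \<in> carrier K \<and> v \<in> carrier V})"

definition tens_alg_null :: "('k, 'r) ring_scheme \<Rightarrow> ('k, 'a, 'm) module_scheme
    \<Rightarrow> ('a list \<Rightarrow> 'k) set" where
  "tens_alg_null K V = span_in K (monoid_algebra K (list_monoid V)) (multilinearity_rels K V)"

definition tens_alg :: "('k, 'r) ring_scheme \<Rightarrow> ('k, 'a, 'm) module_scheme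
    \<Rightarrow> ('k, ('a list \<Rightarrow> 'k) set) module" where
  "tens_alg K V = quot_mod (monoid_algebra K (list_monoid V)) (tens_alg_null K V)"

definition tens_alg_incl :: "('k, 'r) ring_scheme \<Rightarrow> ('k, 'a, 'm) module_scheme
    \<Rightarrow> 'a \<Rightarrow> ('a list \<Rightarrow> 'k) set" where
  "tens_alg_incl K V v = tens_alg_null K V +>\<^bsub>monoid_algebra K (list_monoid V)\<^esub> basis_elt K [v]"

definition counit_ker :: "('k, 'r) ring_scheme \<Rightarrow> ('k, 'a, 'm) coalg_scheme
    \<Rightarrow> ('k, 'a, 'm) coalg_scheme" where
  "counit_ker K C = C\<lparr>carrier := {x \<in> carrier C. counit C x = \<zero>\<^bsub>K\<^esub>}\<rparr>"

definition envT :: "('k, 'r) ring_scheme \<Rightarrow> ('k, 'a, 'm) coalg_scheme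
    \<Rightarrow> ('k, ('a list \<Rightarrow> 'k) set) module" where
  "envT K C = tens_alg K (counit_ker K C)"

text \<open>
  The inclusion \<open>i\<close>: along \<open>C = k1 \<oplus> ker \<epsilon>\<close> the element \<open>x\<close> has components \<open>\<epsilon>(x)1\<close> and
  \<open>x - \<epsilon>(x)1\<close>.
\<close>

definition envT_incl :: "('k, 'r) ring_scheme \<Rightarrow> ('k, 'a, 'm) coalg_scheme
    \<Rightarrow> 'a \<Rightarrow> ('a list \<Rightarrow> 'k) set" where
  "envT_incl K C x = (counit C x \<odot>\<^bsub>envT K C\<^esub> \<one>\<^bsub>envT K C\<^esub>)
     \<oplus>\<^bsub>envT K C\<^esub> tens_alg_incl K (counit_ker K C) (x \<ominus>\<^bsub>C\<^esub> (counit C x \<odot>\<^bsub>C\<^esub> \<one>\<^bsub>C\<^esub>))"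

text \<open>
  Coproduct, counit and action of the tensor algebra, specified by their universal properties; extensionality
  makes them unique as functions on the underlying type.
\<close>

definition envT_comult :: "('k, 'r) ring_scheme \<Rightarrow> ('k, 'a, 'm) coalg_scheme
    \<Rightarrow> ('a list \<Rightarrow> 'k) set \<Rightarrow> (('a list \<Rightarrow> 'k) set \<times> ('a list \<Rightarrow> 'k) set \<Rightarrow> 'k) set" where
  "envT_comult K C = (let T = envT K C; i = envT_incl K C in
     THE \<Delta>. \<Delta> \<in> alg_hom K T (tensor K T T) \<and> \<Delta> \<in> extensional (carrier T) \<and>
       (\<forall>x\<in>carrier (counit_ker K C).
          \<Delta> (i x) = sweedler K C (tensor K T T) (\<lambda>x1 x2. tens K T T (i x1) (i x2)) x))"

definition envT_counit :: "('k, 'r) ring_scheme \<Rightarrow> ('k, 'a, 'm) coalg_scheme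
    \<Rightarrow> ('a list \<Rightarrow> 'k) set \<Rightarrow> 'k" where
  "envT_counit K C =
     (THE e. e \<in> alg_hom K (envT K C) (base_alg K) \<and> e \<in> extensional (carrier (envT K C)) \<and>
       (\<forall>x\<in>carrier (counit_ker K C). e (envT_incl K C x) = \<zero>\<^bsub>K\<^esub>))"

definition envT_act :: "('k, 'r) ring_scheme \<Rightarrow> ('k, 'a, 'm) rack_coalg_scheme
    \<Rightarrow> 'a \<Rightarrow> ('a list \<Rightarrow> 'k) set \<Rightarrow> 'a" where
  "envT_act K C =
     (THE act. right_module K (envT K C) C act \<and>
       act = (\<lambda>y\<in>carrier C. \<lambda>t\<in>carrier (envT K C). act y t) \<and>
       (\<forall>y\<in>carrier C. \<forall>x\<in>carrier (counit_ker K C). act y (envT_incl K C x) = y \<lhd>\<^bsub>C\<^esub> x))"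

definition env_ideal :: "('k, 'r) ring_scheme \<Rightarrow> ('k, 'a, 'm) rack_coalg_scheme
    \<Rightarrow> ('a list \<Rightarrow> 'k) set set" where
  "env_ideal K C = (let T = envT K C; i = envT_incl K C in
     Idl\<^bsub>T\<^esub> {sweedler K C T (\<lambda>y1 y2. i y1 \<otimes>\<^bsub>T\<^esub> i (x \<lhd>\<^bsub>C\<^esub> y2)) y \<ominus>\<^bsub>T\<^esub> (i x \<otimes>\<^bsub>T\<^esub> i y) | x y.
       x \<in> carrier C \<and> y \<in> carrier C})"

definition env_alg :: "('k, 'r) ring_scheme \<Rightarrow> ('k, 'a, 'm) rack_coalg_scheme
    \<Rightarrow> ('k, ('a list \<Rightarrow> 'k) set set) module" where
  "env_alg K C = quot_mod (envT K C) (env_ideal K C)"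

definition env_proj :: "('k, 'r) ring_scheme \<Rightarrow> ('k, 'a, 'm) rack_coalg_scheme
    \<Rightarrow> ('a list \<Rightarrow> 'k) set \<Rightarrow> ('a list \<Rightarrow> 'k) set set" where
  "env_proj K C t = env_ideal K C +>\<^bsub>envT K C\<^esub> t"

definition env_map :: "('k, 'r) ring_scheme \<Rightarrow> ('k, 'a, 'm) rack_coalg_scheme
    \<Rightarrow> 'a \<Rightarrow> ('a list \<Rightarrow> 'k) set set" where
  "env_map K C x = env_proj K C (envT_incl K C x)"

text \<open>
  Coproduct, counit and action on \<open>U(C)\<close> are evaluated on representatives in \<open>T\<close>; that this is
  well defined is not built into the definitions.
\<close>

definition env_bialg :: "('k, 'r) ring_scheme \<Rightarrow> ('k, 'a, 'm) rack_coalg_scheme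
    \<Rightarrow> ('k, ('a list \<Rightarrow> 'k) set set) coalg" where
  "env_bialg K C = with_coalg (env_alg K C)
     (\<lambda>s. tmap K (env_alg K C) (env_alg K C) (env_proj K C) (env_proj K C)
            (envT_comult K C (SOME t. t \<in> s)))
     (\<lambda>s. envT_counit K C (SOME t. t \<in> s))"

definition env_act :: "('k, 'r) ring_scheme \<Rightarrow> ('k, 'a, 'm) rack_coalg_scheme
    \<Rightarrow> 'a \<Rightarrow> ('a list \<Rightarrow> 'k) set set \<Rightarrow> 'a" where
  "env_act K C x s = envT_act K C x (SOME t. t \<in> s)"

end

theory Submission
  imports Defs
begin

text \<open>
  The free modules, tensor products and the tensor algebra are used only through their universal
  properties: linear maps out of a tensor product are determined by their values on pure tensors, and
  algebra maps out of \<open>T\<close> or \<open>U(C)\<close> by their values on \<open>C\<close>.  So every structure on \<open>U(C)\<close> is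
  obtained by checking that a map defined on \<open>T\<close> kills the relation
  \<open>y\<^sub>(\<^sub>1\<^sub>) (x \<lhd> y\<^sub>(\<^sub>2\<^sub>)) - x y\<close>, and every identity by comparing two algebra maps on \<open>C\<close> or by
  induction along sums and products.  For the counit the relation reduces to counitality, for the action
  to self-distributivity, for the map to another Yetter-Drinfel'd rack to the Yetter-Drinfel'd condition.
  For the coproduct one gets
  \<open>q(y\<^sub>1) q(x\<^sub>1 \<lhd> y\<^sub>3) \<otimes> q(y\<^sub>2) q(x\<^sub>2 \<lhd> y\<^sub>4)\<close>, and cocommutativity allows to exchange \<open>y\<^sub>2\<close> and
  \<open>y\<^sub>3\<close>, after which the relation applies in both tensor factors.
\<close>

section \<open>Linear maps, submodules and quotients\<close>

text \<open>The defining relation of U(C) is the Yetter-Drinfel'd condition for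
  \<open>h = q y\<close>, with the action already written as \<lhd>. It is thus forced on every
  target H, and in U(C) it has to be extended from q(C) to products. Identities that involve the
  action are proved for all elements of C at once: in the product step the hypothesis for t is
  needed at an element moved by s.

  The obstacle is that \<open>tlift\<close>, \<open>env_act\<close> and the structure maps of
  \<open>env_bialg\<close> are evaluated at a representative picked by \<open>SOME\<close>. They are
  meaningful only if the map concerned is bilinear, or kills the subspace divided out, so each
  rewriting in a Sweedler sum carries a bilinearity obligation. With these settled, Sweedler
  notation is a calculus with four rules: replace the summand (\<open>tlift_cong\<close>), pull a
  linear map inside (\<open>tlift_comp\<close>), interchange independent sums
  (\<open>tlift_exchange\<close>), reassociate (\<open>coassoc_trilin\<close>).
  \<open>tlift_param_lin\<close> lets sums be nested.

  T is generated by ker \<epsilon>, while the relations run over C. The gap is closed at the element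
  1, which \<open>i\<close> sends to the unit of T.\<close>

lemma linI:
  assumes "\<And>x. x \<in> carrier V \<Longrightarrow> f x \<in> carrier W"
    and "\<And>x y. \<lbrakk>x \<in> carrier V; y \<in> carrier V\<rbrakk> \<Longrightarrow> f (x \<oplus>\<^bsub>V\<^esub> y) = f x \<oplus>\<^bsub>W\<^esub> f y"
    and "\<And>a x. \<lbrakk>a \<in> carrier K; x \<in> carrier V\<rbrakk> \<Longrightarrow> f (a \<odot>\<^bsub>V\<^esub> x) = a \<odot>\<^bsub>W\<^esub> f x"
  shows "f \<in> lin K V W"
  using assms by (auto simp: lin_def)

lemma lin_closed: "\<lbrakk>f \<in> lin K V W; x \<in> carrier V\<rbrakk> \<Longrightarrow> f x \<in> carrier W"
  by (auto simp: lin_def)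

lemma lin_add: "\<lbrakk>f \<in> lin K V W; x \<in> carrier V; y \<in> carrier V\<rbrakk> \<Longrightarrow> f (x \<oplus>\<^bsub>V\<^esub> y) = f x \<oplus>\<^bsub>W\<^esub> f y"
  by (auto simp: lin_def)

lemma lin_smult: "\<lbrakk>f \<in> lin K V W; a \<in> carrier K; x \<in> carrier V\<rbrakk> \<Longrightarrow> f (a \<odot>\<^bsub>V\<^esub> x) = a \<odot>\<^bsub>W\<^esub> f x"
  by (auto simp: lin_def)

lemma lin_id: "(\<lambda>x. x) \<in> lin K V V"
  by (rule linI) auto

lemma lin_comp: "\<lbrakk>g \<in> lin K W P; f \<in> lin K V W\<rbrakk> \<Longrightarrow> (\<lambda>x. g (f x)) \<in> lin K V P"
  by (auto simp: lin_def Pi_iff)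

lemma bilinI:
  assumes "\<And>v. v \<in> carrier V \<Longrightarrow> (\<lambda>w. \<beta> v w) \<in> lin K W P"
    and "\<And>w. w \<in> carrier W \<Longrightarrow> (\<lambda>v. \<beta> v w) \<in> lin K V P"
  shows "\<beta> \<in> bilin K V W P"
  using assms by (auto simp: bilin_def)

lemma bilin_right: "\<lbrakk>\<beta> \<in> bilin K V W P; v \<in> carrier V\<rbrakk> \<Longrightarrow> (\<lambda>w. \<beta> v w) \<in> lin K W P"
  by (auto simp: bilin_def)

lemma bilin_left: "\<lbrakk>\<beta> \<in> bilin K V W P; w \<in> carrier W\<rbrakk> \<Longrightarrow> (\<lambda>v. \<beta> v w) \<in> lin K V P"
  by (auto simp: bilin_def)

lemma bilin_closed: "\<lbrakk>\<beta> \<in> bilin K V W P; v \<in> carrier V; w \<in> carrier W\<rbrakk> \<Longrightarrow> \<beta> v w \<in> carrier P"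
  using bilin_right lin_closed by fast

text \<open>Membership in \<open>lin\<close> concerns values on the carrier only. This transfers
  linearity to restricted maps and to maps given by choice, which may differ elsewhere.\<close>

lemma lin_cong:
  assumes f: "f \<in> lin K V W" and "module K V" and eq: "\<And>v. v \<in> carrier V \<Longrightarrow> g v = f v"
  shows "g \<in> lin K V W"
proof -
  interpret V: module K V by fact
  show ?thesis
    by (rule linI) (simp_all add: eq lin_closed[OF f] lin_add[OF f] lin_smult[OF f])
qed

lemma bilin_cong:
  assumes \<beta>: "\<beta> \<in> bilin K V W P" and "module K V" and "module K W"
    and eq: "\<And>v w. \<lbrakk>v \<in> carrier V; w \<in> carrier W\<rbrakk> \<Longrightarrow> \<beta>' v w = \<beta> v w"
  shows "\<beta>' \<in> bilin K V W P"
  by (rule bilinI)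
    (rule lin_cong[OF bilin_right[OF \<beta>] assms(3)] lin_cong[OF bilin_left[OF \<beta>] assms(2)]; simp add: eq)+

lemma bilin_lin_l:
  "\<lbrakk>\<beta> \<in> bilin K V W P; f \<in> lin K X V; w \<in> carrier W\<rbrakk> \<Longrightarrow> (\<lambda>x. \<beta> (f x) w) \<in> lin K X P"
  by (rule lin_comp[OF bilin_left])

lemma bilin_lin_r:
  "\<lbrakk>\<beta> \<in> bilin K V W P; f \<in> lin K X W; v \<in> carrier V\<rbrakk> \<Longrightarrow> (\<lambda>x. \<beta> v (f x)) \<in> lin K X P"
  by (rule lin_comp[OF bilin_right])

lemma lin_zero:
  assumes "module K V" and "module K W" and f: "f \<in> lin K V W"
  shows "f \<zero>\<^bsub>V\<^esub> = \<zero>\<^bsub>W\<^esub>"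
proof -
  interpret V: module K V by fact
  interpret W: module K W by fact
  have "f (\<zero>\<^bsub>K\<^esub> \<odot>\<^bsub>V\<^esub> \<zero>\<^bsub>V\<^esub>) = \<zero>\<^bsub>K\<^esub> \<odot>\<^bsub>W\<^esub> f \<zero>\<^bsub>V\<^esub>"
    by (rule lin_smult[OF f]) simp_all
  then show ?thesis
    using lin_closed[OF f, of "\<zero>\<^bsub>V\<^esub>"] by simp
qed

lemma lin_minus:
  assumes "module K V" and "module K W" and f: "f \<in> lin K V W" and x: "x \<in> carrier V"
  shows "f (\<ominus>\<^bsub>V\<^esub> x) = \<ominus>\<^bsub>W\<^esub> f x"
proof -
  interpret V: module K V by fact
  interpret W: module K W by fact
  have "f ((\<ominus>\<^bsub>K\<^esub> \<one>\<^bsub>K\<^esub>) \<odot>\<^bsub>V\<^esub> x) = (\<ominus>\<^bsub>K\<^esub> \<one>\<^bsub>K\<^esub>) \<odot>\<^bsub>W\<^esub> f x"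
    by (rule lin_smult[OF f]) (simp_all add: x)
  then show ?thesis
    using x lin_closed[OF f x] by (simp add: V.smult_l_minus W.smult_l_minus)
qed

lemma lin_diff:
  assumes "module K V" and "module K W" and f: "f \<in> lin K V W"
    and x: "x \<in> carrier V" and y: "y \<in> carrier V"
  shows "f (x \<ominus>\<^bsub>V\<^esub> y) = f x \<ominus>\<^bsub>W\<^esub> f y"
proof -
  interpret V: module K V by fact
  show ?thesis
    unfolding a_minus_def lin_minus[OF assms(1-3) y, symmetric]
    by (rule lin_add[OF f x V.a_inv_closed[OF y]])
qed

lemma lin_sum:
  assumes "module K W" and f: "f \<in> lin K V W" and g: "g \<in> lin K V W" and "module K V"
  shows "(\<lambda>x. f x \<oplus>\<^bsub>W\<^esub> g x) \<in> lin K V W"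
proof -
  interpret V: module K V by fact
  interpret W: module K W by fact
  show ?thesis
    by (rule linI)
      (simp_all add: lin_add[OF f] lin_add[OF g] lin_smult[OF f] lin_smult[OF g] lin_closed[OF f]
        lin_closed[OF g] W.smult_r_distr W.a_ac)
qed

lemma base_alg_simps [simp]:
  "carrier (base_alg K) = carrier K" "\<one>\<^bsub>base_alg K\<^esub> = \<one>\<^bsub>K\<^esub>" "\<zero>\<^bsub>base_alg K\<^esub> = \<zero>\<^bsub>K\<^esub>"
  "x \<otimes>\<^bsub>base_alg K\<^esub> y = x \<otimes>\<^bsub>K\<^esub> y" "x \<oplus>\<^bsub>base_alg K\<^esub> y = x \<oplus>\<^bsub>K\<^esub> y"
  "x \<odot>\<^bsub>base_alg K\<^esub> y = x \<otimes>\<^bsub>K\<^esub> y"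
  by (simp_all add: base_alg_def)

lemma smult_bilin:
  assumes "module K P"
  shows "smult P \<in> bilin K (base_alg K) P P"
proof -
  interpret P: module K P by fact
  show ?thesis
    by (intro bilinI linI) (simp_all add: P.smult_l_distr P.smult_r_distr P.smult_assoc1[symmetric] P.m_comm)
qed

text \<open>Negation is scalar multiplication by -1, so closure under additive inverses comes for
  free.\<close>

lemma (in module) submoduleI_add_smult:
  assumes "H \<subseteq> carrier M" and "\<zero>\<^bsub>M\<^esub> \<in> H"
    and "\<And>a b. \<lbrakk>a \<in> H; b \<in> H\<rbrakk> \<Longrightarrow> a \<oplus>\<^bsub>M\<^esub> b \<in> H"
    and sm: "\<And>a x. \<lbrakk>a \<in> carrier R; x \<in> H\<rbrakk> \<Longrightarrow> a \<odot>\<^bsub>M\<^esub> x \<in> H"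
  shows "submodule H R M"
proof (rule submoduleI)
  show "\<ominus>\<^bsub>M\<^esub> x \<in> H" if "x \<in> H" for x
    using sm[OF _ that, of "\<ominus> \<one>"] that assms(1) by (auto simp: smult_l_minus)
qed (use assms in auto)

lemma kernel_submodule:
  assumes "module K V" and "module K W" and f: "f \<in> lin K V W"
  shows "submodule {x \<in> carrier V. f x = \<zero>\<^bsub>W\<^esub>} K V"
proof -
  interpret V: module K V by fact
  interpret W: module K W by fact
  show ?thesis
    by (rule V.submoduleI_add_smult)
      (simp_all add: subset_iff lin_zero[OF assms(1,2) f] lin_add[OF f] lin_smult[OF f])
qed

lemma span_in_submodule:
  assumes "module K V" and "S \<subseteq> carrier V"
  shows "submodule (span_in K V S) K V"
proof -
  interpret V: module K V by fact
  \<comment> \<open>The carrier belongs to the family, so the intersection is not that of the empty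
    family, which would be the whole type.\<close>
  have c: "submodule (carrier V) K V" by (rule V.carrier_is_submodule)
  show ?thesis
    unfolding span_in_def hull_def
  proof (rule V.submoduleI_add_smult)
    show "\<Inter> {t. submodule t K V \<and> S \<subseteq> t} \<subseteq> carrier V"
      using c assms(2) by auto
    show "\<zero>\<^bsub>V\<^esub> \<in> \<Inter> {t. submodule t K V \<and> S \<subseteq> t}"
    proof (intro InterI, clarify)
      fix t assume "submodule t K V"
      then interpret submodule t K V .
      \<comment> \<open>A submodule is a subgroup of the additive monoid, whose \<open>one\<close>
        is the zero vector.\<close>
      show "\<zero>\<^bsub>V\<^esub> \<in> t" using one_closed by simp
    qed
  qed (auto dest: V.submoduleE)
qed

lemma span_in_minimal: "\<lbrakk>submodule N K V; S \<subseteq> N\<rbrakk> \<Longrightarrow> span_in K V S \<subseteq> N"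
  unfolding span_in_def by (rule hull_minimal)

lemma span_in_incl: "S \<subseteq> span_in K V S"
  unfolding span_in_def by (rule hull_subset)

lemma (in abelian_group) diff_zero_imp_eq:
  assumes "x \<in> carrier G" "y \<in> carrier G" "x \<ominus> y = \<zero>"
  shows "x = y"
  using assms by (metis a_inv_closed minus_eq minus_equality minus_minus)

lemma (in abelian_group) diff_self: "x \<in> carrier G \<Longrightarrow> x \<ominus> x = \<zero>"
  by (simp add: minus_eq r_neg)

section \<open>Quotients by subspaces\<close>

locale quotient_module = module K V + submodule N K V for K (structure) and V (structure) and N
begin

abbreviation "Q \<equiv> quot_mod V N"

lemma abelian_subgroup_N: "abelian_subgroup N V"
  by (rule abelian_subgroupI3[OF additive_subgroupI[OF subgroup_axioms] M.abelian_group_axioms])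

lemma Q_carrier: "carrier Q = (\<lambda>x. N +>\<^bsub>V\<^esub> x) ` carrier V"
  by (auto simp: quot_mod_def ring.defs module.defs FactRing_simps)

lemma Q_add: "\<lbrakk>x \<in> carrier V; y \<in> carrier V\<rbrakk> \<Longrightarrow>
    (N +>\<^bsub>V\<^esub> x) \<oplus>\<^bsub>Q\<^esub> (N +>\<^bsub>V\<^esub> y) = N +>\<^bsub>V\<^esub> (x \<oplus>\<^bsub>V\<^esub> y)"
  by (simp add: quot_mod_def ring.defs module.defs FactRing_def abelian_subgroup.a_rcos_sum[OF abelian_subgroup_N])

lemma Q_zero: "\<zero>\<^bsub>Q\<^esub> = N +>\<^bsub>V\<^esub> \<zero>\<^bsub>V\<^esub>"
  using M.a_coset_add_zero[OF subset[simplified]] by (simp add: quot_mod_def ring.defs module.defs FactRing_def)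

lemma Q_one: "\<one>\<^bsub>Q\<^esub> = N +>\<^bsub>V\<^esub> \<one>\<^bsub>V\<^esub>"
  by (simp add: quot_mod_def ring.defs module.defs FactRing_def)

lemma coset_mem_iff:
  assumes "x \<in> carrier V" "y \<in> carrier V"
  shows "x \<in> N +>\<^bsub>V\<^esub> y \<longleftrightarrow> x \<ominus>\<^bsub>V\<^esub> y \<in> N"
  using abelian_subgroup.a_rcos_module[OF abelian_subgroup_N, OF assms(2,1)] by (simp add: a_minus_def)

lemma coset_eq_iff:
  assumes "x \<in> carrier V" "y \<in> carrier V"
  shows "N +>\<^bsub>V\<^esub> x = N +>\<^bsub>V\<^esub> y \<longleftrightarrow> x \<ominus>\<^bsub>V\<^esub> y \<in> N"
proof
  show "x \<ominus>\<^bsub>V\<^esub> y \<in> N" if "N +>\<^bsub>V\<^esub> x = N +>\<^bsub>V\<^esub> y"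
    using that abelian_subgroup.a_rcos_self[OF abelian_subgroup_N, OF assms(1)] coset_mem_iff[OF assms] by simp
  show "N +>\<^bsub>V\<^esub> x = N +>\<^bsub>V\<^esub> y" if "x \<ominus>\<^bsub>V\<^esub> y \<in> N"
    using that abelian_subgroup.a_repr_independence'[OF abelian_subgroup_N, OF _ assms(2), of x] coset_mem_iff[OF assms] by simp
qed

lemma coset_zero_iff:
  assumes "x \<in> carrier V"
  shows "N +>\<^bsub>V\<^esub> x = \<zero>\<^bsub>Q\<^esub> \<longleftrightarrow> x \<in> N"
  unfolding Q_zero M.a_coset_add_zero[OF subset[simplified]]
  using abelian_subgroup.a_rcos_self[OF abelian_subgroup_N assms]
    abelian_subgroup.a_rcos_const[OF abelian_subgroup_N] by auto

lemmas M_smult_closed = module.smult_closed[OF module_axioms]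

text \<open>The scalar multiple of a coset is a union over all its representatives, and each of them
  contributes the same coset because N is closed under scalars.\<close>

lemma Q_smult:
  assumes "a \<in> carrier K" "x \<in> carrier V"
  shows "a \<odot>\<^bsub>Q\<^esub> (N +>\<^bsub>V\<^esub> x) = N +>\<^bsub>V\<^esub> (a \<odot>\<^bsub>V\<^esub> x)"
proof -
  have "N +>\<^bsub>V\<^esub> (a \<odot>\<^bsub>V\<^esub> y) = N +>\<^bsub>V\<^esub> (a \<odot>\<^bsub>V\<^esub> x)" if y: "y \<in> N +>\<^bsub>V\<^esub> x" for y
  proof -
    have yc: "y \<in> carrier V"
      by (rule abelian_subgroup.a_elemrcos_carrier[OF abelian_subgroup_N assms(2) y])
    have "y \<ominus>\<^bsub>V\<^esub> x \<in> N" using coset_mem_iff[OF yc assms(2)] y by simp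
    then have "a \<odot>\<^bsub>V\<^esub> (y \<ominus>\<^bsub>V\<^esub> x) \<in> N" using assms(1) by (rule smult_closed[rotated])
    then have "a \<odot>\<^bsub>V\<^esub> y \<ominus>\<^bsub>V\<^esub> a \<odot>\<^bsub>V\<^esub> x \<in> N"
      unfolding a_minus_def
      by (simp only: smult_r_distr[OF assms(1) yc M.a_inv_closed[OF assms(2)]] smult_r_minus[OF assms])
    then show ?thesis
      using coset_eq_iff[OF M_smult_closed[OF assms(1) yc] M_smult_closed[OF assms]] by simp
  qed
  then have "(\<Union>y\<in>N +>\<^bsub>V\<^esub> x. N +>\<^bsub>V\<^esub> (a \<odot>\<^bsub>V\<^esub> y)) = (\<Union>y\<in>N +>\<^bsub>V\<^esub> x. N +>\<^bsub>V\<^esub> (a \<odot>\<^bsub>V\<^esub> x))"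
    by (intro SUP_cong refl)
  \<comment> \<open>A union of equal sets is that set only over a nonempty index set.\<close>
  moreover have "N +>\<^bsub>V\<^esub> x \<noteq> {}"
    using abelian_subgroup.a_rcos_self[OF abelian_subgroup_N assms(2)] by blast
  ultimately show ?thesis
    by (simp add: quot_mod_def ring.defs module.defs FactRing_def)
qed

lemma Q_abelian_group: "abelian_group Q"
proof (rule abelian_groupI)
  show "\<exists>y\<in>carrier Q. y \<oplus>\<^bsub>Q\<^esub> x = \<zero>\<^bsub>Q\<^esub>" if x: "x \<in> carrier Q" for x
  proof -
    obtain v where v: "x = N +>\<^bsub>V\<^esub> v" "v \<in> carrier V" using x by (auto simp: Q_carrier)
    have "(N +>\<^bsub>V\<^esub> (\<ominus>\<^bsub>V\<^esub> v)) \<oplus>\<^bsub>Q\<^esub> x = \<zero>\<^bsub>Q\<^esub>" using v by (simp add: Q_add Q_zero M.l_neg)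
    then show ?thesis using v by (auto simp: Q_carrier)
  qed
qed (auto simp: Q_carrier Q_add Q_zero M.a_ac)

lemma Q_module: "module K Q"
  by (rule moduleI[OF R.is_cring Q_abelian_group])
    (auto simp: Q_carrier Q_add Q_smult smult_l_distr smult_r_distr smult_assoc1)

lemma proj_lin: "(\<lambda>x. N +>\<^bsub>V\<^esub> x) \<in> lin K V Q"
  by (rule linI) (auto simp: Q_carrier Q_add Q_smult)

lemma some_in_coset:
  assumes "x \<in> carrier V"
  shows "(SOME t. t \<in> N +>\<^bsub>V\<^esub> x) \<in> carrier V"
    and "N +>\<^bsub>V\<^esub> (SOME t. t \<in> N +>\<^bsub>V\<^esub> x) = N +>\<^bsub>V\<^esub> x"
    and "(SOME t. t \<in> N +>\<^bsub>V\<^esub> x) \<ominus>\<^bsub>V\<^esub> x \<in> N"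
proof -
  have e: "(SOME t. t \<in> N +>\<^bsub>V\<^esub> x) \<in> N +>\<^bsub>V\<^esub> x"
    by (rule someI) (rule abelian_subgroup.a_rcos_self[OF abelian_subgroup_N, OF assms])
  show c: "(SOME t. t \<in> N +>\<^bsub>V\<^esub> x) \<in> carrier V"
    using e assms abelian_subgroup.a_elemrcos_carrier[OF abelian_subgroup_N] by blast
  show "N +>\<^bsub>V\<^esub> (SOME t. t \<in> N +>\<^bsub>V\<^esub> x) = N +>\<^bsub>V\<^esub> x"
    using abelian_subgroup.a_repr_independence'[OF abelian_subgroup_N, OF e assms] by simp
  then show "(SOME t. t \<in> N +>\<^bsub>V\<^esub> x) \<ominus>\<^bsub>V\<^esub> x \<in> N"
    using c assms coset_eq_iff by simp
qed

text \<open>The chosen representative differs from x by an element of N, which f kills. This is the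
  well-definedness behind every map that is evaluated at \<open>SOME t. t \<in> X\<close>:
  \<open>tlift\<close>, the coproduct and counit of \<open>env_bialg\<close>, and
  \<open>env_act\<close>.\<close>

lemma lin_factor:
  assumes "module K W" and f: "f \<in> lin K V W" and ker: "\<And>n. n \<in> N \<Longrightarrow> f n = \<zero>\<^bsub>W\<^esub>"
    and x: "x \<in> carrier V"
  shows "f (SOME t. t \<in> N +>\<^bsub>V\<^esub> x) = f x"
proof -
  interpret W: module K W by fact
  let ?t = "SOME t. t \<in> N +>\<^bsub>V\<^esub> x"
  have "f ?t \<ominus>\<^bsub>W\<^esub> f x = \<zero>\<^bsub>W\<^esub>"
    using lin_diff[OF module_axioms assms(1) f some_in_coset(1)[OF x] x] ker some_in_coset(3)[OF x]
    by simp
  then show ?thesis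
    using W.diff_zero_imp_eq[OF lin_closed[OF f some_in_coset(1)[OF x]] lin_closed[OF f x]] by simp
qed

lemma lin_factor_lin:
  assumes "module K W" and f: "f \<in> lin K V W" and ker: "\<And>n. n \<in> N \<Longrightarrow> f n = \<zero>\<^bsub>W\<^esub>"
  shows "(\<lambda>X. f (SOME t. t \<in> X)) \<in> lin K Q W"
  by (rule linI)
    (auto simp: Q_carrier Q_add Q_smult lin_factor[OF assms] lin_add[OF f] lin_smult[OF f] lin_closed[OF f])

end

section \<open>Ideals and quotient algebras\<close>

lemma k_algebra_one_closed: "k_algebra K A \<Longrightarrow> \<one>\<^bsub>A\<^esub> \<in> carrier A"
  using k_algebra.alg_ring ring.is_monoid monoid.one_closed by metis

lemma k_algebra_mult_closed:
  "\<lbrakk>k_algebra K A; x \<in> carrier A; y \<in> carrier A\<rbrakk> \<Longrightarrow> x \<otimes>\<^bsub>A\<^esub> y \<in> carrier A"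
  using k_algebra.alg_ring ring.is_monoid monoid.m_closed by metis

text \<open>Scaling by a is left multiplication by a times the unit, so absorption of products gives
  absorption of scalars.\<close>

lemma (in k_algebra) ideal_submodule:
  assumes "ideal N A"
  shows "submodule N K A"
proof -
  interpret N: ideal N A by fact
  interpret M: module K A by (rule alg_module)
  show ?thesis
  proof (rule M.submoduleI_add_smult)
    show "a \<odot>\<^bsub>A\<^esub> x \<in> N" if a: "a \<in> carrier K" and x: "x \<in> N" for a x
    proof -
      have xc: "x \<in> carrier A" using x by (rule N.a_Hcarr)
      have "a \<odot>\<^bsub>A\<^esub> x = (a \<odot>\<^bsub>A\<^esub> \<one>\<^bsub>A\<^esub>) \<otimes>\<^bsub>A\<^esub> x"
        using smult_mult_left[OF a N.one_closed xc] by (simp add: xc)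
      then show ?thesis
        using N.I_l_closed[OF x M.smult_closed[OF a N.one_closed]] by simp
    qed
  qed (use N.a_subset in auto)
qed

locale quotient_algebra = k_algebra K A + ideal N A for K (structure) and A (structure) and N
begin

lemmas A_laws = m_assoc l_distr r_distr

sublocale quotient_module K A N
  by (intro quotient_module.intro alg_module ideal_submodule ideal_axioms)

lemma Q_mult: "\<lbrakk>x \<in> carrier A; y \<in> carrier A\<rbrakk> \<Longrightarrow>
    (N +>\<^bsub>A\<^esub> x) \<otimes>\<^bsub>Q\<^esub> (N +>\<^bsub>A\<^esub> y) = N +>\<^bsub>A\<^esub> (x \<otimes>\<^bsub>A\<^esub> y)"
  by (simp add: quot_mod_def ring.defs module.defs FactRing_def rcoset_mult_add)

lemma Q_ring: "ring Q"
proof (rule ringI[OF Q_abelian_group])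
  show "Group.monoid Q"
    by (rule monoidI) (auto simp: Q_carrier Q_mult Q_one A_laws)
qed (auto simp: Q_carrier Q_mult Q_add A_laws)

lemma Q_algebra: "k_algebra K Q"
  by (intro k_algebra.intro Q_module Q_ring)
    (auto simp: Q_carrier Q_mult Q_smult smult_mult_left smult_mult_right)

lemma proj_alg_hom: "(\<lambda>x. N +>\<^bsub>A\<^esub> x) \<in> alg_hom K A Q"
  using proj_lin unfolding alg_hom_def
  by (auto intro!: ring_hom_memI simp: Q_carrier Q_mult Q_add Q_one)

end

section \<open>The monoid algebra\<close>

abbreviation (input) supp :: "('k, 'r) ring_scheme \<Rightarrow> ('g \<Rightarrow> 'k) \<Rightarrow> 'g set" where
  "supp K f \<equiv> {x. f x \<noteq> \<zero>\<^bsub>K\<^esub>}"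

text \<open>The linear extension of \<phi> from the basis. Summing over the nonzero values in the
  whole type makes it literally the sum in \<open>tlift\<close>.\<close>

definition free_ext :: "('k, 'r) ring_scheme \<Rightarrow> ('k, 'p, 'o) module_scheme \<Rightarrow> ('g \<Rightarrow> 'p) \<Rightarrow> ('g \<Rightarrow> 'k) \<Rightarrow> 'p"
  where "free_ext K P \<phi> f = (\<Oplus>\<^bsub>P\<^esub>x\<in>supp K f. f x \<odot>\<^bsub>P\<^esub> \<phi> x)"

locale free_module = cring K for K (structure) +
  fixes G :: "('g, 'm) monoid_scheme"
begin

abbreviation "F \<equiv> monoid_algebra K G"
abbreviation "e \<equiv> basis_elt K"

lemma F_carrier: "f \<in> carrier F \<longleftrightarrow>
    (\<forall>x. f x \<in> carrier K) \<and> supp K f \<subseteq> carrier G \<and> finite (supp K f)"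
  by (auto simp: monoid_algebra_def)

lemma F_add: "f \<oplus>\<^bsub>F\<^esub> g = (\<lambda>x. f x \<oplus> g x)"
  and F_zero: "\<zero>\<^bsub>F\<^esub> = (\<lambda>x. \<zero>)"
  and F_one: "\<one>\<^bsub>F\<^esub> = e \<one>\<^bsub>G\<^esub>"
  and F_smult: "a \<odot>\<^bsub>F\<^esub> f = (\<lambda>x. a \<otimes> f x)"
  by (simp_all add: monoid_algebra_def basis_elt_def)

lemma supp_add: "\<lbrakk>f \<in> carrier F; g \<in> carrier F\<rbrakk> \<Longrightarrow> supp K (\<lambda>x. f x \<oplus> g x) \<subseteq> supp K f \<union> supp K g"
  by (auto simp: F_carrier)

lemma F_add_closed:
  assumes "f \<in> carrier F" "g \<in> carrier F"
  shows "(\<lambda>x. f x \<oplus> g x) \<in> carrier F"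
  using assms finite_subset[OF supp_add[OF assms]] supp_add[OF assms] unfolding F_carrier by auto

lemma F_smult_closed:
  assumes "a \<in> carrier K" "f \<in> carrier F"
  shows "(\<lambda>x. a \<otimes> f x) \<in> carrier F"
proof -
  have "supp K (\<lambda>x. a \<otimes> f x) \<subseteq> supp K f" using assms(1) by auto
  then show ?thesis
    using assms finite_subset unfolding F_carrier by blast
qed

lemma F_module: "module K F"
proof (rule moduleI)
  show "abelian_group F"
  proof (rule abelian_groupI)
    show "\<exists>g\<in>carrier F. g \<oplus>\<^bsub>F\<^esub> f = \<zero>\<^bsub>F\<^esub>" if f: "f \<in> carrier F" for f
      using f F_smult_closed[OF _ f, of "\<ominus> \<one>"]
      by (intro bexI[of _ "\<lambda>x. \<ominus> \<one> \<otimes> f x"]) (auto simp: F_add F_zero F_carrier l_minus l_neg)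
  qed (auto simp: F_add F_zero F_add_closed, auto simp: F_carrier a_ac)
qed (auto simp: is_cring F_add F_smult F_smult_closed, auto simp: F_carrier l_distr r_distr m_assoc)

sublocale F: module K F
  by (rule F_module)

lemma basis_closed: "x \<in> carrier G \<Longrightarrow> e x \<in> carrier F"
  by (auto simp: F_carrier basis_elt_def intro: finite_subset[of _ "{x}"])

lemma free_induct [consumes 1, case_names zero basis add smult]:
  assumes "f \<in> carrier F"
    and zero: "P \<zero>\<^bsub>F\<^esub>"
    and basis: "\<And>x. x \<in> carrier G \<Longrightarrow> P (e x)"
    and add: "\<And>f g. \<lbrakk>f \<in> carrier F; g \<in> carrier F; P f; P g\<rbrakk> \<Longrightarrow> P (f \<oplus>\<^bsub>F\<^esub> g)"
    and smult: "\<And>a f. \<lbrakk>a \<in> carrier K; f \<in> carrier F; P f\<rbrakk> \<Longrightarrow> P (a \<odot>\<^bsub>F\<^esub> f)"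
  shows "P f"
proof -
  \<comment> \<open>The support need only lie in S: removing the coefficient at one point then
    leaves a function covered by the induction hypothesis.\<close>
  have "\<forall>f \<in> carrier F. supp K f \<subseteq> S \<longrightarrow> P f" if "finite S" for S
    using that
  proof (induction S rule: finite_induct)
    case empty
    have "f = \<zero>\<^bsub>F\<^esub>" if "supp K f \<subseteq> {}" for f
      using that by (auto simp: F_zero)
    then show ?case using zero by blast
  next
    case (insert x S)
    show ?case
    proof (intro ballI impI)
      fix f assume f: "f \<in> carrier F" and s: "supp K f \<subseteq> insert x S"
      show "P f"
      proof (cases "f x = \<zero>")
        case True
        then have "supp K f \<subseteq> S" using s by auto
        then show ?thesis using insert f by blast
      next
        case False
        then have x: "x \<in> carrier G" "f x \<in> carrier K" using f by (auto simp: F_carrier)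
        define g where "g = f(x := \<zero>)"
        have sg: "supp K g = supp K f - {x}" by (auto simp: g_def)
        have g: "g \<in> carrier F"
          using f unfolding F_carrier sg by (auto simp: g_def)
        have "supp K g \<subseteq> S" using s unfolding sg by auto
        then have "P g" using insert g by blast
        moreover have "P (f x \<odot>\<^bsub>F\<^esub> e x)" using x basis smult basis_closed by blast
        moreover have "f = g \<oplus>\<^bsub>F\<^esub> (f x \<odot>\<^bsub>F\<^esub> e x)"
          using f x by (auto simp: F_add F_smult g_def basis_elt_def F_carrier)
        ultimately show ?thesis using add g x basis_closed F.smult_closed by metis
      qed
    qed
  qed
  then show ?thesis using assms(1) by (auto simp: F_carrier)
qed

text \<open>Common source of the inductions for tensor products and for the tensor algebra, both
  being quotients of a free module. Their versions lose the zero case by writing zero as the scalar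
  0 times a generator.\<close>

lemma free_quotient_induct:
  assumes N: "submodule N K F" and X: "X \<in> carrier (quot_mod F N)"
    and basis: "\<And>x. x \<in> carrier G \<Longrightarrow> P (N +>\<^bsub>F\<^esub> e x)"
    and add: "\<And>X Y. \<lbrakk>X \<in> carrier (quot_mod F N); Y \<in> carrier (quot_mod F N); P X; P Y\<rbrakk>
      \<Longrightarrow> P (X \<oplus>\<^bsub>quot_mod F N\<^esub> Y)"
    and smult: "\<And>a X. \<lbrakk>a \<in> carrier K; X \<in> carrier (quot_mod F N); P X\<rbrakk> \<Longrightarrow> P (a \<odot>\<^bsub>quot_mod F N\<^esub> X)"
    and zero: "P \<zero>\<^bsub>quot_mod F N\<^esub>"
  shows "P X"
proof -
  interpret Q: quotient_module K F N by (intro quotient_module.intro F_module N)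
  obtain f where f: "f \<in> carrier F" "X = N +>\<^bsub>F\<^esub> f" using X by (auto simp: Q.Q_carrier)
  note c = lin_closed[OF Q.proj_lin]
  have "P (N +>\<^bsub>F\<^esub> f)" using f(1)
  proof (induction rule: free_induct)
    case zero
    then show ?case using assms(6) by (simp add: Q.Q_zero)
  next
    case (basis x)
    then show ?case by (rule assms(3))
  next
    case (add f g)
    then show ?case using assms(4)[OF c c] by (simp add: Q.Q_add)
  next
    case (smult a f)
    then show ?case using assms(5)[OF _ c] by (simp add: Q.Q_smult)
  qed
  then show ?thesis by (simp add: f)
qed

text \<open>Points outside the support contribute zero. A common index set is needed for additivity,
  where f, g and their sum have different supports.\<close>

lemma free_ext_superset:
  assumes "module K P" and f: "f \<in> carrier F" and \<phi>: "\<phi> \<in> carrier G \<rightarrow> carrier P"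
    and A: "finite A" "supp K f \<subseteq> A" "A \<subseteq> carrier G"
  shows "free_ext K P \<phi> f = (\<Oplus>\<^bsub>P\<^esub>x\<in>A. f x \<odot>\<^bsub>P\<^esub> \<phi> x)"
proof -
  interpret P: module K P by fact
  show ?thesis
    unfolding free_ext_def
    by (rule P.add.finprod_mono_neutral_cong_left) (use f \<phi> A in \<open>auto simp: F_carrier Pi_iff\<close>)
qed

lemma free_ext_lin:
  assumes "module K P" and \<phi>: "\<phi> \<in> carrier G \<rightarrow> carrier P"
  shows "free_ext K P \<phi> \<in> lin K F P"
proof -
  interpret P: module K P by fact
  note sup = free_ext_superset[OF assms(1) _ \<phi>]
  have c: "(\<lambda>x. f x \<odot>\<^bsub>P\<^esub> \<phi> x) \<in> A \<rightarrow> carrier P" if "f \<in> carrier F" "A \<subseteq> carrier G" for f A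
    using that \<phi> by (auto simp: F_carrier)
  have \<phi>c: "\<phi> x \<in> carrier P" if "f \<in> carrier F" "f x \<noteq> \<zero>" for f x
    using that \<phi> by (auto simp: F_carrier)
  have fc: "f x \<in> carrier K" if "f \<in> carrier F" for f x
    using that by (simp add: F_carrier)
  show ?thesis
  proof (rule linI)
    fix f assume f: "f \<in> carrier F"
    show "free_ext K P \<phi> f \<in> carrier P"
      unfolding free_ext_def using c[OF f] f by (auto simp: F_carrier intro: P.finsum_closed)
    { fix a assume a: "a \<in> carrier K"
      have "free_ext K P \<phi> (a \<odot>\<^bsub>F\<^esub> f) = (\<Oplus>\<^bsub>P\<^esub>x\<in>supp K f. (a \<otimes> f x) \<odot>\<^bsub>P\<^esub> \<phi> x)"
      proof -
        have "supp K (\<lambda>x. a \<otimes> f x) \<subseteq> supp K f" using a by auto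
        then show ?thesis
          using sup[OF F.smult_closed[OF a f], where A = "supp K f"] f by (simp add: F_smult F_carrier)
      qed
      also have "\<dots> = (\<Oplus>\<^bsub>P\<^esub>x\<in>supp K f. a \<odot>\<^bsub>P\<^esub> (f x \<odot>\<^bsub>P\<^esub> \<phi> x))"
        by (rule P.finsum_cong') (use a in \<open>auto simp: \<phi>c[OF f] fc[OF f] P.smult_assoc1\<close>)
      also have "\<dots> = a \<odot>\<^bsub>P\<^esub> free_ext K P \<phi> f"
        unfolding free_ext_def
        by (rule P.finsum_smult_ldistr[symmetric]) (use a f c[OF f] in \<open>auto simp: F_carrier\<close>)
      finally show "free_ext K P \<phi> (a \<odot>\<^bsub>F\<^esub> f) = a \<odot>\<^bsub>P\<^esub> free_ext K P \<phi> f" . }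
    { fix g assume g: "g \<in> carrier F"
      let ?A = "supp K f \<union> supp K g"
      have A: "finite ?A" "?A \<subseteq> carrier G" using f g by (auto simp: F_carrier)
      have "free_ext K P \<phi> (f \<oplus>\<^bsub>F\<^esub> g) = (\<Oplus>\<^bsub>P\<^esub>x\<in>?A. (f x \<oplus> g x) \<odot>\<^bsub>P\<^esub> \<phi> x)"
        using sup[OF F.a_closed[OF f g] A(1) _ A(2)] supp_add[OF f g] by (simp add: F_add)
      also have "\<dots> = (\<Oplus>\<^bsub>P\<^esub>x\<in>?A. f x \<odot>\<^bsub>P\<^esub> \<phi> x \<oplus>\<^bsub>P\<^esub> g x \<odot>\<^bsub>P\<^esub> \<phi> x)"
        by (rule P.finsum_cong') (auto simp: \<phi>c[OF f] \<phi>c[OF g] fc[OF f] fc[OF g] P.smult_l_distr)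
      also have "\<dots> = (\<Oplus>\<^bsub>P\<^esub>x\<in>?A. f x \<odot>\<^bsub>P\<^esub> \<phi> x) \<oplus>\<^bsub>P\<^esub> (\<Oplus>\<^bsub>P\<^esub>x\<in>?A. g x \<odot>\<^bsub>P\<^esub> \<phi> x)"
        by (rule P.finsum_addf) (use c[OF f A(2)] c[OF g A(2)] in auto)
      also have "\<dots> = free_ext K P \<phi> f \<oplus>\<^bsub>P\<^esub> free_ext K P \<phi> g"
        using sup[OF f A(1) _ A(2)] sup[OF g A(1) _ A(2)] by simp
      finally show "free_ext K P \<phi> (f \<oplus>\<^bsub>F\<^esub> g) = free_ext K P \<phi> f \<oplus>\<^bsub>P\<^esub> free_ext K P \<phi> g" . }
  qed
qed

lemma free_ext_basis:
  assumes "module K P" and \<phi>: "\<phi> \<in> carrier G \<rightarrow> carrier P" and x: "x \<in> carrier G"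
  shows "free_ext K P \<phi> (e x) = \<phi> x"
proof -
  interpret P: module K P by fact
  have "free_ext K P \<phi> (e x) = (\<Oplus>\<^bsub>P\<^esub>y\<in>{x}. e x y \<odot>\<^bsub>P\<^esub> \<phi> y)"
    by (rule free_ext_superset[OF assms(1) basis_closed[OF x] \<phi>])
      (use x in \<open>auto simp: basis_elt_def\<close>)
  then show ?thesis
    using \<phi> x P.finsum_insert[of "{}" x "\<lambda>y. e x y \<odot>\<^bsub>P\<^esub> \<phi> y"]
    by (simp add: basis_elt_def Pi_iff)
qed

lemma free_lin_eq:
  assumes "module K P" and g: "g \<in> lin K F P" and h: "h \<in> lin K F P"
    and eq: "\<And>x. x \<in> carrier G \<Longrightarrow> g (e x) = h (e x)" and f: "f \<in> carrier F"
  shows "g f = h f"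
  using f
proof (induction rule: free_induct)
  case zero
  then show ?case using lin_zero[OF F_module assms(1) g] lin_zero[OF F_module assms(1) h] by simp
qed (simp_all add: eq lin_add[OF g] lin_add[OF h] lin_smult[OF g] lin_smult[OF h])

end

section \<open>Convolution and ideals in the monoid algebra\<close>

locale monoid_alg = free_module K G + G: Group.monoid G for K (structure) and G (structure)
begin

text \<open>The index set of the convolution sum varies with z and with both supports. A fixed
  rectangle, padded with zeros, lets sums for different factors be compared termwise.\<close>

lemma mult_expand:
  assumes f: "f \<in> carrier F" and g: "g \<in> carrier F"
    and A: "finite A" "supp K f \<subseteq> A" and B: "finite B" "supp K g \<subseteq> B"
  shows "(f \<otimes>\<^bsub>F\<^esub> g) z =
    (\<Oplus>p\<in>A \<times> B. if fst p \<otimes>\<^bsub>G\<^esub> snd p = z then f (fst p) \<otimes> g (snd p) else \<zero>)"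
proof -
  have c: "f x \<in> carrier K" "g x \<in> carrier K" for x
    using f g by (auto simp: F_carrier)
  have "(f \<otimes>\<^bsub>F\<^esub> g) z = (\<Oplus>p\<in>{(x, y). f x \<noteq> \<zero> \<and> g y \<noteq> \<zero> \<and> x \<otimes>\<^bsub>G\<^esub> y = z}. f (fst p) \<otimes> g (snd p))"
    by (simp add: monoid_algebra_def)
  also have "\<dots> = (\<Oplus>p\<in>A \<times> B. if fst p \<otimes>\<^bsub>G\<^esub> snd p = z then f (fst p) \<otimes> g (snd p) else \<zero>)"
    by (rule add.finprod_mono_neutral_cong_left) (use A B c in \<open>auto simp: Pi_iff\<close>)
  finally show ?thesis .
qed

lemma F_mult_closed:
  assumes f: "f \<in> carrier F" and g: "g \<in> carrier F"
  shows "f \<otimes>\<^bsub>F\<^esub> g \<in> carrier F"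
proof -
  have c: "f x \<in> carrier K" "g x \<in> carrier K" for x
    using f g by (auto simp: F_carrier)
  have fin: "finite (supp K f)" "finite (supp K g)" and s: "supp K f \<subseteq> carrier G" "supp K g \<subseteq> carrier G"
    using f g by (auto simp: F_carrier)
  note ex = mult_expand[OF f g fin(1) subset_refl fin(2) subset_refl]
  have "(f \<otimes>\<^bsub>F\<^esub> g) z \<in> carrier K" for z
    unfolding ex by (rule finsum_closed) (auto simp: c)
  moreover have sub: "supp K (f \<otimes>\<^bsub>F\<^esub> g) \<subseteq> (\<lambda>p. fst p \<otimes>\<^bsub>G\<^esub> snd p) ` (supp K f \<times> supp K g)"
  proof
    fix z assume z: "z \<in> supp K (f \<otimes>\<^bsub>F\<^esub> g)"
    show "z \<in> (\<lambda>p. fst p \<otimes>\<^bsub>G\<^esub> snd p) ` (supp K f \<times> supp K g)"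
    proof (rule ccontr)
      assume n: "z \<notin> (\<lambda>p. fst p \<otimes>\<^bsub>G\<^esub> snd p) ` (supp K f \<times> supp K g)"
      have "(f \<otimes>\<^bsub>F\<^esub> g) z = (\<Oplus>p\<in>supp K f \<times> supp K g. \<zero>)"
        unfolding ex by (rule finsum_cong') (use n in auto)
      then show False using z by simp
    qed
  qed
  moreover have "(\<lambda>p. fst p \<otimes>\<^bsub>G\<^esub> snd p) ` (supp K f \<times> supp K g) \<subseteq> carrier G"
    using s by (auto intro!: G.m_closed)
  ultimately show ?thesis
    unfolding F_carrier using finite_subset[OF sub] fin by auto
qed

lemma F_mult_lin_left:
  assumes g: "g \<in> carrier F"
  shows "(\<lambda>f. f \<otimes>\<^bsub>F\<^esub> g) \<in> lin K F F"
proof (rule linI)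
  fix f assume f: "f \<in> carrier F"
  show "f \<otimes>\<^bsub>F\<^esub> g \<in> carrier F" using F_mult_closed[OF f g] .
  have gc: "g x \<in> carrier K" and fc: "f x \<in> carrier K" for x
    using f g by (auto simp: F_carrier)
  have fin: "finite (supp K g)" "finite (supp K f)" using f g by (auto simp: F_carrier)
  { fix a assume a: "a \<in> carrier K"
    show "(a \<odot>\<^bsub>F\<^esub> f) \<otimes>\<^bsub>F\<^esub> g = a \<odot>\<^bsub>F\<^esub> (f \<otimes>\<^bsub>F\<^esub> g)"
    proof
      fix z
      have "supp K (a \<odot>\<^bsub>F\<^esub> f) \<subseteq> supp K f" using a by (auto simp: F_smult)
      then have "((a \<odot>\<^bsub>F\<^esub> f) \<otimes>\<^bsub>F\<^esub> g) z = (\<Oplus>p\<in>supp K f \<times> supp K g.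
          if fst p \<otimes>\<^bsub>G\<^esub> snd p = z then (a \<odot>\<^bsub>F\<^esub> f) (fst p) \<otimes> g (snd p) else \<zero>)"
        by (rule mult_expand[OF F.smult_closed[OF a f] g fin(2) _ fin(1) subset_refl])
      also have "\<dots> = (\<Oplus>p\<in>supp K f \<times> supp K g.
          a \<otimes> (if fst p \<otimes>\<^bsub>G\<^esub> snd p = z then f (fst p) \<otimes> g (snd p) else \<zero>))"
        by (rule finsum_cong') (auto simp: F_smult a gc fc m_assoc)
      also have "\<dots> = a \<otimes> (f \<otimes>\<^bsub>F\<^esub> g) z"
        unfolding mult_expand[OF f g fin(2) subset_refl fin(1) subset_refl]
        by (rule finsum_rdistr[symmetric]) (use a fin in \<open>auto simp: gc fc\<close>)
      finally show "((a \<odot>\<^bsub>F\<^esub> f) \<otimes>\<^bsub>F\<^esub> g) z = (a \<odot>\<^bsub>F\<^esub> (f \<otimes>\<^bsub>F\<^esub> g)) z" by (simp add: F_smult)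
    qed }
  { fix f' assume f': "f' \<in> carrier F"
    have fc': "f' x \<in> carrier K" for x using f' by (auto simp: F_carrier)
    let ?A = "supp K f \<union> supp K f'"
    have A: "finite ?A" using f f' by (auto simp: F_carrier)
    show "(f \<oplus>\<^bsub>F\<^esub> f') \<otimes>\<^bsub>F\<^esub> g = (f \<otimes>\<^bsub>F\<^esub> g) \<oplus>\<^bsub>F\<^esub> (f' \<otimes>\<^bsub>F\<^esub> g)"
    proof
      fix z
      have "supp K (f \<oplus>\<^bsub>F\<^esub> f') \<subseteq> ?A" using supp_add[OF f f'] by (simp add: F_add)
      then have "((f \<oplus>\<^bsub>F\<^esub> f') \<otimes>\<^bsub>F\<^esub> g) z = (\<Oplus>p\<in>?A \<times> supp K g.
          if fst p \<otimes>\<^bsub>G\<^esub> snd p = z then (f \<oplus>\<^bsub>F\<^esub> f') (fst p) \<otimes> g (snd p) else \<zero>)"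
        by (rule mult_expand[OF F.a_closed[OF f f'] g A _ fin(1) subset_refl])
      also have "\<dots> = (\<Oplus>p\<in>?A \<times> supp K g.
          (if fst p \<otimes>\<^bsub>G\<^esub> snd p = z then f (fst p) \<otimes> g (snd p) else \<zero>) \<oplus>
          (if fst p \<otimes>\<^bsub>G\<^esub> snd p = z then f' (fst p) \<otimes> g (snd p) else \<zero>))"
        by (rule finsum_cong') (auto simp: F_add gc fc fc' l_distr)
      also have "\<dots> = (f \<otimes>\<^bsub>F\<^esub> g) z \<oplus> (f' \<otimes>\<^bsub>F\<^esub> g) z"
        unfolding mult_expand[OF f g A Un_upper1 fin(1) subset_refl] mult_expand[OF f' g A Un_upper2 fin(1) subset_refl]
        by (rule finsum_addf) (auto simp: gc fc fc')
      finally show "((f \<oplus>\<^bsub>F\<^esub> f') \<otimes>\<^bsub>F\<^esub> g) z = ((f \<otimes>\<^bsub>F\<^esub> g) \<oplus>\<^bsub>F\<^esub> (f' \<otimes>\<^bsub>F\<^esub> g)) z"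
        by (simp add: F_add)
    qed }
qed

text \<open>Over the opposite monoid the factors of a convolution change places, K being
  commutative, so linearity in the left factor gives linearity in the right one.\<close>

lemma F_mult_lin_right:
  assumes f: "f \<in> carrier F"
  shows "(\<lambda>g. f \<otimes>\<^bsub>F\<^esub> g) \<in> lin K F F"
proof -
  define G' where "G' = \<lparr>carrier = carrier G, monoid.mult = (\<lambda>x y. y \<otimes>\<^bsub>G\<^esub> x), one = \<one>\<^bsub>G\<^esub>\<rparr>"
  interpret op: monoid_alg K G'
    by (intro monoid_alg.intro free_module.intro is_cring monoidI) (simp_all add: G'_def G.m_assoc)
  have F': "carrier op.F = carrier F" "lin K op.F op.F = lin K F F"
    by (simp_all add: lin_def monoid_algebra_def G'_def)
  have "f \<otimes>\<^bsub>F\<^esub> g = g \<otimes>\<^bsub>op.F\<^esub> f" if g: "g \<in> carrier F" for g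
  proof
    fix z
    have c: "f x \<in> carrier K" "g x \<in> carrier K" for x using f g by (auto simp: F_carrier)
    let ?S = "{(x, y). f x \<noteq> \<zero> \<and> g y \<noteq> \<zero> \<and> x \<otimes>\<^bsub>G\<^esub> y = z}"
    have "(g \<otimes>\<^bsub>op.F\<^esub> f) z = (\<Oplus>p\<in>prod.swap ` ?S. g (fst p) \<otimes> f (snd p))"
      by (simp add: monoid_algebra_def G'_def) (rule arg_cong[of _ _ "finsum K _"], force)
    also have "\<dots> = (\<Oplus>p\<in>?S. g (fst (prod.swap p)) \<otimes> f (snd (prod.swap p)))"
      by (rule finsum_reindex) (auto simp: c inj_on_def)
    also have "\<dots> = (\<Oplus>p\<in>?S. f (fst p) \<otimes> g (snd p))"
      by (rule finsum_cong') (auto simp: c m_comm)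
    finally show "(f \<otimes>\<^bsub>F\<^esub> g) z = (g \<otimes>\<^bsub>op.F\<^esub> f) z"
      by (simp add: monoid_algebra_def)
  qed
  then show ?thesis
    by (rule lin_cong[OF op.F_mult_lin_left[unfolded F', OF f] F_module])
qed

lemma basis_mult:
  assumes x: "x \<in> carrier G" and y: "y \<in> carrier G"
  shows "e x \<otimes>\<^bsub>F\<^esub> e y = e (x \<otimes>\<^bsub>G\<^esub> y)"
proof
  fix z
  have "(e x \<otimes>\<^bsub>F\<^esub> e y) z = (\<Oplus>p\<in>{x} \<times> {y}.
      if fst p \<otimes>\<^bsub>G\<^esub> snd p = z then e x (fst p) \<otimes> e y (snd p) else \<zero>)"
    by (rule mult_expand[OF basis_closed[OF x] basis_closed[OF y]]) (auto simp: basis_elt_def)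
  also have "\<dots> = (\<Oplus>p\<in>insert (x, y) {}.
      if fst p \<otimes>\<^bsub>G\<^esub> snd p = z then e x (fst p) \<otimes> e y (snd p) else \<zero>)"
    by simp
  also have "\<dots> = e (x \<otimes>\<^bsub>G\<^esub> y) z"
    by (subst finsum_insert) (auto simp: basis_elt_def)
  finally show "(e x \<otimes>\<^bsub>F\<^esub> e y) z = e (x \<otimes>\<^bsub>G\<^esub> y) z" .
qed

text \<open>Both sides are linear in each factor, so h, g and f are replaced by basis elements in
  turn, which leaves associativity of the monoid. No triple sum has to be rearranged.\<close>

lemma F_assoc:
  assumes f: "f \<in> carrier F" and g: "g \<in> carrier F" and h: "h \<in> carrier F"
  shows "(f \<otimes>\<^bsub>F\<^esub> g) \<otimes>\<^bsub>F\<^esub> h = f \<otimes>\<^bsub>F\<^esub> (g \<otimes>\<^bsub>F\<^esub> h)"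
proof -
  note L = F_mult_lin_left and R = F_mult_lin_right and C = F_mult_closed
  have 1: "(e x \<otimes>\<^bsub>F\<^esub> e y) \<otimes>\<^bsub>F\<^esub> h = e x \<otimes>\<^bsub>F\<^esub> (e y \<otimes>\<^bsub>F\<^esub> h)"
    if x: "x \<in> carrier G" and y: "y \<in> carrier G" for x y
    by (rule free_lin_eq[OF F_module R lin_comp[OF R R] _ h])
      (simp_all add: C basis_closed basis_mult x y G.m_assoc)
  have 2: "(e x \<otimes>\<^bsub>F\<^esub> g) \<otimes>\<^bsub>F\<^esub> h = e x \<otimes>\<^bsub>F\<^esub> (g \<otimes>\<^bsub>F\<^esub> h)" if x: "x \<in> carrier G" for x
    by (rule free_lin_eq[OF F_module lin_comp[OF L R] lin_comp[OF R L] _ g])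
      (simp_all add: 1 C basis_closed x h)
  show ?thesis
    by (rule free_lin_eq[OF F_module lin_comp[OF L L] L _ f]) (simp_all add: 2 C g h)
qed

lemma F_algebra: "k_algebra K F"
proof -
  have o: "\<one>\<^bsub>F\<^esub> \<in> carrier F" by (simp add: F_one basis_closed)
  have l1: "\<one>\<^bsub>F\<^esub> \<otimes>\<^bsub>F\<^esub> f = f" if f: "f \<in> carrier F" for f
    by (rule free_lin_eq[OF F_module F_mult_lin_right lin_id _ f])
      (simp_all add: F_one basis_closed basis_mult)
  have r1: "f \<otimes>\<^bsub>F\<^esub> \<one>\<^bsub>F\<^esub> = f" if f: "f \<in> carrier F" for f
    by (rule free_lin_eq[OF F_module F_mult_lin_left lin_id _ f])
      (simp_all add: F_one basis_closed basis_mult)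
  show ?thesis
  proof (intro k_algebra.intro F_module)
    show "ring F"
    proof (rule ringI[OF F.abelian_group_axioms])
      show "Group.monoid F"
        by (rule monoidI) (simp_all add: F_mult_closed o F_assoc l1 r1)
    qed (simp_all add: lin_add[OF F_mult_lin_left] lin_add[OF F_mult_lin_right])
  qed (simp_all add: lin_smult[OF F_mult_lin_left] lin_smult[OF F_mult_lin_right])
qed

text \<open>Absorption need only be tested on generators and basis elements. For a basis element,
  the vectors whose product with it lies in the span form a subspace containing R, hence the span;
  an arbitrary factor is then reached by linearity.\<close>

lemma span_ideal:
  assumes R: "R \<subseteq> carrier F"
    and l: "\<And>x r. \<lbrakk>x \<in> carrier G; r \<in> R\<rbrakk> \<Longrightarrow> e x \<otimes>\<^bsub>F\<^esub> r \<in> span_in K F R"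
    and r: "\<And>x r. \<lbrakk>x \<in> carrier G; r \<in> R\<rbrakk> \<Longrightarrow> r \<otimes>\<^bsub>F\<^esub> e x \<in> span_in K F R"
  shows "ideal (span_in K F R) F"
proof -
  define N where "N = span_in K F R"
  have sub: "submodule N K F" unfolding N_def by (rule span_in_submodule[OF F_module R])
  note N = F.submoduleE[OF sub]
  have Nc: "n \<in> carrier F" if "n \<in> N" for n using that N(1) by auto
  have pre: "submodule {n \<in> carrier F. h n \<in> N} K F" if h: "h \<in> lin K F F" for h
  proof (rule F.submoduleI_add_smult)
    show "\<zero>\<^bsub>F\<^esub> \<in> {n \<in> carrier F. h n \<in> N}"
      using lin_zero[OF F_module F_module h] sub[THEN submodule.axioms(1), THEN subgroup.one_closed] by simp
  qed (auto simp: lin_add[OF h] lin_smult[OF h] N)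
  have z: "\<zero>\<^bsub>F\<^esub> \<in> N" using sub[THEN submodule.axioms(1), THEN subgroup.one_closed] by simp
  have 1: "e x \<otimes>\<^bsub>F\<^esub> n \<in> N" if n: "n \<in> N" and x: "x \<in> carrier G" for n x
  proof -
    have "N \<subseteq> {n \<in> carrier F. e x \<otimes>\<^bsub>F\<^esub> n \<in> N}"
      unfolding N_def by (rule span_in_minimal[OF pre[OF F_mult_lin_right, unfolded N_def]])
        (use x R l in \<open>auto simp: basis_closed\<close>)
    then show ?thesis using n by auto
  qed
  have 2: "n \<otimes>\<^bsub>F\<^esub> e x \<in> N" if n: "n \<in> N" and x: "x \<in> carrier G" for n x
  proof -
    have "N \<subseteq> {n \<in> carrier F. n \<otimes>\<^bsub>F\<^esub> e x \<in> N}"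
      unfolding N_def by (rule span_in_minimal[OF pre[OF F_mult_lin_left, unfolded N_def]])
        (use x R r in \<open>auto simp: basis_closed\<close>)
    then show ?thesis using n by auto
  qed
  have "ideal N F"
  proof (rule idealI)
    show "ring F" using F_algebra by (rule k_algebra.alg_ring)
    show "subgroup N (add_monoid F)" using sub by (rule submodule.axioms)
    fix n f assume n: "n \<in> N" and f: "f \<in> carrier F"
    note nc = Nc[OF n]
    show "f \<otimes>\<^bsub>F\<^esub> n \<in> N"
      using f by (induction rule: free_induct)
        (simp_all add: 1 n z nc N lin_zero[OF F_module F_module F_mult_lin_left]
          lin_add[OF F_mult_lin_left] lin_smult[OF F_mult_lin_left])
    show "n \<otimes>\<^bsub>F\<^esub> f \<in> N"
      using f by (induction rule: free_induct)
        (simp_all add: 2 n z nc N lin_zero[OF F_module F_module F_mult_lin_right]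
          lin_add[OF F_mult_lin_right] lin_smult[OF F_mult_lin_right])
  qed
  then show ?thesis by (simp add: N_def)
qed

end

section \<open>Tensor products\<close>

locale tensor_product = V: module K V + W: module K W
  for K (structure) and V :: "('k, 'a, 'm) module_scheme" and W :: "('k, 'b, 'n) module_scheme"
begin

sublocale free_module K "V \<times>\<times> W"
  by (intro free_module.intro V.is_cring)

lemma rels_closed: "bilinearity_rels K V W \<subseteq> carrier F"
  unfolding bilinearity_rels_def Let_def
  by (auto intro!: F.minus_closed F.a_closed F.smult_closed basis_closed)

lemma null_submodule: "submodule (tensor_null K V W) K F"
  unfolding tensor_null_def by (rule span_in_submodule[OF F_module rels_closed])

sublocale quotient_module K F "tensor_null K V W"
  by (intro quotient_module.intro F_module null_submodule)

lemma tensor_eq: "tensor K V W = Q"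
  by (simp add: tensor_def)

lemma rel_coset_eq:
  assumes "x \<ominus>\<^bsub>F\<^esub> y \<in> bilinearity_rels K V W" "x \<in> carrier F" "y \<in> carrier F"
  shows "tensor_null K V W +>\<^bsub>F\<^esub> x = tensor_null K V W +>\<^bsub>F\<^esub> y"
  using assms span_in_incl[of "bilinearity_rels K V W" K F] coset_eq_iff[of x y]
  unfolding tensor_null_def by blast

lemma tens_in: "\<lbrakk>v \<in> carrier V; w \<in> carrier W\<rbrakk> \<Longrightarrow> tens K V W v w \<in> carrier (tensor K V W)"
  unfolding tens_def tensor_eq Q_carrier by (auto intro!: basis_closed imageI)

lemma tens_bilin: "tens K V W \<in> bilin K V W (tensor K V W)"
proof -
  have b: "e (v, w) \<in> carrier F" if "v \<in> carrier V" "w \<in> carrier W" for v w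
    using that by (simp add: basis_closed)
  have a1: "tens K V W (v \<oplus>\<^bsub>V\<^esub> v') w = tens K V W v w \<oplus>\<^bsub>Q\<^esub> tens K V W v' w"
    if h: "v \<in> carrier V" "v' \<in> carrier V" "w \<in> carrier W" for v v' w
    unfolding tens_def using h
    by (subst Q_add) ((simp_all add: b)[2], rule rel_coset_eq, auto simp: b bilinearity_rels_def Let_def)
  have a2: "tens K V W v (w \<oplus>\<^bsub>W\<^esub> w') = tens K V W v w \<oplus>\<^bsub>Q\<^esub> tens K V W v w'"
    if h: "v \<in> carrier V" "w \<in> carrier W" "w' \<in> carrier W" for v w w'
    unfolding tens_def using h
    by (subst Q_add) ((simp_all add: b)[2], rule rel_coset_eq, auto simp: b bilinearity_rels_def Let_def)
  have s1: "tens K V W (a \<odot>\<^bsub>V\<^esub> v) w = a \<odot>\<^bsub>Q\<^esub> tens K V W v w"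
    if h: "a \<in> carrier K" "v \<in> carrier V" "w \<in> carrier W" for a v w
    unfolding tens_def using h
    by (subst Q_smult) ((simp_all add: b)[2], rule rel_coset_eq, auto simp: b bilinearity_rels_def Let_def)
  have s2: "tens K V W v (a \<odot>\<^bsub>W\<^esub> w) = a \<odot>\<^bsub>Q\<^esub> tens K V W v w"
    if h: "a \<in> carrier K" "v \<in> carrier V" "w \<in> carrier W" for a v w
    unfolding tens_def using h
    by (subst Q_smult) ((simp_all add: b)[2], rule rel_coset_eq, auto simp: b bilinearity_rels_def Let_def)
  show ?thesis
    by (intro bilinI linI) (simp_all add: tens_in a1 a2 s1 s2 tensor_eq[symmetric])
qed

lemma tlift_eq: "tlift K P \<beta> X = free_ext K P (\<lambda>p. \<beta> (fst p) (snd p)) (SOME f. f \<in> X)"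
  by (simp add: tlift_def free_ext_def Let_def)

text \<open>Each relation vanishes by bilinearity, and the kernel is a subspace, so it contains
  their span. This makes \<open>tlift\<close> independent of the representative.\<close>

lemma ext_kills_null:
  assumes P: "module K P" and \<beta>: "\<beta> \<in> bilin K V W P" and n: "n \<in> tensor_null K V W"
  shows "free_ext K P (\<lambda>p. \<beta> (fst p) (snd p)) n = \<zero>\<^bsub>P\<^esub>"
proof -
  interpret P: module K P by fact
  let ?L = "free_ext K P (\<lambda>p. \<beta> (fst p) (snd p))"
  have c: "(\<lambda>p. \<beta> (fst p) (snd p)) \<in> carrier (V \<times>\<times> W) \<rightarrow> carrier P"
    using bilin_closed[OF \<beta>] by (auto simp: DirProd_def)
  note L = free_ext_lin[OF P c]
  have b: "e (v, w) \<in> carrier F" if "v \<in> carrier V" "w \<in> carrier W" for v w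
    using that by (simp add: basis_closed)
  have Le: "?L (e (v, w)) = \<beta> v w" if "v \<in> carrier V" "w \<in> carrier W" for v w
    using free_ext_basis[OF P c, of "(v, w)"] that by simp
  note bc = bilin_closed[OF \<beta>]
  have "?L r = \<zero>\<^bsub>P\<^esub>" if r: "r \<in> bilinearity_rels K V W" for r
    using r unfolding bilinearity_rels_def Let_def
    by (auto simp: lin_diff[OF F_module P L] lin_add[OF L] lin_smult[OF L] b Le bc P.diff_self
        lin_add[OF bilin_left[OF \<beta>]] lin_add[OF bilin_right[OF \<beta>]]
        lin_smult[OF bilin_left[OF \<beta>]] lin_smult[OF bilin_right[OF \<beta>]])
  then have "tensor_null K V W \<subseteq> {x \<in> carrier F. ?L x = \<zero>\<^bsub>P\<^esub>}"
    unfolding tensor_null_def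
    using span_in_minimal[OF kernel_submodule[OF F_module P L]] rels_closed by auto
  then show ?thesis using n by auto
qed

lemma tlift_lin:
  assumes P: "module K P" and \<beta>: "\<beta> \<in> bilin K V W P"
  shows "tlift K P \<beta> \<in> lin K (tensor K V W) P"
proof -
  have c: "(\<lambda>p. \<beta> (fst p) (snd p)) \<in> carrier (V \<times>\<times> W) \<rightarrow> carrier P"
    using bilin_closed[OF \<beta>] by (auto simp: DirProd_def)
  show ?thesis
    unfolding tensor_eq using lin_factor_lin[OF P free_ext_lin[OF P c] ext_kills_null[OF P \<beta>]]
    by (simp add: tlift_eq[abs_def])
qed

lemma tlift_tens:
  assumes P: "module K P" and \<beta>: "\<beta> \<in> bilin K V W P" and v: "v \<in> carrier V" and w: "w \<in> carrier W"
  shows "tlift K P \<beta> (tens K V W v w) = \<beta> v w"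
proof -
  have c: "(\<lambda>p. \<beta> (fst p) (snd p)) \<in> carrier (V \<times>\<times> W) \<rightarrow> carrier P"
    using bilin_closed[OF \<beta>] by (auto simp: DirProd_def)
  have b: "(v, w) \<in> carrier (V \<times>\<times> W)" using v w by simp
  show ?thesis
    unfolding tlift_eq tens_def
    using lin_factor[OF P free_ext_lin[OF P c] ext_kills_null[OF P \<beta>] basis_closed[OF b]]
      free_ext_basis[OF P c b] by simp
qed

lemma tensor_induct [consumes 1, case_names tens add smult]:
  assumes X: "X \<in> carrier (tensor K V W)"
    and t: "\<And>v w. \<lbrakk>v \<in> carrier V; w \<in> carrier W\<rbrakk> \<Longrightarrow> P (tens K V W v w)"
    and a: "\<And>X Y. \<lbrakk>X \<in> carrier (tensor K V W); Y \<in> carrier (tensor K V W); P X; P Y\<rbrakk>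
      \<Longrightarrow> P (X \<oplus>\<^bsub>tensor K V W\<^esub> Y)"
    and s: "\<And>a X. \<lbrakk>a \<in> carrier K; X \<in> carrier (tensor K V W); P X\<rbrakk>
      \<Longrightarrow> P (a \<odot>\<^bsub>tensor K V W\<^esub> X)"
  shows "P X"
  using null_submodule X[unfolded tensor_eq]
proof (rule free_quotient_induct)
  show "P (tensor_null K V W +>\<^bsub>F\<^esub> e x)" if "x \<in> carrier (V \<times>\<times> W)" for x
    using that t[of "fst x" "snd x"] by (auto simp: tens_def DirProd_def)
  interpret T: module K Q by (rule Q_module)
  have "P (\<zero>\<^bsub>K\<^esub> \<odot>\<^bsub>Q\<^esub> tens K V W \<zero>\<^bsub>V\<^esub> \<zero>\<^bsub>W\<^esub>)"
    by (intro s[unfolded tensor_eq] t tens_in[unfolded tensor_eq]) auto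
  then show "P \<zero>\<^bsub>Q\<^esub>"
    using tens_in[of "\<zero>\<^bsub>V\<^esub>" "\<zero>\<^bsub>W\<^esub>"] by (simp add: tensor_eq)
qed (simp_all add: a s flip: tensor_eq)

end

lemma tensor_module:
  assumes "module K V" "module K W"
  shows "module K (tensor K V W)"
proof -
  interpret tensor_product K V W using assms by (rule tensor_product.intro)
  show ?thesis unfolding tensor_eq by (rule Q_module)
qed

lemmas tens_bilin = tensor_product.tens_bilin[OF tensor_product.intro]
lemmas tlift_lin = tensor_product.tlift_lin[OF tensor_product.intro]
lemmas tlift_tens = tensor_product.tlift_tens[OF tensor_product.intro]
lemmas tens_closed = tensor_product.tens_in[OF tensor_product.intro]
lemmas tensor_induct = tensor_product.tensor_induct[OF tensor_product.intro, consumes 3, case_names tens add smult]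

lemma tensor_lin_eq:
  assumes V: "module K V" and W: "module K W" and g: "g \<in> lin K (tensor K V W) P"
    and h: "h \<in> lin K (tensor K V W) P"
    and eq: "\<And>v w. \<lbrakk>v \<in> carrier V; w \<in> carrier W\<rbrakk> \<Longrightarrow> g (tens K V W v w) = h (tens K V W v w)"
    and X: "X \<in> carrier (tensor K V W)"
  shows "g X = h X"
  using V W X
  by (induction rule: tensor_induct)
    (simp_all add: eq lin_add[OF g] lin_add[OF h] lin_smult[OF g] lin_smult[OF h])

text \<open>Only \<beta> is assumed bilinear: \<beta>' agrees with it on the carriers and inherits
  this. In rewriting a summand the obligation is thus met once, for whichever side is more
  convenient.\<close>

lemma tlift_cong:
  assumes V: "module K V" and W: "module K W" and P: "module K P" and X: "X \<in> carrier (tensor K V W)"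
    and \<beta>: "\<beta> \<in> bilin K V W P"
    and eq: "\<And>v w. \<lbrakk>v \<in> carrier V; w \<in> carrier W\<rbrakk> \<Longrightarrow> \<beta>' v w = \<beta> v w"
  shows "tlift K P \<beta>' X = tlift K P \<beta> X"
proof -
  have \<beta>': "\<beta>' \<in> bilin K V W P"
    by (rule bilin_cong[OF \<beta> V W eq])
  show ?thesis
    by (rule tensor_lin_eq[OF V W tlift_lin[OF V W P \<beta>'] tlift_lin[OF V W P \<beta>] _ X])
      (simp add: tlift_tens[OF V W P \<beta>] tlift_tens[OF V W P \<beta>'] eq)
qed

text \<open>Both sides are linear in X and agree on pure tensors. In Sweedler notation: a linear map
  may be applied to the summand.\<close>

lemma tlift_comp:
  assumes V: "module K V" and W: "module K W" and P: "module K P" and R: "module K R"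
    and \<beta>: "\<beta> \<in> bilin K V W P" and L: "L \<in> lin K P R" and X: "X \<in> carrier (tensor K V W)"
  shows "L (tlift K P \<beta> X) = tlift K R (\<lambda>v w. L (\<beta> v w)) X"
proof -
  have \<beta>': "(\<lambda>v w. L (\<beta> v w)) \<in> bilin K V W R"
    by (intro bilinI lin_comp[OF L] bilin_left[OF \<beta>] bilin_right[OF \<beta>])
  show ?thesis
    by (rule tensor_lin_eq[OF V W lin_comp[OF L tlift_lin[OF V W P \<beta>]] tlift_lin[OF V W R \<beta>'] _ X])
      (simp add: tlift_tens[OF V W P \<beta>] tlift_tens[OF V W R \<beta>'])
qed

text \<open>For fixed p the sum is linear in X, so the laws in p can be checked on pure tensors. An
  inner Sweedler sum is thereby linear in the variables of an outer one, which makes nested sums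
  bilinear.\<close>

lemma tlift_param_lin:
  assumes V: "module K V" and W: "module K W" and P: "module K P" and Q: "module K Q"
    and X: "X \<in> carrier (tensor K V W)"
    and \<beta>: "\<And>p. p \<in> carrier Q \<Longrightarrow> \<beta> p \<in> bilin K V W P"
    and lin: "\<And>v w. \<lbrakk>v \<in> carrier V; w \<in> carrier W\<rbrakk> \<Longrightarrow> (\<lambda>p. \<beta> p v w) \<in> lin K Q P"
  shows "(\<lambda>p. tlift K P (\<beta> p) X) \<in> lin K Q P"
proof -
  interpret P: module K P by fact
  interpret Q: module K Q by fact
  note tl = tlift_lin[OF V W P \<beta>] and tt = tlift_tens[OF V W P \<beta>]
  show ?thesis
  proof (rule linI)
    fix p assume p: "p \<in> carrier Q"
    show "tlift K P (\<beta> p) X \<in> carrier P" by (rule lin_closed[OF tl[OF p] X])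
    { fix q assume q: "q \<in> carrier Q"
      show "tlift K P (\<beta> (p \<oplus>\<^bsub>Q\<^esub> q)) X = tlift K P (\<beta> p) X \<oplus>\<^bsub>P\<^esub> tlift K P (\<beta> q) X"
        by (rule tensor_lin_eq[OF V W tl[OF Q.a_closed[OF p q]]
              lin_sum[OF P tl[OF p] tl[OF q] tensor_module[OF V W]] _ X])
          (simp add: tt p q lin_add[OF lin]) }
    { fix a assume a: "a \<in> carrier K"
      have sm: "(\<lambda>y. a \<odot>\<^bsub>P\<^esub> y) \<in> lin K P P"
        by (rule bilin_right[OF smult_bilin[OF P]]) (simp add: a)
      show "tlift K P (\<beta> (a \<odot>\<^bsub>Q\<^esub> p)) X = a \<odot>\<^bsub>P\<^esub> tlift K P (\<beta> p) X"
        by (rule tensor_lin_eq[OF V W tl[OF Q.smult_closed[OF a p]] lin_comp[OF sm tl[OF p]] _ X])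
          (simp add: tt p a lin_smult[OF lin]) }
  qed
qed

section \<open>Algebra homomorphisms\<close>

lemma alg_homI:
  assumes "h \<in> lin K A B" "h \<one>\<^bsub>A\<^esub> = \<one>\<^bsub>B\<^esub>"
    and "\<And>x y. \<lbrakk>x \<in> carrier A; y \<in> carrier A\<rbrakk> \<Longrightarrow> h (x \<otimes>\<^bsub>A\<^esub> y) = h x \<otimes>\<^bsub>B\<^esub> h y"
  shows "h \<in> alg_hom K A B"
  unfolding alg_hom_def using assms
  by (auto intro!: ring_hom_memI simp: lin_closed[OF assms(1)] lin_add[OF assms(1)])

lemma alg_hom_lin: "h \<in> alg_hom K A B \<Longrightarrow> h \<in> lin K A B"
  by (simp add: alg_hom_def)

lemma alg_hom_one: "h \<in> alg_hom K A B \<Longrightarrow> h \<one>\<^bsub>A\<^esub> = \<one>\<^bsub>B\<^esub>"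
  by (simp add: alg_hom_def ring_hom_one)

lemma alg_hom_mult:
  "\<lbrakk>h \<in> alg_hom K A B; x \<in> carrier A; y \<in> carrier A\<rbrakk> \<Longrightarrow> h (x \<otimes>\<^bsub>A\<^esub> y) = h x \<otimes>\<^bsub>B\<^esub> h y"
  by (simp add: alg_hom_def ring_hom_mult)

lemma alg_hom_id: "(\<lambda>x. x) \<in> alg_hom K A A"
  by (rule alg_homI) (auto simp: lin_id)

lemma alg_hom_comp:
  assumes g: "g \<in> alg_hom K B D" and f: "f \<in> alg_hom K A B"
  shows "(\<lambda>x. g (f x)) \<in> alg_hom K A D"
  by (rule alg_homI[OF lin_comp[OF alg_hom_lin[OF g] alg_hom_lin[OF f]]])
    (simp_all add: alg_hom_one[OF f] alg_hom_one[OF g] alg_hom_mult[OF f] alg_hom_mult[OF g]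
      lin_closed[OF alg_hom_lin[OF f]])

lemma kernel_ideal:
  assumes A: "k_algebra K A" and B: "k_algebra K B" and h: "h \<in> alg_hom K A B"
  shows "ideal {x \<in> carrier A. h x = \<zero>\<^bsub>B\<^esub>} A"
proof -
  interpret A: k_algebra K A by fact
  interpret B: k_algebra K B by fact
  interpret AR: ring A by (rule A.alg_ring)
  interpret BR: ring B by (rule B.alg_ring)
  show ?thesis
    by (rule idealI[OF A.alg_ring submodule.axioms(1)[OF kernel_submodule[OF A.alg_module B.alg_module alg_hom_lin[OF h]]]])
      (auto simp: alg_hom_mult[OF h] lin_closed[OF alg_hom_lin[OF h]])
qed

lemma mult_bilin:
  assumes "k_algebra K A"
  shows "monoid.mult A \<in> bilin K A A A"
proof -
  interpret k_algebra K A by fact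
  interpret AR: ring A by (rule alg_ring)
  show ?thesis
    by (intro bilinI linI) (simp_all add: AR.l_distr AR.r_distr smult_mult_left smult_mult_right)
qed

lemma base_alg_algebra:
  assumes "cring K"
  shows "k_algebra K (base_alg K)"
proof -
  interpret cring K by fact
  have ag: "abelian_group (base_alg K)"
    by (rule abelian_groupI) (auto simp: a_ac intro: bexI[of _ "\<ominus>\<^bsub>K\<^esub> x" for x] l_neg)
  show ?thesis
  proof (rule k_algebra.intro)
    show "module K (base_alg K)"
      by (rule moduleI[OF is_cring ag]) (simp_all add: l_distr r_distr m_assoc)
    show "ring (base_alg K)"
    proof (rule ringI[OF ag])
      show "Group.monoid (base_alg K)" by (rule monoidI) (simp_all add: m_assoc)
    qed (simp_all add: l_distr r_distr)
  qed (simp_all add: m_ac)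
qed

section \<open>The tensor product of algebras\<close>

locale tensor_algebras = A: k_algebra K A + B: k_algebra K B for K (structure) and A and B
begin

sublocale AR: ring A by (rule A.alg_ring)
sublocale BR: ring B by (rule B.alg_ring)
sublocale tensor_product K A B
  by (intro tensor_product.intro A.alg_module B.alg_module)
sublocale monoid_alg K "A \<times>\<times> B"
  by (intro monoid_alg.intro free_module_axioms DirProd_monoid AR.is_monoid BR.is_monoid)

lemma pair_basis: "\<lbrakk>a \<in> carrier A; b \<in> carrier B\<rbrakk> \<Longrightarrow> e (a, b) \<in> carrier F"
  by (simp add: basis_closed)

lemma pair_mult:
  "\<lbrakk>a \<in> carrier A; b \<in> carrier B; a' \<in> carrier A; b' \<in> carrier B\<rbrakk> \<Longrightarrow>
    e (a, b) \<otimes>\<^bsub>F\<^esub> e (a', b') = e (a \<otimes>\<^bsub>A\<^esub> a', b \<otimes>\<^bsub>B\<^esub> b')"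
  by (subst basis_mult) (simp_all add: DirProd_def)

text \<open>Multiplying by a basis element induces a bilinear map \<open>A \<times> B \<rightarrow> A \<otimes> B\<close>, hence preserves the
  bilinearity relations.\<close>

lemma null_ideal: "ideal (tensor_null K A B) F"
  unfolding tensor_null_def
proof (rule span_ideal[OF rels_closed], fold tensor_null_def)
  fix x r assume x: "x \<in> carrier (A \<times>\<times> B)" and r: "r \<in> bilinearity_rels K A B"
  obtain a b where xab: "x = (a, b)" and a: "a \<in> carrier A" and b: "b \<in> carrier B"
    using x by (auto simp: DirProd_def)
  have rn: "r \<in> tensor_null K A B" unfolding tensor_null_def by (rule subsetD[OF span_in_incl r])
  have rF: "r \<in> carrier F" by (rule subsetD[OF rels_closed r])
  \<comment> \<open>h r is tested in the quotient: h followed by the projection is the linear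
    extension of \<beta>, which vanishes on relations.\<close>
  have pres: "h r \<in> tensor_null K A B"
    if h: "h \<in> lin K F F" and \<beta>: "\<beta> \<in> bilin K A B Q"
      and eq: "\<And>v w. \<lbrakk>v \<in> carrier A; w \<in> carrier B\<rbrakk> \<Longrightarrow> tensor_null K A B +>\<^bsub>F\<^esub> h (e (v, w)) = \<beta> v w"
    for h \<beta>
  proof -
    have c: "(\<lambda>p. \<beta> (fst p) (snd p)) \<in> carrier (A \<times>\<times> B) \<rightarrow> carrier Q"
      using bilin_closed[OF \<beta>] by (auto simp: DirProd_def)
    have "tensor_null K A B +>\<^bsub>F\<^esub> h r = free_ext K Q (\<lambda>p. \<beta> (fst p) (snd p)) r"
    proof (rule free_lin_eq[OF Q_module lin_comp[OF proj_lin h] free_ext_lin[OF Q_module c] _ rF])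
      fix p assume p: "p \<in> carrier (A \<times>\<times> B)"
      then have "fst p \<in> carrier A" "snd p \<in> carrier B" by (auto simp: DirProd_def)
      then show "tensor_null K A B +>\<^bsub>F\<^esub> h (e p) = free_ext K Q (\<lambda>p. \<beta> (fst p) (snd p)) (e p)"
        using eq[of "fst p" "snd p"] free_ext_basis[OF Q_module c p] by simp
    qed
    then have "tensor_null K A B +>\<^bsub>F\<^esub> h r = \<zero>\<^bsub>Q\<^esub>"
      using ext_kills_null[OF Q_module \<beta> rn] by simp
    then show ?thesis using coset_zero_iff[OF lin_closed[OF h rF]] by simp
  qed
  note tb = tens_bilin[unfolded tensor_eq] and mA = mult_bilin[OF A.k_algebra_axioms]
    and mB = mult_bilin[OF B.k_algebra_axioms]
  show "e x \<otimes>\<^bsub>F\<^esub> r \<in> tensor_null K A B"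
  proof (rule pres[OF F_mult_lin_right[OF basis_closed[OF x]]])
    show "(\<lambda>v w. tens K A B (a \<otimes>\<^bsub>A\<^esub> v) (b \<otimes>\<^bsub>B\<^esub> w)) \<in> bilin K A B Q"
      by (rule bilinI)
        (rule lin_comp[OF bilin_right[OF tb] bilin_right[OF mB b]] lin_comp[OF bilin_left[OF tb] bilin_right[OF mA a]];
         simp add: a b)+
  qed (simp add: xab pair_mult a b tens_def)
  show "r \<otimes>\<^bsub>F\<^esub> e x \<in> tensor_null K A B"
  proof (rule pres[OF F_mult_lin_left[OF basis_closed[OF x]]])
    show "(\<lambda>v w. tens K A B (v \<otimes>\<^bsub>A\<^esub> a) (w \<otimes>\<^bsub>B\<^esub> b)) \<in> bilin K A B Q"
      by (rule bilinI)
        (rule lin_comp[OF bilin_right[OF tb] bilin_left[OF mB b]] lin_comp[OF bilin_left[OF tb] bilin_left[OF mA a]];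
         simp add: a b)+
  qed (simp add: xab pair_mult a b tens_def)
qed

sublocale QA: quotient_algebra K F "tensor_null K A B"
  by (intro quotient_algebra.intro F_algebra null_ideal)

lemma algebra: "k_algebra K (tensor K A B)"
  unfolding tensor_def by (rule QA.Q_algebra)

lemma tens_mult:
  "\<lbrakk>a \<in> carrier A; b \<in> carrier B; a' \<in> carrier A; b' \<in> carrier B\<rbrakk> \<Longrightarrow>
    tens K A B a b \<otimes>\<^bsub>tensor K A B\<^esub> tens K A B a' b' = tens K A B (a \<otimes>\<^bsub>A\<^esub> a') (b \<otimes>\<^bsub>B\<^esub> b')"
  unfolding tensor_def tens_def by (simp add: QA.Q_mult pair_basis pair_mult)

lemma one_tens: "\<one>\<^bsub>tensor K A B\<^esub> = tens K A B \<one>\<^bsub>A\<^esub> \<one>\<^bsub>B\<^esub>"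
proof -
  have "\<one>\<^bsub>A \<times>\<times> B\<^esub> = (\<one>\<^bsub>A\<^esub>, \<one>\<^bsub>B\<^esub>)" by (simp add: DirProd_def)
  then show ?thesis
    unfolding tensor_def tens_def by (simp only: Q_one F_one)
qed

end

lemmas tensor_algebra = tensor_algebras.algebra[OF tensor_algebras.intro]
lemmas tens_mult = tensor_algebras.tens_mult[OF tensor_algebras.intro]
lemmas one_tens = tensor_algebras.one_tens[OF tensor_algebras.intro]

section \<open>The tensor algebra\<close>

locale tensor_alg = V: module K V for K (structure) and V :: "('k, 'a, 'm) module_scheme"
begin

sublocale monoid_alg K "list_monoid V"
  by (intro monoid_alg.intro free_module.intro V.is_cring monoidI) (auto simp: list_monoid_def)

abbreviation "T \<equiv> tens_alg K V"
abbreviation "N \<equiv> tens_alg_null K V"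

definition word :: "'a list \<Rightarrow> ('a list \<Rightarrow> 'k) set" where
  "word xs = N +>\<^bsub>F\<^esub> e xs"

lemma lists_basis: "xs \<in> lists (carrier V) \<Longrightarrow> e xs \<in> carrier F"
  by (rule basis_closed) (simp add: list_monoid_def)

lemma lists_mult: "\<lbrakk>xs \<in> lists (carrier V); ys \<in> lists (carrier V)\<rbrakk> \<Longrightarrow> e xs \<otimes>\<^bsub>F\<^esub> e ys = e (xs @ ys)"
  by (subst basis_mult) (simp_all add: list_monoid_def)

lemma rels_closed: "multilinearity_rels K V \<subseteq> carrier F"
  unfolding multilinearity_rels_def Let_def
  by (auto intro!: F.minus_closed F.a_closed F.smult_closed lists_basis)

lemma rels_memI:
  "\<lbrakk>xs \<in> lists (carrier V); ys \<in> lists (carrier V); v \<in> carrier V; w \<in> carrier V\<rbrakk> \<Longrightarrow>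
    e (xs @ [v \<oplus>\<^bsub>V\<^esub> w] @ ys) \<ominus>\<^bsub>F\<^esub> (e (xs @ [v] @ ys) \<oplus>\<^bsub>F\<^esub> e (xs @ [w] @ ys)) \<in> multilinearity_rels K V"
  "\<lbrakk>xs \<in> lists (carrier V); ys \<in> lists (carrier V); a \<in> carrier K; v \<in> carrier V\<rbrakk> \<Longrightarrow>
    e (xs @ [a \<odot>\<^bsub>V\<^esub> v] @ ys) \<ominus>\<^bsub>F\<^esub> (a \<odot>\<^bsub>F\<^esub> e (xs @ [v] @ ys)) \<in> multilinearity_rels K V"
  unfolding multilinearity_rels_def Let_def by blast+

text \<open>A multilinearity relation times a word is again a relation, with a longer prefix or
  suffix; for this the relations carry the contexts xs and ys.\<close>

lemma null_ideal: "ideal N F"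
  unfolding tens_alg_null_def
proof (rule span_ideal[OF rels_closed])
  fix x r assume "x \<in> carrier (list_monoid V)" and r: "r \<in> multilinearity_rels K V"
  then have x: "x \<in> lists (carrier V)" by (simp add: list_monoid_def)
  note lin = F_mult_lin_right[OF lists_basis[OF x]] F_mult_lin_left[OF lists_basis[OF x]]
  note simps = lin_diff[OF F_module F_module lin(1)] lin_diff[OF F_module F_module lin(2)]
    lin_add[OF lin(1)] lin_add[OF lin(2)] lin_smult[OF lin(1)] lin_smult[OF lin(2)]
    lists_basis lists_mult x
  have 1: "e x \<otimes>\<^bsub>F\<^esub> r \<in> multilinearity_rels K V"
    using r rels_memI[of "x @ _"] x
    by (subst (asm) multilinearity_rels_def, unfold Let_def, elim UnE CollectE exE conjE)
      (simp_all add: simps)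
  have 2: "r \<otimes>\<^bsub>F\<^esub> e x \<in> multilinearity_rels K V"
    using r rels_memI[of _ "_ @ x"] x
    by (subst (asm) multilinearity_rels_def, unfold Let_def, elim UnE CollectE exE conjE)
      (simp_all add: simps)
  show "e x \<otimes>\<^bsub>F\<^esub> r \<in> span_in K F (multilinearity_rels K V)"
    "r \<otimes>\<^bsub>F\<^esub> e x \<in> span_in K F (multilinearity_rels K V)"
    by (rule subsetD[OF span_in_incl 1], rule subsetD[OF span_in_incl 2])
qed

sublocale QA: quotient_algebra K F N
  by (intro quotient_algebra.intro F_algebra null_ideal)

lemma algebra: "k_algebra K T"
  unfolding tens_alg_def by (rule QA.Q_algebra)

lemma word_closed: "xs \<in> lists (carrier V) \<Longrightarrow> word xs \<in> carrier T"
  by (simp add: tens_alg_def QA.Q_carrier word_def lists_basis)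

lemma word_append:
  "\<lbrakk>xs \<in> lists (carrier V); ys \<in> lists (carrier V)\<rbrakk> \<Longrightarrow> word (xs @ ys) = word xs \<otimes>\<^bsub>T\<^esub> word ys"
  unfolding tens_alg_def word_def by (simp add: QA.Q_mult lists_basis lists_mult)

lemma word_Nil: "word [] = \<one>\<^bsub>T\<^esub>"
  proof -
  have "\<one>\<^bsub>list_monoid V\<^esub> = []" by (simp add: list_monoid_def)
  then show ?thesis
    unfolding tens_alg_def word_def by (simp only: QA.Q_one F_one)
qed

lemma word_single: "word [v] = tens_alg_incl K V v"
  by (simp add: word_def tens_alg_incl_def)

section \<open>Generation and universal properties of the tensor algebra\<close>

lemma word_induct [consumes 1, case_names word add smult]:
  assumes t: "t \<in> carrier T"
    and b: "\<And>xs. xs \<in> lists (carrier V) \<Longrightarrow> P (word xs)"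
    and a: "\<And>x y. \<lbrakk>x \<in> carrier T; y \<in> carrier T; P x; P y\<rbrakk> \<Longrightarrow> P (x \<oplus>\<^bsub>T\<^esub> y)"
    and s: "\<And>a x. \<lbrakk>a \<in> carrier K; x \<in> carrier T; P x\<rbrakk> \<Longrightarrow> P (a \<odot>\<^bsub>T\<^esub> x)"
  shows "P t"
  using k_algebra.ideal_submodule[OF F_algebra null_ideal] t[unfolded tens_alg_def]
proof (rule free_quotient_induct)
  show "P (N +>\<^bsub>F\<^esub> e x)" if "x \<in> carrier (list_monoid V)" for x
    using that b[of x] by (simp add: word_def list_monoid_def)
  interpret T: module K T by (rule k_algebra.alg_module[OF algebra])
  have "P (\<zero>\<^bsub>K\<^esub> \<odot>\<^bsub>T\<^esub> word [])"
    by (intro s b word_closed) auto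
  then show "P \<zero>\<^bsub>quot_mod F N\<^esub>"
    using word_closed[of "[]"] by (simp flip: tens_alg_def)
qed (simp_all add: a s flip: tens_alg_def)

lemma incl_lin: "tens_alg_incl K V \<in> lin K V T"
proof (rule linI)
  have rel: "x \<ominus>\<^bsub>F\<^esub> y \<in> multilinearity_rels K V \<Longrightarrow> x \<in> carrier F \<Longrightarrow> y \<in> carrier F \<Longrightarrow> N +>\<^bsub>F\<^esub> x = N +>\<^bsub>F\<^esub> y" for x y
    using span_in_incl[of "multilinearity_rels K V" K F] QA.coset_eq_iff[of x y]
    unfolding tens_alg_null_def by blast
  have b: "e [v] \<in> carrier F" if "v \<in> carrier V" for v using that by (simp add: lists_basis)
  fix v assume v: "v \<in> carrier V"
  show "tens_alg_incl K V v \<in> carrier T" using word_closed[of "[v]"] v by (simp add: word_single)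
  { fix w assume w: "w \<in> carrier V"
    have "e ([] @ [v \<oplus>\<^bsub>V\<^esub> w] @ []) \<ominus>\<^bsub>F\<^esub> (e ([] @ [v] @ []) \<oplus>\<^bsub>F\<^esub> e ([] @ [w] @ [])) \<in> multilinearity_rels K V"
      unfolding multilinearity_rels_def Let_def using v w by blast
    then have "N +>\<^bsub>F\<^esub> e [v \<oplus>\<^bsub>V\<^esub> w] = N +>\<^bsub>F\<^esub> (e [v] \<oplus>\<^bsub>F\<^esub> e [w])"
      by (intro rel) (simp_all add: b v w)
    then show "tens_alg_incl K V (v \<oplus>\<^bsub>V\<^esub> w) = tens_alg_incl K V v \<oplus>\<^bsub>T\<^esub> tens_alg_incl K V w"
      by (simp add: tens_alg_incl_def tens_alg_def QA.Q_add b v w) }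
  { fix a assume a: "a \<in> carrier K"
    have "e ([] @ [a \<odot>\<^bsub>V\<^esub> v] @ []) \<ominus>\<^bsub>F\<^esub> (a \<odot>\<^bsub>F\<^esub> e ([] @ [v] @ [])) \<in> multilinearity_rels K V"
      unfolding multilinearity_rels_def Let_def using v a by blast
    then have "N +>\<^bsub>F\<^esub> e [a \<odot>\<^bsub>V\<^esub> v] = N +>\<^bsub>F\<^esub> (a \<odot>\<^bsub>F\<^esub> e [v])"
      by (intro rel) (simp_all add: b v a)
    then show "tens_alg_incl K V (a \<odot>\<^bsub>V\<^esub> v) = a \<odot>\<^bsub>T\<^esub> tens_alg_incl K V v"
      by (simp add: tens_alg_incl_def tens_alg_def QA.Q_smult b v a) }
qed

text \<open>A function on words that is linear in each letter kills the multilinearity relations. It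
  serves both for algebra maps, where a word goes to a product, and for actions, where it goes to an
  iterated action on a fixed element.\<close>

lemma multilinear_ext:
  assumes P: "module K P" and c: "\<phi> \<in> lists (carrier V) \<rightarrow> carrier P"
    and add: "\<And>xs ys v w. \<lbrakk>xs \<in> lists (carrier V); ys \<in> lists (carrier V); v \<in> carrier V; w \<in> carrier V\<rbrakk>
      \<Longrightarrow> \<phi> (xs @ [v \<oplus>\<^bsub>V\<^esub> w] @ ys) = \<phi> (xs @ [v] @ ys) \<oplus>\<^bsub>P\<^esub> \<phi> (xs @ [w] @ ys)"
    and sm: "\<And>xs ys a v. \<lbrakk>xs \<in> lists (carrier V); ys \<in> lists (carrier V); a \<in> carrier K; v \<in> carrier V\<rbrakk>
      \<Longrightarrow> \<phi> (xs @ [a \<odot>\<^bsub>V\<^esub> v] @ ys) = a \<odot>\<^bsub>P\<^esub> \<phi> (xs @ [v] @ ys)"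
  obtains L where "L \<in> lin K T P" "\<And>xs. xs \<in> lists (carrier V) \<Longrightarrow> L (word xs) = \<phi> xs"
proof
  interpret P: module K P by fact
  let ?L = "free_ext K P \<phi>"
  have c': "\<phi> \<in> carrier (list_monoid V) \<rightarrow> carrier P" using c by (simp add: list_monoid_def)
  note L = free_ext_lin[OF P c']
  have Le: "?L (e xs) = \<phi> xs" if "xs \<in> lists (carrier V)" for xs
    using free_ext_basis[OF P c', of xs] that by (simp add: list_monoid_def)
  have pc: "\<phi> xs \<in> carrier P" if "xs \<in> lists (carrier V)" for xs using c that by blast
  have "?L r = \<zero>\<^bsub>P\<^esub>" if r: "r \<in> multilinearity_rels K V" for r
    using r unfolding multilinearity_rels_def Let_def
    by (elim UnE CollectE exE conjE)
      (simp_all add: lin_diff[OF F_module P L] lin_add[OF L] lin_smult[OF L] lists_basis Le P.diff_self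
        pc add[simplified] sm[simplified])
  then have "N \<subseteq> {x \<in> carrier F. ?L x = \<zero>\<^bsub>P\<^esub>}"
    unfolding tens_alg_null_def
    using span_in_minimal[OF kernel_submodule[OF F_module P L]] rels_closed by auto
  then have k: "\<And>n. n \<in> N \<Longrightarrow> ?L n = \<zero>\<^bsub>P\<^esub>" by auto
  show "(\<lambda>X. ?L (SOME t. t \<in> X)) \<in> lin K T P"
    unfolding tens_alg_def by (rule QA.lin_factor_lin[OF P L k])
  show "?L (SOME t. t \<in> word xs) = \<phi> xs" if xs: "xs \<in> lists (carrier V)" for xs
    unfolding word_def by (rule trans[OF QA.lin_factor[OF P L k lists_basis[OF xs]] Le[OF xs]])
qed

text \<open>A word is the product of its letters, so the image of V generates T as an
  algebra.\<close>

lemma alg_induct [consumes 1, case_names one incl add smult mult]: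
  assumes t: "t \<in> carrier T"
    and one: "P \<one>\<^bsub>T\<^esub>"
    and incl: "\<And>v. v \<in> carrier V \<Longrightarrow> P (tens_alg_incl K V v)"
    and a: "\<And>x y. \<lbrakk>x \<in> carrier T; y \<in> carrier T; P x; P y\<rbrakk> \<Longrightarrow> P (x \<oplus>\<^bsub>T\<^esub> y)"
    and s: "\<And>a x. \<lbrakk>a \<in> carrier K; x \<in> carrier T; P x\<rbrakk> \<Longrightarrow> P (a \<odot>\<^bsub>T\<^esub> x)"
    and m: "\<And>x y. \<lbrakk>x \<in> carrier T; y \<in> carrier T; P x; P y\<rbrakk> \<Longrightarrow> P (x \<otimes>\<^bsub>T\<^esub> y)"
  shows "P t"
  using t
proof (induction rule: word_induct)
  case (word xs)
  then show ?case
  proof (induction xs)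
    case Nil
    then show ?case using one by (simp add: word_Nil)
  next
    case (Cons x xs)
    then have "word (x # xs) = tens_alg_incl K V x \<otimes>\<^bsub>T\<^esub> word xs"
      using word_append[of "[x]" xs] by (simp add: word_single)
    then show ?case using Cons m[of "tens_alg_incl K V x" "word xs"] incl word_closed[of "[x]"] word_closed
      by (simp add: word_single)
  qed
qed (simp_all add: a s)

lemma alg_hom_exists:
  assumes A: "k_algebra K A" and f: "f \<in> lin K V A"
  obtains h where "h \<in> alg_hom K T A" "\<And>v. v \<in> carrier V \<Longrightarrow> h (tens_alg_incl K V v) = f v"
proof -
  interpret A: k_algebra K A by fact
  interpret AR: ring A by (rule A.alg_ring)
  define \<phi> where "\<phi> = (\<lambda>xs. foldr (\<lambda>v y. f v \<otimes>\<^bsub>A\<^esub> y) xs \<one>\<^bsub>A\<^esub>)"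
  have c: "\<phi> xs \<in> carrier A" if "xs \<in> lists (carrier V)" for xs
    using that by (induction xs) (auto simp: \<phi>_def lin_closed[OF f])
  have app: "\<phi> (xs @ ys) = \<phi> xs \<otimes>\<^bsub>A\<^esub> \<phi> ys" if "xs \<in> lists (carrier V)" "ys \<in> lists (carrier V)" for xs ys
    using that c[OF that(2)] by (induction xs) (auto simp: \<phi>_def lin_closed[OF f] AR.m_assoc c[unfolded \<phi>_def])
  have sg: "\<phi> (v # xs) = f v \<otimes>\<^bsub>A\<^esub> \<phi> xs" for v xs by (simp add: \<phi>_def)
  note fs = lin_closed[OF f] lin_add[OF f] lin_smult[OF f]
  obtain L where L: "L \<in> lin K T A" and Lw: "\<And>xs. xs \<in> lists (carrier V) \<Longrightarrow> L (word xs) = \<phi> xs"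
  proof (rule multilinear_ext[OF A.alg_module, of \<phi>])
    show "\<phi> (xs @ [v \<oplus>\<^bsub>V\<^esub> w] @ ys) = \<phi> (xs @ [v] @ ys) \<oplus>\<^bsub>A\<^esub> \<phi> (xs @ [w] @ ys)"
      if "xs \<in> lists (carrier V)" "ys \<in> lists (carrier V)" "v \<in> carrier V" "w \<in> carrier V" for xs ys v w
      using that by (simp add: app sg c fs AR.l_distr AR.r_distr)
    show "\<phi> (xs @ [a \<odot>\<^bsub>V\<^esub> v] @ ys) = a \<odot>\<^bsub>A\<^esub> \<phi> (xs @ [v] @ ys)"
      if "xs \<in> lists (carrier V)" "ys \<in> lists (carrier V)" "a \<in> carrier K" "v \<in> carrier V" for xs ys v a
      using that by (simp add: app sg c fs A.smult_mult_left A.smult_mult_right)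
  qed (auto simp: c)
  show ?thesis
  proof
    interpret T: k_algebra K T by (rule algebra)
    note TA = mult_bilin[OF algebra] and AA = mult_bilin[OF A]
    show "L \<in> alg_hom K T A"
    proof (rule alg_homI[OF L])
      show "L \<one>\<^bsub>T\<^esub> = \<one>\<^bsub>A\<^esub>" using Lw[of "[]"] by (simp add: word_Nil \<phi>_def)
      fix x y assume x: "x \<in> carrier T" and y: "y \<in> carrier T"
      \<comment> \<open>On words multiplicativity is \<open>app\<close>; both sides being bilinear,
        it extends first in y and then in x.\<close>
      have 1: "L (word xs \<otimes>\<^bsub>T\<^esub> y) = L (word xs) \<otimes>\<^bsub>A\<^esub> L y" if xs: "xs \<in> lists (carrier V)" for xs
        using y
      proof (induction rule: word_induct)
        case (word ys)
        then show ?case using xs by (simp add: Lw app flip: word_append)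
      qed (simp_all add: lin_add[OF L] lin_smult[OF L] lin_closed[OF L] word_closed xs
            lin_add[OF bilin_right[OF TA]] lin_smult[OF bilin_right[OF TA]] bilin_closed[OF TA]
            lin_add[OF bilin_right[OF AA]] lin_smult[OF bilin_right[OF AA]])
      show "L (x \<otimes>\<^bsub>T\<^esub> y) = L x \<otimes>\<^bsub>A\<^esub> L y"
        using x
      proof (induction rule: word_induct)
        case (word xs)
        then show ?case by (rule 1)
      qed (simp_all add: lin_add[OF L] lin_smult[OF L] lin_closed[OF L] y
            lin_add[OF bilin_left[OF TA]] lin_smult[OF bilin_left[OF TA]] bilin_closed[OF TA]
            lin_add[OF bilin_left[OF AA]] lin_smult[OF bilin_left[OF AA]])
    qed
    show "L (tens_alg_incl K V v) = f v" if "v \<in> carrier V" for v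
      using Lw[of "[v]"] that by (simp add: word_single \<phi>_def lin_closed[OF f])
  qed
qed

text \<open>For a right action the first letter of a word acts first, so its value at y is a left
  fold of r; concatenation of words then becomes composition of actions.\<close>

lemma act_exists:
  assumes C: "module K C" and r: "r \<in> bilin K C V C"
  obtains act where "right_module K T C act"
    "\<And>y v. \<lbrakk>y \<in> carrier C; v \<in> carrier V\<rbrakk> \<Longrightarrow> act y (tens_alg_incl K V v) = r y v"
proof -
  interpret C: module K C by fact
  interpret T: k_algebra K T by (rule algebra)
  note TT = mult_bilin[OF algebra]
  have fl: "(\<lambda>y. foldl r y xs) \<in> lin K C C" if "xs \<in> lists (carrier V)" for xs
    using that
  proof (induction xs)
    case Nil
    then show ?case by (simp add: lin_id)
  next
    case (Cons v xs)
    then show ?case using lin_comp[of "\<lambda>y. foldl r y xs" K C C "\<lambda>y. r y v" C] bilin_left[OF r, of v] by simp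
  qed
  have ex: "\<exists>L. L \<in> lin K T C \<and> (\<forall>xs \<in> lists (carrier V). L (word xs) = foldl r y xs)" if y: "y \<in> carrier C" for y
  proof (rule multilinear_ext[OF C, of "foldl r y"])
    show "foldl r y \<in> lists (carrier V) \<rightarrow> carrier C" using lin_closed[OF fl y] by auto
  qed (auto simp: lin_closed[OF fl y] lin_add[OF bilin_right[OF r]] lin_smult[OF bilin_right[OF r]]
        lin_add[OF fl] lin_smult[OF fl] bilin_closed[OF r])
  define act where "act y = (SOME L. L \<in> lin K T C \<and> (\<forall>xs \<in> lists (carrier V). L (word xs) = foldl r y xs))" for y
  have act: "act y \<in> lin K T C" "\<And>xs. xs \<in> lists (carrier V) \<Longrightarrow> act y (word xs) = foldl r y xs"
    if "y \<in> carrier C" for y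
    using someI_ex[OF ex[OF that]] unfolding act_def by auto
  \<comment> \<open>The map \<open>act y\<close> is chosen separately for each y, so the choices are
    tied together only by their values on words. Linearity in y is recovered from these by induction
    on t.\<close>
  have actl: "(\<lambda>y. act y t) \<in> lin K C C" if t: "t \<in> carrier T" for t
    using t
  proof (induction rule: word_induct)
    case (word xs)
    then show ?case by (intro lin_cong[OF fl C]) (auto simp: act)
  next
    case (add s t)
    show ?case
      by (rule lin_cong[OF lin_sum[OF C add(3,4) C] C]) (simp add: lin_add[OF act(1)] add)
  next
    case (smult a t)
    have sm: "(\<lambda>y. a \<odot>\<^bsub>C\<^esub> y) \<in> lin K C C"
      by (rule bilin_right[OF smult_bilin[OF C]]) (simp add: smult)
    show ?case
      by (rule lin_cong[OF lin_comp[OF sm smult(3)] C]) (simp add: lin_smult[OF act(1)] smult)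
  qed
  show ?thesis
  proof
    show "act y (tens_alg_incl K V v) = r y v" if "y \<in> carrier C" "v \<in> carrier V" for y v
      using act(2)[OF that(1), of "[v]"] that by (simp add: word_single)
    show "right_module K T C act"
    proof (intro right_module.intro algebra C bilinI act(1) actl)
      fix x assume x: "x \<in> carrier C"
      show "act x \<one>\<^bsub>T\<^esub> = x" using act(2)[OF x, of "[]"] by (simp add: word_Nil)
      fix s t assume s: "s \<in> carrier T" and t: "t \<in> carrier T"
      note ac = lin_closed[OF act(1)]
      have 1: "act x (word xs \<otimes>\<^bsub>T\<^esub> t) = act (act x (word xs)) t" if xs: "xs \<in> lists (carrier V)" for xs
        using t
      proof (induction rule: word_induct)
        case (word ys)
        then show ?case
          using xs x ac[OF x word_closed[OF xs]] lin_closed[OF fl x]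
          by (simp add: act flip: word_append)
      qed (simp_all add: lin_add[OF act(1)] lin_smult[OF act(1)] word_closed xs x ac
            lin_add[OF bilin_right[OF TT]] lin_smult[OF bilin_right[OF TT]] bilin_closed[OF TT])
      show "act x (s \<otimes>\<^bsub>T\<^esub> t) = act (act x s) t"
        using s
      proof (induction rule: word_induct)
        case (word xs)
        then show ?case by (rule 1)
      qed (simp_all add: lin_add[OF act(1)] lin_smult[OF act(1)] word_closed x t ac
            lin_add[OF bilin_left[OF TT]] lin_smult[OF bilin_left[OF TT]] bilin_closed[OF TT]
            lin_add[OF actl] lin_smult[OF actl])
    qed
  qed
qed

end

section \<open>Sweedler calculus\<close>

lemma tlift_arg_lin:
  "\<lbrakk>module K V; module K W; module K P; \<beta> \<in> bilin K V W P; f \<in> lin K X (tensor K V W)\<rbrakk>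
    \<Longrightarrow> (\<lambda>x. tlift K P \<beta> (f x)) \<in> lin K X P"
  by (rule lin_comp[OF tlift_lin])

lemma tlift_closed:
  "\<lbrakk>module K V; module K W; module K P; \<beta> \<in> bilin K V W P; X \<in> carrier (tensor K V W)\<rbrakk>
    \<Longrightarrow> tlift K P \<beta> X \<in> carrier P"
  by (rule lin_closed[OF tlift_lin])

text \<open>Fubini for independent Sweedler sums. Both sides are linear in X, and on a pure tensor
  the sum over X collapses on either side.\<close>

lemma tlift_exchange:
  assumes V: "module K V" and W: "module K W" and V': "module K V'" and W': "module K W'"
    and P: "module K P"
    and X: "X \<in> carrier (tensor K V W)" and Y: "Y \<in> carrier (tensor K V' W')"
    and \<tau>1: "\<And>a b. \<lbrakk>a \<in> carrier V; b \<in> carrier W\<rbrakk> \<Longrightarrow> \<tau> a b \<in> bilin K V' W' P"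
    and \<tau>2: "\<And>c d. \<lbrakk>c \<in> carrier V'; d \<in> carrier W'\<rbrakk> \<Longrightarrow> (\<lambda>a b. \<tau> a b c d) \<in> bilin K V W P"
  shows "tlift K P (\<lambda>a b. tlift K P (\<tau> a b) Y) X = tlift K P (\<lambda>c d. tlift K P (\<lambda>a b. \<tau> a b c d) X) Y"
proof -
  have l: "(\<lambda>a b. tlift K P (\<tau> a b) Y) \<in> bilin K V W P"
    by (intro bilinI tlift_param_lin[OF V' W' P _ Y] V W \<tau>1 bilin_left[OF \<tau>2] bilin_right[OF \<tau>2])
  \<comment> \<open>\<open>X\<close> is rebound here: linearity in X requires this bilinearity for
    every tensor.\<close>
  have r: "(\<lambda>c d. tlift K P (\<lambda>a b. \<tau> a b c d) X) \<in> bilin K V' W' P" if X: "X \<in> carrier (tensor K V W)" for X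
    by (intro bilinI tlift_param_lin[OF V W P _ X] V' W' \<tau>2 bilin_left[OF \<tau>1] bilin_right[OF \<tau>1])
  show ?thesis
  proof (rule tensor_lin_eq[OF V W tlift_lin[OF V W P l] _ _ X])
    show "(\<lambda>X. tlift K P (\<lambda>c d. tlift K P (\<lambda>a b. \<tau> a b c d) X) Y) \<in> lin K (tensor K V W) P"
      by (intro tlift_param_lin[OF V' W' P tensor_module[OF V W] Y] r tlift_lin[OF V W P] \<tau>2)
    show "tlift K P (\<lambda>a b. tlift K P (\<tau> a b) Y) (tens K V W v w) =
        tlift K P (\<lambda>c d. tlift K P (\<lambda>a b. \<tau> a b c d) (tens K V W v w)) Y"
      if v: "v \<in> carrier V" and w: "w \<in> carrier W" for v w
      unfolding tlift_tens[OF V W P l v w]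
      by (rule tlift_cong[OF V' W' P Y \<tau>1[OF v w], symmetric]) (rule tlift_tens[OF V W P \<tau>2 v w])
  qed
qed

lemma tmap_bilin:
  assumes V': "module K V'" and W': "module K W'" and f: "f \<in> lin K V V'" and g: "g \<in> lin K W W'"
  shows "(\<lambda>v w. tens K V' W' (f v) (g w)) \<in> bilin K V W (tensor K V' W')"
  by (intro bilinI bilin_lin_l[OF tens_bilin[OF V' W'] f] bilin_lin_r[OF tens_bilin[OF V' W'] g]
      lin_closed[OF f] lin_closed[OF g])

lemma tmap_lin:
  assumes V: "module K V" and W: "module K W" and V': "module K V'" and W': "module K W'"
    and f: "f \<in> lin K V V'" and g: "g \<in> lin K W W'"
  shows "tmap K V' W' f g \<in> lin K (tensor K V W) (tensor K V' W')"
  using tlift_lin[OF V W tensor_module[OF V' W'] tmap_bilin[OF V' W' f g]] by (simp add: tmap_def[abs_def])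

lemma tmap_tens:
  assumes V: "module K V" and W: "module K W" and V': "module K V'" and W': "module K W'"
    and f: "f \<in> lin K V V'" and g: "g \<in> lin K W W'" and v: "v \<in> carrier V" and w: "w \<in> carrier W"
  shows "tmap K V' W' f g (tens K V W v w) = tens K V' W' (f v) (g w)"
  unfolding tmap_def by (rule tlift_tens[OF V W tensor_module[OF V' W'] tmap_bilin[OF V' W' f g] v w])

text \<open>Change of variables in a Sweedler sum. For a coalgebra morphism f it turns sums over the
  coproduct of f x into sums over the coproduct of x.\<close>

lemma tlift_tmap:
  assumes V: "module K V" and W: "module K W" and V': "module K V'" and W': "module K W'"
    and P: "module K P" and f: "f \<in> lin K V V'" and g: "g \<in> lin K W W'"
    and \<beta>: "\<beta> \<in> bilin K V' W' P" and X: "X \<in> carrier (tensor K V W)"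
  shows "tlift K P \<beta> (tmap K V' W' f g X) = tlift K P (\<lambda>v w. \<beta> (f v) (g w)) X"
proof -
  have \<beta>': "(\<lambda>v w. \<beta> (f v) (g w)) \<in> bilin K V W P"
    by (intro bilinI bilin_lin_l[OF \<beta> f] bilin_lin_r[OF \<beta> g] lin_closed[OF f] lin_closed[OF g])
  show ?thesis
    by (rule tensor_lin_eq[OF V W lin_comp[OF tlift_lin[OF V' W' P \<beta>] tmap_lin[OF V W V' W' f g]]
          tlift_lin[OF V W P \<beta>'] _ X])
      (simp add: tmap_tens[OF V W V' W' f g] tlift_tens[OF V W P \<beta>'] tlift_tens[OF V' W' P \<beta>]
        lin_closed[OF f] lin_closed[OF g])
qed

text \<open>Multiplicativity is bilinear in X and Y, so it is checked on pure tensors, where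
  products are taken factorwise.\<close>

lemma tmap_alg_hom:
  assumes A: "k_algebra K A" and B: "k_algebra K B" and A': "k_algebra K A'" and B': "k_algebra K B'"
    and f: "f \<in> alg_hom K A A'" and g: "g \<in> alg_hom K B B'"
  shows "tmap K A' B' f g \<in> alg_hom K (tensor K A B) (tensor K A' B')"
proof -
  note m = k_algebra.alg_module[OF A] k_algebra.alg_module[OF B] k_algebra.alg_module[OF A'] k_algebra.alg_module[OF B']
  note fl = alg_hom_lin[OF f] and gl = alg_hom_lin[OF g]
  note L = tmap_lin[OF m fl gl] and t = tmap_tens[OF m fl gl]
  note M = mult_bilin[OF tensor_algebra[OF A B]] and M' = mult_bilin[OF tensor_algebra[OF A' B']]
  note cl = k_algebra_mult_closed[OF A] k_algebra_mult_closed[OF B] lin_closed[OF fl] lin_closed[OF gl]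
    k_algebra_one_closed[OF A] k_algebra_one_closed[OF B] lin_closed[OF L] tens_closed[OF m(1,2)] tens_closed[OF m(3,4)]
  show ?thesis
  proof (rule alg_homI[OF L])
    show "tmap K A' B' f g \<one>\<^bsub>tensor K A B\<^esub> = \<one>\<^bsub>tensor K A' B'\<^esub>"
      by (simp add: one_tens[OF A B] one_tens[OF A' B'] t cl alg_hom_one[OF f] alg_hom_one[OF g])
    fix X Y assume X: "X \<in> carrier (tensor K A B)" and Y: "Y \<in> carrier (tensor K A B)"
    have 1: "tmap K A' B' f g (tens K A B a b \<otimes>\<^bsub>tensor K A B\<^esub> Y)
        = tmap K A' B' f g (tens K A B a b) \<otimes>\<^bsub>tensor K A' B'\<^esub> tmap K A' B' f g Y"
      if ab: "a \<in> carrier A" "b \<in> carrier B" for a b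
      by (rule tensor_lin_eq[OF m(1,2) lin_comp[OF L bilin_right[OF M]] lin_comp[OF bilin_right[OF M'] L] _ Y])
        (simp_all add: ab cl tens_mult[OF A B] tens_mult[OF A' B'] t alg_hom_mult[OF f] alg_hom_mult[OF g])
    show "tmap K A' B' f g (X \<otimes>\<^bsub>tensor K A B\<^esub> Y)
        = tmap K A' B' f g X \<otimes>\<^bsub>tensor K A' B'\<^esub> tmap K A' B' f g Y"
      by (rule tensor_lin_eq[OF m(1,2) lin_comp[OF L bilin_left[OF M]] lin_comp[OF bilin_left[OF M'] L] _ X])
        (simp_all add: Y cl 1)
  qed
qed

text \<open>Both sides are linear in X and in Y, and on pure tensors they are \<beta> at the
  products. As the coproduct of a bialgebra is multiplicative, this evaluates a Sweedler sum over st
  as a double sum over s and t, which drives the product step of the later inductions.\<close>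

lemma tlift_prod:
  assumes A: "k_algebra K A" and B: "k_algebra K B" and P: "module K P" and \<beta>: "\<beta> \<in> bilin K A B P"
    and X: "X \<in> carrier (tensor K A B)" and Y: "Y \<in> carrier (tensor K A B)"
  shows "tlift K P \<beta> (X \<otimes>\<^bsub>tensor K A B\<^esub> Y) =
    tlift K P (\<lambda>a b. tlift K P (\<lambda>a' b'. \<beta> (a \<otimes>\<^bsub>A\<^esub> a') (b \<otimes>\<^bsub>B\<^esub> b')) Y) X"
proof -
  note mA = k_algebra.alg_module[OF A] and mB = k_algebra.alg_module[OF B]
  note M = mult_bilin[OF tensor_algebra[OF A B]] and MA = mult_bilin[OF A] and MB = mult_bilin[OF B]
  note L = tlift_lin[OF mA mB P]
  note rules = bilinI bilin_lin_l[OF \<beta>] bilin_lin_r[OF \<beta>] bilin_lin_l[OF MA] bilin_lin_l[OF MB]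
    bilin_lin_r[OF MA] bilin_lin_r[OF MB] lin_id bilin_closed[OF MA] bilin_closed[OF MB]
    tlift_param_lin[OF mA mB P _ Y] mA mB
  have b1: "(\<lambda>a' b'. \<beta> (a \<otimes>\<^bsub>A\<^esub> a') (b \<otimes>\<^bsub>B\<^esub> b')) \<in> bilin K A B P"
    if ab: "a \<in> carrier A" "b \<in> carrier B" for a b
    by (assumption | rule rules ab)+
  have b2: "(\<lambda>a b. tlift K P (\<lambda>a' b'. \<beta> (a \<otimes>\<^bsub>A\<^esub> a') (b \<otimes>\<^bsub>B\<^esub> b')) Y) \<in> bilin K A B P"
    by (assumption | rule rules)+
  have 1: "tlift K P \<beta> (tens K A B a b \<otimes>\<^bsub>tensor K A B\<^esub> Y)
      = tlift K P (\<lambda>a' b'. \<beta> (a \<otimes>\<^bsub>A\<^esub> a') (b \<otimes>\<^bsub>B\<^esub> b')) Y"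
    if ab: "a \<in> carrier A" "b \<in> carrier B" for a b
    by (rule tensor_lin_eq[OF mA mB lin_comp[OF L[OF \<beta>] bilin_right[OF M]] L[OF b1[OF ab]] _ Y])
      (simp_all add: ab tens_closed[OF mA mB] tens_mult[OF A B] tlift_tens[OF mA mB P \<beta>]
        tlift_tens[OF mA mB P b1[OF ab]] bilin_closed[OF MA] bilin_closed[OF MB])
  show ?thesis
    by (rule tensor_lin_eq[OF mA mB lin_comp[OF L[OF \<beta>] bilin_left[OF M Y]] L[OF b2] _ X])
      (simp add: 1 tlift_tens[OF mA mB P b2])
qed

text \<open>Three maps instead of one, because in the proof of coassociativity they depend on a further argument
  that is multiplied as well.\<close>

lemma tlift_mult:
  assumes A: "k_algebra K A" and B: "k_algebra K B" and P: "k_algebra K P"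
    and \<beta>: "\<beta> \<in> bilin K A B P" and \<gamma>: "\<gamma> \<in> bilin K A B P" and \<delta>: "\<delta> \<in> bilin K A B P"
    and mult: "\<And>a b a' b'. \<lbrakk>a \<in> carrier A; b \<in> carrier B; a' \<in> carrier A; b' \<in> carrier B\<rbrakk> \<Longrightarrow>
      \<delta> (a \<otimes>\<^bsub>A\<^esub> a') (b \<otimes>\<^bsub>B\<^esub> b') = \<beta> a b \<otimes>\<^bsub>P\<^esub> \<gamma> a' b'"
    and X: "X \<in> carrier (tensor K A B)" and Y: "Y \<in> carrier (tensor K A B)"
  shows "tlift K P \<delta> (X \<otimes>\<^bsub>tensor K A B\<^esub> Y) = tlift K P \<beta> X \<otimes>\<^bsub>P\<^esub> tlift K P \<gamma> Y"
proof -
  note mA = k_algebra.alg_module[OF A] and mB = k_algebra.alg_module[OF B] and mP = k_algebra.alg_module[OF P]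
  note M = mult_bilin[OF tensor_algebra[OF A B]] and MA = mult_bilin[OF A] and MB = mult_bilin[OF B]
    and MP = mult_bilin[OF P]
  note L = tlift_lin[OF mA mB mP] and t = tlift_tens[OF mA mB mP]
  have 1: "tlift K P \<delta> (tens K A B a b \<otimes>\<^bsub>tensor K A B\<^esub> Y) = \<beta> a b \<otimes>\<^bsub>P\<^esub> tlift K P \<gamma> Y"
    if ab: "a \<in> carrier A" "b \<in> carrier B" for a b
    by (rule tensor_lin_eq[OF mA mB lin_comp[OF L[OF \<delta>] bilin_right[OF M]]
          lin_comp[OF bilin_right[OF MP] L[OF \<gamma>]] _ Y])
      (simp_all add: ab tens_closed[OF mA mB] tens_mult[OF A B] t[OF \<delta>] t[OF \<gamma>] mult
        bilin_closed[OF MA] bilin_closed[OF MB] bilin_closed[OF \<beta>])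
  show ?thesis
    by (rule tensor_lin_eq[OF mA mB lin_comp[OF L[OF \<delta>] bilin_left[OF M Y]]
          lin_comp[OF bilin_left[OF MP] L[OF \<beta>]] _ X])
      (simp_all add: 1 t[OF \<beta>] lin_closed[OF L[OF \<gamma>] Y])
qed

lemma tlift_alg_hom:
  assumes A: "k_algebra K A" and B: "k_algebra K B" and P: "k_algebra K P"
    and \<beta>: "\<beta> \<in> bilin K A B P" and one: "\<beta> \<one>\<^bsub>A\<^esub> \<one>\<^bsub>B\<^esub> = \<one>\<^bsub>P\<^esub>"
    and mult: "\<And>a b a' b'. \<lbrakk>a \<in> carrier A; b \<in> carrier B; a' \<in> carrier A; b' \<in> carrier B\<rbrakk> \<Longrightarrow>
      \<beta> (a \<otimes>\<^bsub>A\<^esub> a') (b \<otimes>\<^bsub>B\<^esub> b') = \<beta> a b \<otimes>\<^bsub>P\<^esub> \<beta> a' b'"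
  shows "tlift K P \<beta> \<in> alg_hom K (tensor K A B) P"
proof -
  note mA = k_algebra.alg_module[OF A] and mB = k_algebra.alg_module[OF B] and mP = k_algebra.alg_module[OF P]
  show ?thesis
  proof (rule alg_homI[OF tlift_lin[OF mA mB mP \<beta>]])
    show "tlift K P \<beta> \<one>\<^bsub>tensor K A B\<^esub> = \<one>\<^bsub>P\<^esub>"
      by (simp add: one_tens[OF A B] tlift_tens[OF mA mB mP \<beta>] one k_algebra_one_closed[OF A] k_algebra_one_closed[OF B])
  qed (rule tlift_mult[OF A B P \<beta> \<beta> \<beta> mult])
qed

context coalgebra
begin

lemma comult_closed: "x \<in> carrier C \<Longrightarrow> comult C x \<in> carrier (tensor K C C)"
  by (rule lin_closed[OF comult_lin])

text \<open>The axiom compares two elements of C \<otimes> (C \<otimes> C). A trilinear \<tau>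
  factors through this space as \<open>tlift K P \<beta>\<close>, and applying that linear map to
  both elements gives the identity for \<tau>.\<close>

lemma coassoc_trilin:
  assumes P: "module K P" and x: "x \<in> carrier C"
    and \<tau>1: "\<And>a. a \<in> carrier C \<Longrightarrow> \<tau> a \<in> bilin K C C P"
    and \<tau>2: "\<And>b c. \<lbrakk>b \<in> carrier C; c \<in> carrier C\<rbrakk> \<Longrightarrow> (\<lambda>a. \<tau> a b c) \<in> lin K C P"
  shows "tlift K P (\<lambda>x1 x2. tlift K P (\<lambda>x11 x12. \<tau> x11 x12 x2) (comult C x1)) (comult C x)
    = tlift K P (\<lambda>x1 x2. tlift K P (\<tau> x1) (comult C x2)) (comult C x)"
proof -
  note C = coalg_module
  note CC = tensor_module[OF C C]
  note CCC = tensor_module[OF C CC]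
  note t2 = tens_bilin[OF C C] and t3 = tens_bilin[OF C CC]
  define \<beta> where "\<beta> = (\<lambda>a Y. tlift K P (\<tau> a) Y)"
  have \<beta>: "\<beta> \<in> bilin K C (tensor K C C) P"
    unfolding \<beta>_def by (intro bilinI tlift_lin[OF C C P \<tau>1] tlift_param_lin[OF C C P C] \<tau>1 \<tau>2)
  note L = tlift_lin[OF C CC P \<beta>]
  note rules = bilinI bilin_lin_l[OF t2] bilin_lin_r[OF t2] bilin_lin_l[OF t3] bilin_lin_r[OF t3] lin_id
    tens_closed[OF C C] tens_closed[OF C CC] tlift_param_lin[OF C C CCC C comult_closed]
    tlift_arg_lin[OF C C CCC] comult_lin
  have i: "(\<lambda>x11 x12. tens K C (tensor K C C) x11 (tens K C C x12 x2)) \<in> bilin K C C (tensor K C (tensor K C C))"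
    if x2: "x2 \<in> carrier C" for x2
    by (assumption | rule rules x2)+
  have o: "(\<lambda>x1 x2. tlift K (tensor K C (tensor K C C))
       (\<lambda>x11 x12. tens K C (tensor K C C) x11 (tens K C C x12 x2)) (comult C x1))
       \<in> bilin K C C (tensor K C (tensor K C C))"
    by (assumption | rule rules)+
  have r: "(\<lambda>x1 x2. tens K C (tensor K C C) x1 (comult C x2)) \<in> bilin K C C (tensor K C (tensor K C C))"
    by (assumption | rule rules comult_closed)+
  have ib: "(\<lambda>x11 x12. \<tau> x11 x12 x2) \<in> bilin K C C P" if x2: "x2 \<in> carrier C" for x2
    by (intro bilinI \<tau>2 x2 bilin_left[OF \<tau>1])
  have ob: "(\<lambda>x1 x2. tlift K P (\<lambda>x11 x12. \<tau> x11 x12 x2) (comult C x1)) \<in> bilin K C C P"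
    by (assumption | rule bilinI tlift_param_lin[OF C C P C comult_closed] tlift_arg_lin[OF C C P] comult_lin ib
        bilin_right[OF \<tau>1])+
  have rb: "(\<lambda>x1 x2. tlift K P (\<tau> x1) (comult C x2)) \<in> bilin K C C P"
    by (assumption | rule bilinI tlift_param_lin[OF C C P C comult_closed] tlift_arg_lin[OF C C P] comult_lin \<tau>1 \<tau>2)+
  have inner: "tlift K P \<beta> (tlift K (tensor K C (tensor K C C))
       (\<lambda>x11 x12. tens K C (tensor K C C) x11 (tens K C C x12 x2)) (comult C x1))
     = tlift K P (\<lambda>x11 x12. \<tau> x11 x12 x2) (comult C x1)"
    if x1: "x1 \<in> carrier C" and x2: "x2 \<in> carrier C" for x1 x2
    by (rule trans[OF tlift_comp[OF C C CCC P i[OF x2] L comult_closed[OF x1]]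
          tlift_cong[OF C C P comult_closed[OF x1] ib[OF x2]]])
      (simp only: tlift_tens[OF C CC P \<beta>] tens_closed[OF C C] x2, simp only: \<beta>_def tlift_tens[OF C C P \<tau>1] x2)
  have "tlift K P (\<lambda>x1 x2. tlift K P (\<lambda>x11 x12. \<tau> x11 x12 x2) (comult C x1)) (comult C x) =
     tlift K P \<beta> (tlift K (tensor K C (tensor K C C)) (\<lambda>x1 x2. tlift K (tensor K C (tensor K C C))
       (\<lambda>x11 x12. tens K C (tensor K C C) x11 (tens K C C x12 x2)) (comult C x1)) (comult C x))"
    unfolding tlift_comp[OF C C CCC P o L comult_closed[OF x]]
    by (rule tlift_cong[OF C C P comult_closed[OF x] ob, symmetric]) (rule inner)
  also have "\<dots> = tlift K P \<beta> (tlift K (tensor K C (tensor K C C)) (\<lambda>x1 x2. tens K C (tensor K C C) x1 (comult C x2)) (comult C x))"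
    using coassoc[OF x] by (simp add: sweedler_def)
  also have "\<dots> = tlift K P (\<lambda>x1 x2. tlift K P (\<tau> x1) (comult C x2)) (comult C x)"
    unfolding tlift_comp[OF C C CCC P r L comult_closed[OF x]]
    by (rule tlift_cong[OF C C P comult_closed[OF x] rb])
      (simp add: tlift_tens[OF C CC P \<beta>] comult_closed, simp add: \<beta>_def)
  finally show ?thesis .
qed

text \<open>Again the linear map induced by \<beta> is applied to both sides of the axiom, which
  speaks of the universal bilinear map only.\<close>

lemma cocomm_bilin:
  assumes cc: "cocommutative K C" and P: "module K P" and \<beta>: "\<beta> \<in> bilin K C C P" and x: "x \<in> carrier C"
  shows "tlift K P (\<lambda>a b. \<beta> b a) (comult C x) = tlift K P \<beta> (comult C x)"
proof -
  note C = coalg_module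
  note CC = tensor_module[OF C C]
  have t: "(\<lambda>a b. tens K C C b a) \<in> bilin K C C (tensor K C C)"
    by (intro bilinI bilin_left[OF tens_bilin[OF C C]] bilin_right[OF tens_bilin[OF C C]])
  have \<beta>': "(\<lambda>a b. \<beta> b a) \<in> bilin K C C P"
    by (intro bilinI bilin_left[OF \<beta>] bilin_right[OF \<beta>])
  have "tlift K P \<beta> (tlift K (tensor K C C) (\<lambda>x1 x2. tens K C C x2 x1) (comult C x)) = tlift K P \<beta> (comult C x)"
    using cc x by (simp add: cocommutative_def sweedler_def)
  then have "tlift K P (\<lambda>a b. tlift K P \<beta> (tens K C C b a)) (comult C x) = tlift K P \<beta> (comult C x)"
    unfolding tlift_comp[OF C C CC P t tlift_lin[OF C C P \<beta>] comult_closed[OF x]] .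
  moreover have "tlift K P (\<lambda>a b. tlift K P \<beta> (tens K C C b a)) (comult C x)
      = tlift K P (\<lambda>a b. \<beta> b a) (comult C x)"
    by (rule tlift_cong[OF C C P comult_closed[OF x] \<beta>']) (rule tlift_tens[OF C C P \<beta>])
  ultimately show ?thesis by simp
qed

text \<open>This is coassociativity for the trilinear map that sends a, b, z to the sum of \<tau> a
  b over the coproduct of z. It turns the balanced splitting (ab)(cd) into the nested one
  a(b(cd)).\<close>

lemma quad_coassoc:
  assumes P: "module K P" and x: "x \<in> carrier C"
    and \<tau>1: "\<And>a b. \<lbrakk>a \<in> carrier C; b \<in> carrier C\<rbrakk> \<Longrightarrow> \<tau> a b \<in> bilin K C C P"
    and \<tau>2: "\<And>c d. \<lbrakk>c \<in> carrier C; d \<in> carrier C\<rbrakk> \<Longrightarrow> (\<lambda>a b. \<tau> a b c d) \<in> bilin K C C P"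
  shows "tlift K P (\<lambda>y z. tlift K P (\<lambda>a b. tlift K P (\<tau> a b) (comult C z)) (comult C y)) (comult C x)
    = tlift K P (\<lambda>a s. tlift K P (\<lambda>b r. tlift K P (\<tau> a b) (comult C r)) (comult C s)) (comult C x)"
proof -
  note C = coalg_module
  note rules = bilinI \<tau>1 \<tau>2 bilin_left[OF \<tau>1] bilin_left[OF \<tau>2] bilin_right[OF \<tau>1] bilin_right[OF \<tau>2]
    comult_closed comult_lin C P
  show ?thesis
    by (rule coassoc_trilin[OF P x]; (assumption | rule rules tlift_param_lin[OF C C P C comult_closed]
      tlift_arg_lin[OF C C P])+)
qed

text \<open>In neither a(b(cd)) nor (ab)(cd) are the middle legs split off together. Coassociativity
  on the last three legs regroups them as (bc)d; there b and c are the two legs of one coproduct and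
  may be exchanged.\<close>

lemma cocomm_swap_middle:
  assumes cc: "cocommutative K C" and P: "module K P" and x: "x \<in> carrier C"
    and \<tau>1: "\<And>a b. \<lbrakk>a \<in> carrier C; b \<in> carrier C\<rbrakk> \<Longrightarrow> \<tau> a b \<in> bilin K C C P"
    and \<tau>2: "\<And>c d. \<lbrakk>c \<in> carrier C; d \<in> carrier C\<rbrakk> \<Longrightarrow> (\<lambda>a b. \<tau> a b c d) \<in> bilin K C C P"
  shows "tlift K P (\<lambda>y z. tlift K P (\<lambda>a b. tlift K P (\<lambda>c d. \<tau> a b c d) (comult C z)) (comult C y)) (comult C x)
    = tlift K P (\<lambda>y z. tlift K P (\<lambda>a b. tlift K P (\<lambda>c d. \<tau> a c b d) (comult C z)) (comult C y)) (comult C x)"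
proof -
  note C = coalg_module
  note rules = bilinI \<tau>1 \<tau>2 bilin_left[OF \<tau>1] bilin_left[OF \<tau>2] bilin_right[OF \<tau>1] bilin_right[OF \<tau>2]
    comult_closed comult_lin C P
  note tl = tlift_param_lin[OF C C P C comult_closed] tlift_arg_lin[OF C C P]
  have s1: "(\<lambda>c d. \<tau> a c b d) \<in> bilin K C C P" if "a \<in> carrier C" "b \<in> carrier C" for a b
    by (assumption | rule rules that)+
  have s2: "(\<lambda>a b. \<tau> a c b d) \<in> bilin K C C P" if "c \<in> carrier C" "d \<in> carrier C" for c d
    by (assumption | rule rules that)+
  have mid: "tlift K P (\<lambda>b r. tlift K P (\<lambda>c d. \<tau> a c b d) (comult C r)) (comult C s)
      = tlift K P (\<lambda>b r. tlift K P (\<lambda>c d. \<tau> a b c d) (comult C r)) (comult C s)"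
    if a: "a \<in> carrier C" and s: "s \<in> carrier C" for a s
  proof -
    have "tlift K P (\<lambda>b r. tlift K P (\<lambda>c d. \<tau> a c b d) (comult C r)) (comult C s)
        = tlift K P (\<lambda>m d. tlift K P (\<lambda>b c. \<tau> a c b d) (comult C m)) (comult C s)"
      by (rule coassoc_trilin[OF P s, symmetric]) (assumption | rule rules a)+
    also have "\<dots> = tlift K P (\<lambda>m d. tlift K P (\<lambda>b c. \<tau> a b c d) (comult C m)) (comult C s)"
      by (rule tlift_cong[OF C C P comult_closed[OF s]])
        ((assumption | rule rules a tl)+, (rule cocomm_bilin[OF cc P], (assumption | rule rules a)+))
    also have "\<dots> = tlift K P (\<lambda>b r. tlift K P (\<lambda>c d. \<tau> a b c d) (comult C r)) (comult C s)"
      by (rule coassoc_trilin[OF P s]) (assumption | rule rules a)+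
    finally show ?thesis .
  qed
  have b: "(\<lambda>a s. tlift K P (\<lambda>b r. tlift K P (\<tau> a b) (comult C r)) (comult C s)) \<in> bilin K C C P"
    by (assumption | rule rules tl)+
  show ?thesis
  proof (rule trans[OF quad_coassoc[OF P x, of \<tau>] trans[OF _ quad_coassoc[OF P x, of "\<lambda>a b c d. \<tau> a c b d", symmetric]]])
    show "tlift K P (\<lambda>a s. tlift K P (\<lambda>b r. tlift K P (\<tau> a b) (comult C r)) (comult C s)) (comult C x)
      = tlift K P (\<lambda>a s. tlift K P (\<lambda>b r. tlift K P (\<lambda>c d. \<tau> a c b d) (comult C r)) (comult C s)) (comult C x)"
      by (rule tlift_cong[OF C C P comult_closed[OF x] b, symmetric]) (rule mid)
  qed (simp_all add: \<tau>1 \<tau>2 s1 s2)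
qed

end

section \<open>Coalgebra structures\<close>

text \<open>U(C) is the bare algebra \<open>env_alg\<close> with coalgebra fields added, which
  changes the record. The following rules let notions that ignore these fields see through the
  extension, so that facts on quotients and tensor products carry over.\<close>

lemma with_coalg_simps [simp]:
  "carrier (with_coalg A \<Delta> \<epsilon>) = carrier A" "monoid.mult (with_coalg A \<Delta> \<epsilon>) = monoid.mult A"
  "one (with_coalg A \<Delta> \<epsilon>) = one A" "zero (with_coalg A \<Delta> \<epsilon>) = zero A" "add (with_coalg A \<Delta> \<epsilon>) = add A"
  "smult (with_coalg A \<Delta> \<epsilon>) = smult A" "comult (with_coalg A \<Delta> \<epsilon>) = \<Delta>" "counit (with_coalg A \<Delta> \<epsilon>) = \<epsilon>"
  by (simp_all add: with_coalg_def module.defs coalg.defs)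

lemma abelian_group_with_coalg [simp]: "abelian_group (with_coalg A \<Delta> \<epsilon>) \<longleftrightarrow> abelian_group A"
  by (simp add: abelian_group_def abelian_monoid_def abelian_group_axioms_def comm_group_def group_def
      group_axioms_def comm_monoid_def comm_monoid_axioms_def Group.monoid_def Units_def)

lemma lin_with_coalg [simp]:
  "lin K (with_coalg A \<Delta> \<epsilon>) W = lin K A W" "lin K V (with_coalg A \<Delta> \<epsilon>) = lin K V A"
  by (simp_all add: lin_def)

lemma module_with_coalg [simp]: "module K (with_coalg A \<Delta> \<epsilon>) \<longleftrightarrow> module K A"
  by (simp add: module_def module_axioms_def)

lemma monoid_with_coalg [simp]: "Group.monoid (with_coalg A \<Delta> \<epsilon>) \<longleftrightarrow> Group.monoid A"
  by (simp only: Group.monoid_def with_coalg_simps)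

lemma ring_with_coalg [simp]: "ring (with_coalg A \<Delta> \<epsilon>) \<longleftrightarrow> ring A"
  by (simp only: ring_def ring_axioms_def with_coalg_simps abelian_group_with_coalg monoid_with_coalg)

lemma k_algebra_with_coalg [simp]: "k_algebra K (with_coalg A \<Delta> \<epsilon>) \<longleftrightarrow> k_algebra K A"
  by (simp only: k_algebra_def with_coalg_simps module_with_coalg ring_with_coalg)

lemma alg_hom_with_coalg [simp]:
  "alg_hom K (with_coalg A \<Delta> \<epsilon>) B = alg_hom K A B" "alg_hom K B (with_coalg A \<Delta> \<epsilon>) = alg_hom K B A"
  by (simp_all add: alg_hom_def ring_hom_def)

lemma DirProd_with_coalg: "with_coalg A \<Delta> \<epsilon> \<times>\<times> with_coalg B \<Delta>' \<epsilon>' = A \<times>\<times> B"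
  "V \<times>\<times> with_coalg B \<Delta>' \<epsilon>' = V \<times>\<times> B" "with_coalg A \<Delta> \<epsilon> \<times>\<times> V = A \<times>\<times> V"
  by (simp_all add: DirProd_def)

lemma tensor_null_with_coalg [simp]:
  "tensor_null K (with_coalg A \<Delta> \<epsilon>) V = tensor_null K A V"
  "tensor_null K V (with_coalg A \<Delta> \<epsilon>) = tensor_null K V A"
  by (simp_all only: tensor_null_def bilinearity_rels_def DirProd_with_coalg with_coalg_simps)

lemma tensor_with_coalg [simp]:
  "tensor K (with_coalg A \<Delta> \<epsilon>) V = tensor K A V" "tensor K V (with_coalg A \<Delta> \<epsilon>) = tensor K V A"
  by (simp_all only: tensor_def DirProd_with_coalg tensor_null_with_coalg)

lemma tens_with_coalg [simp]:
  "tens K (with_coalg A \<Delta> \<epsilon>) V = tens K A V" "tens K V (with_coalg A \<Delta> \<epsilon>) = tens K V A"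
  by (simp_all only: tens_def[abs_def] DirProd_with_coalg tensor_null_with_coalg)

lemma tmap_with_coalg [simp]:
  "tmap K (with_coalg A \<Delta> \<epsilon>) V = tmap K A V" "tmap K V (with_coalg A \<Delta> \<epsilon>) = tmap K V A"
  by (simp_all add: tmap_def[abs_def])

lemma bilin_with_coalg [simp]: "bilin K V W (with_coalg A \<Delta> \<epsilon>) = bilin K V W A"
  by (simp add: bilin_def)

text \<open>All maps involved are linear on C \<otimes> D, so the morphism condition may be read on
  pure tensors, where the coproduct of the tensor coalgebra disappears. One direction is used for
  the rack product, the other for the action of U(C).\<close>

lemma tensor_coalg_hom_iff:
  assumes "coalgebra K C" and "coalgebra K D" and "coalgebra K E" and \<beta>: "\<beta> \<in> bilin K C D E"
  shows "tlift K E \<beta> \<in> coalg_hom K (tensor_coalg K C D) E \<longleftrightarrow>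
    (\<forall>c\<in>carrier C. \<forall>d\<in>carrier D.
      comult E (\<beta> c d) = tlift K (tensor K E E) (\<lambda>c1 c2. tlift K (tensor K E E)
        (\<lambda>d1 d2. tens K E E (\<beta> c1 d1) (\<beta> c2 d2)) (comult D d)) (comult C c) \<and>
      counit E (\<beta> c d) = counit C c \<otimes>\<^bsub>K\<^esub> counit D d)" (is "?hom \<longleftrightarrow> ?cond")
proof -
  interpret C: coalgebra K C by fact
  interpret D: coalgebra K D by fact
  interpret E: coalgebra K E by fact
  note mC = C.coalg_module and mD = D.coalg_module and mE = E.coalg_module
  have K: "cring K" using mC by (simp add: module_def)
  define CD where "CD = tensor K C D"
  define CDCD where "CDCD = tensor K CD CD"
  note mCD = tensor_module[OF mC mD, folded CD_def]
  note mCDCD = tensor_module[OF mCD mCD, folded CDCD_def]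
  note mEE = tensor_module[OF mE mE]
  note mK = k_algebra.alg_module[OF base_alg_algebra[OF K]]
  note tCD = tens_bilin[OF mC mD, folded CD_def] and tCDCD = tens_bilin[OF mCD mCD, folded CDCD_def]
    and tEE = tens_bilin[OF mE mE]
  note L = tlift_lin[OF mC mD mE \<beta>]
  note rules = bilinI lin_id \<beta> tCD tCDCD tEE mC mD mE mCD mCDCD mEE
    bilin_lin_l[OF tCDCD] bilin_lin_r[OF tCDCD] bilin_lin_l[OF tCD] bilin_lin_r[OF tCD]
    bilin_lin_l[OF tEE] bilin_lin_r[OF tEE] bilin_lin_l[OF \<beta>] bilin_lin_r[OF \<beta>]
    bilin_closed[OF tCD] bilin_closed[OF \<beta>] C.comult_closed D.comult_closed C.comult_lin D.comult_lin
  note pC = tlift_param_lin[OF mC mC mCDCD] tlift_arg_lin[OF mC mC mCDCD] tlift_param_lin[OF mD mD mCDCD] tlift_arg_lin[OF mD mD mCDCD]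
  note pE = tlift_param_lin[OF mC mC mEE] tlift_arg_lin[OF mC mC mEE] tlift_param_lin[OF mD mD mEE] tlift_arg_lin[OF mD mD mEE]
  define \<Delta> where "\<Delta> = (\<lambda>c d. tlift K CDCD (\<lambda>c1 c2. tlift K CDCD (\<lambda>d1 d2.
      tens K CD CD (tens K C D c1 d1) (tens K C D c2 d2)) (comult D d)) (comult C c))"
  define \<Gamma> where "\<Gamma> = (\<lambda>c d. tlift K (tensor K E E) (\<lambda>c1 c2. tlift K (tensor K E E) (\<lambda>d1 d2.
      tens K E E (\<beta> c1 d1) (\<beta> c2 d2)) (comult D d)) (comult C c))"
  have cm: "comult (tensor_coalg K C D) = tlift K CDCD \<Delta>"
    by (simp add: tensor_coalg_def Let_def sweedler_def CD_def CDCD_def \<Delta>_def)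
  have cu: "counit (tensor_coalg K C D) = tlift K (base_alg K) (\<lambda>c d. counit C c \<otimes>\<^bsub>K\<^esub> counit D d)"
    by (simp add: tensor_coalg_def Let_def)
  have ca: "carrier (tensor_coalg K C D) = carrier CD"
    by (simp add: tensor_coalg_def Let_def CD_def)
  have ln: "lin K (tensor_coalg K C D) E = lin K CD E"
    by (simp add: tensor_coalg_def Let_def CD_def)
  have d1: "(\<lambda>d1 d2. tens K CD CD (tens K C D c1 d1) (tens K C D c2 d2)) \<in> bilin K D D CDCD"
    if "c1 \<in> carrier C" "c2 \<in> carrier C" for c1 c2
    by (assumption | rule rules that)+
  have d2: "(\<lambda>c1 c2. tlift K CDCD (\<lambda>d1 d2. tens K CD CD (tens K C D c1 d1) (tens K C D c2 d2)) (comult D d)) \<in> bilin K C C CDCD"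
    if "d \<in> carrier D" for d
    by (assumption | rule rules pC that)+
  have \<Delta>: "\<Delta> \<in> bilin K C D CDCD"
    unfolding \<Delta>_def by (assumption | rule rules pC)+
  have e1: "(\<lambda>d1 d2. tens K E E (\<beta> c1 d1) (\<beta> c2 d2)) \<in> bilin K D D (tensor K E E)"
    if "c1 \<in> carrier C" "c2 \<in> carrier C" for c1 c2
    by (assumption | rule rules that)+
  have e2: "(\<lambda>c1 c2. tlift K (tensor K E E) (\<lambda>d1 d2. tens K E E (\<beta> c1 d1) (\<beta> c2 d2)) (comult D d)) \<in> bilin K C C (tensor K E E)"
    if "d \<in> carrier D" for d
    by (assumption | rule rules pE that)+
  have \<epsilon>: "(\<lambda>c d. counit C c \<otimes>\<^bsub>K\<^esub> counit D d) \<in> bilin K C D (base_alg K)"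
  proof -
    note m = mult_bilin[OF base_alg_algebra[OF K]]
    have "(\<lambda>c d. counit C c \<otimes>\<^bsub>base_alg K\<^esub> counit D d) \<in> bilin K C D (base_alg K)"
      by (assumption | rule bilinI bilin_lin_l[OF m] bilin_lin_r[OF m] C.counit_lin D.counit_lin
          lin_closed[OF C.counit_lin] lin_closed[OF D.counit_lin])+
    then show ?thesis by simp
  qed
  note M = tmap_lin[OF mCD mCD mE mE L[folded CD_def] L[folded CD_def], folded CDCD_def]
  \<comment> \<open>\<beta> \<otimes> \<beta> is pulled through both Sweedler sums and evaluated on
    the innermost tensors.\<close>
  have M\<Delta>: "tmap K E E (tlift K E \<beta>) (tlift K E \<beta>) (\<Delta> c d) = \<Gamma> c d" if c: "c \<in> carrier C" and d: "d \<in> carrier D" for c d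
    unfolding \<Delta>_def \<Gamma>_def
  proof (rule trans[OF tlift_comp[OF mC mC mCDCD mEE d2[OF d] M C.comult_closed[OF c]]
        tlift_cong[OF mC mC mEE C.comult_closed[OF c] e2[OF d]]])
    fix c1 c2 assume c12: "c1 \<in> carrier C" "c2 \<in> carrier C"
    show "tmap K E E (tlift K E \<beta>) (tlift K E \<beta>) (tlift K CDCD (\<lambda>d1 d2. tens K CD CD (tens K C D c1 d1) (tens K C D c2 d2)) (comult D d))
        = tlift K (tensor K E E) (\<lambda>d1 d2. tens K E E (\<beta> c1 d1) (\<beta> c2 d2)) (comult D d)"
    proof (rule trans[OF tlift_comp[OF mD mD mCDCD mEE d1[OF c12] M D.comult_closed[OF d]]
        tlift_cong[OF mD mD mEE D.comult_closed[OF d] e1[OF c12]]])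
      fix d1 d2 assume "d1 \<in> carrier D" "d2 \<in> carrier D"
      then show "tmap K E E (tlift K E \<beta>) (tlift K E \<beta>) (tens K CD CD (tens K C D c1 d1) (tens K C D c2 d2))
          = tens K E E (\<beta> c1 d1) (\<beta> c2 d2)"
        using c12 by (simp add: tmap_tens[OF mCD mCD mE mE L[folded CD_def] L[folded CD_def]]
            bilin_closed[OF tCD] tlift_tens[OF mC mD mE \<beta>])
    qed
  qed
  note \<Delta>t = tlift_tens[OF mC mD mCDCD \<Delta>] and \<epsilon>t = tlift_tens[OF mC mD mK \<epsilon>] and Lt = tlift_tens[OF mC mD mE \<beta>]
  show ?thesis
  proof
    assume h: ?hom
    have "comult E (tlift K E \<beta> X) = tmap K E E (tlift K E \<beta>) (tlift K E \<beta>) (tlift K CDCD \<Delta> X)"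
      "counit E (tlift K E \<beta> X) = tlift K (base_alg K) (\<lambda>c d. counit C c \<otimes>\<^bsub>K\<^esub> counit D d) X"
      if "X \<in> carrier CD" for X
      using h that by (simp_all add: coalg_hom_def ca cm cu)
    from this[OF bilin_closed[OF tCD]] show ?cond
      by (simp add: \<Delta>t \<epsilon>t Lt M\<Delta>) (simp add: \<Gamma>_def)
  next
    assume c: ?cond
    have "comult E (tlift K E \<beta> X) = tmap K E E (tlift K E \<beta>) (tlift K E \<beta>) (tlift K CDCD \<Delta> X)"
      if X: "X \<in> carrier (tensor K C D)" for X
      by (rule tensor_lin_eq[OF mC mD lin_comp[OF E.comult_lin L] lin_comp[OF M tlift_lin[OF mC mD mCDCD \<Delta>]] _ X])
        (simp add: \<Delta>t Lt M\<Delta>, simp add: \<Gamma>_def c)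
    moreover have "counit E (tlift K E \<beta> X) = tlift K (base_alg K) (\<lambda>c d. counit C c \<otimes>\<^bsub>K\<^esub> counit D d) X"
      if X: "X \<in> carrier (tensor K C D)" for X
      by (rule tensor_lin_eq[OF mC mD lin_comp[OF E.counit_lin L] tlift_lin[OF mC mD mK \<epsilon>] _ X])
        (simp add: \<epsilon>t Lt c)
    ultimately show ?hom
      using L by (simp add: coalg_hom_def ca cm cu ln CD_def)
  qed
qed

section \<open>The tensor algebra of a rack bialgebra\<close>

lemma alg_hom_cong:
  assumes h: "h \<in> alg_hom K A B" and A: "k_algebra K A" and eq: "\<And>x. x \<in> carrier A \<Longrightarrow> g x = h x"
  shows "g \<in> alg_hom K A B"
  by (rule alg_homI[OF lin_cong[OF alg_hom_lin[OF h] k_algebra.alg_module[OF A] eq]])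
    (simp_all add: eq k_algebra_one_closed[OF A] k_algebra_mult_closed[OF A] alg_hom_one[OF h] alg_hom_mult[OF h])

lemma right_module_cong:
  assumes "right_module K A M act"
    and eq: "\<And>x s. \<lbrakk>x \<in> carrier M; s \<in> carrier A\<rbrakk> \<Longrightarrow> act' x s = act x s"
  shows "right_module K A M act'"
proof -
  interpret right_module K A M act by fact
  show ?thesis
    by (intro right_module.intro alg act_module bilin_cong[OF act_bilin act_module k_algebra.alg_module[OF alg] eq])
      (simp_all add: eq k_algebra_one_closed[OF alg] k_algebra_mult_closed[OF alg] act_one act_mult
        bilin_closed[OF act_bilin])
qed

context rack_bialgebra
begin

abbreviation "T \<equiv> envT K C"
abbreviation "i \<equiv> envT_incl K C"
abbreviation "V \<equiv> counit_ker K C"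

lemma K_cring: "cring K"
  using coalg_module by (simp add: module_def)

lemmas base_module = k_algebra.alg_module[OF base_alg_algebra[OF K_cring]]

lemma V_carrier: "x \<in> carrier V \<longleftrightarrow> x \<in> carrier C \<and> counit C x = \<zero>\<^bsub>K\<^esub>"
  by (simp add: counit_ker_def)

lemma V_module: "module K V"
  using submodule.submodule_is_module[OF kernel_submodule[OF coalg_module base_module counit_lin] coalg_module]
  by (simp add: counit_ker_def)

lemma V_lin: "f \<in> lin K C P \<Longrightarrow> f \<in> lin K V P"
  by (auto simp: lin_def counit_ker_def)

lemma T_algebra: "k_algebra K T"
  unfolding envT_def by (rule tensor_alg.algebra[OF tensor_alg.intro[OF V_module]])

lemmas T_module = k_algebra.alg_module[OF T_algebra]

lemma reduced_in_V:
  assumes x: "x \<in> carrier C"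
  shows "x \<ominus>\<^bsub>C\<^esub> (counit C x \<odot>\<^bsub>C\<^esub> \<one>\<^bsub>C\<^esub>) \<in> carrier V"
    and "(counit C x \<odot>\<^bsub>C\<^esub> \<one>\<^bsub>C\<^esub>) \<oplus>\<^bsub>C\<^esub> (x \<ominus>\<^bsub>C\<^esub> (counit C x \<odot>\<^bsub>C\<^esub> \<one>\<^bsub>C\<^esub>)) = x"
proof -
  interpret C: module K C by (rule coalg_module)
  have ex: "counit C x \<in> carrier K" using lin_closed[OF counit_lin x] by simp
  have sc: "counit C x \<odot>\<^bsub>C\<^esub> \<one>\<^bsub>C\<^esub> \<in> carrier C" using ex one_closed by simp
  have "counit C (x \<ominus>\<^bsub>C\<^esub> (counit C x \<odot>\<^bsub>C\<^esub> \<one>\<^bsub>C\<^esub>)) = counit C x \<ominus>\<^bsub>base_alg K\<^esub> counit C x"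
    unfolding lin_diff[OF coalg_module base_module counit_lin x sc] lin_smult[OF counit_lin ex one_closed] counit_one
    using ex by simp
  also have "\<dots> = \<zero>\<^bsub>K\<^esub>"
    using abelian_group.diff_self[of "base_alg K" "counit C x"] base_module ex by (simp add: module_def)
  finally show "x \<ominus>\<^bsub>C\<^esub> (counit C x \<odot>\<^bsub>C\<^esub> \<one>\<^bsub>C\<^esub>) \<in> carrier V"
    using C.M.minus_closed[OF x sc] by (simp add: V_carrier)
  have "(counit C x \<odot>\<^bsub>C\<^esub> \<one>\<^bsub>C\<^esub>) \<oplus>\<^bsub>C\<^esub> (x \<oplus>\<^bsub>C\<^esub> \<ominus>\<^bsub>C\<^esub> (counit C x \<odot>\<^bsub>C\<^esub> \<one>\<^bsub>C\<^esub>)) = x"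
    using x sc C.M.a_lcomm[OF sc x C.M.a_inv_closed[OF sc]] C.M.r_neg[OF sc] by simp
  then show "(counit C x \<odot>\<^bsub>C\<^esub> \<one>\<^bsub>C\<^esub>) \<oplus>\<^bsub>C\<^esub> (x \<ominus>\<^bsub>C\<^esub> (counit C x \<odot>\<^bsub>C\<^esub> \<one>\<^bsub>C\<^esub>)) = x"
    by (simp only: a_minus_def)
qed

text \<open>Every x is \<epsilon>(x)1 plus an element of ker \<epsilon>. The definitions fix the
  structure maps of T on ker \<epsilon> only, while the relations of U(C) run over C.\<close>

lemma lin_eq_via_V:
  assumes f: "f \<in> lin K C P" and g: "g \<in> lin K C P" and one: "f \<one>\<^bsub>C\<^esub> = g \<one>\<^bsub>C\<^esub>"
    and eq: "\<And>v. v \<in> carrier V \<Longrightarrow> f v = g v" and x: "x \<in> carrier C"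
  shows "f x = g x"
proof -
  interpret C: module K C by (rule coalg_module)
  let ?s = "counit C x \<odot>\<^bsub>C\<^esub> \<one>\<^bsub>C\<^esub>" and ?v = "x \<ominus>\<^bsub>C\<^esub> (counit C x \<odot>\<^bsub>C\<^esub> \<one>\<^bsub>C\<^esub>)"
  have ex: "counit C x \<in> carrier K" using lin_closed[OF counit_lin x] by simp
  have sc: "?s \<in> carrier C" using ex one_closed by simp
  have vc: "?v \<in> carrier C" using reduced_in_V(1)[OF x] by (simp add: V_carrier)
  have "f (?s \<oplus>\<^bsub>C\<^esub> ?v) = g (?s \<oplus>\<^bsub>C\<^esub> ?v)"
    unfolding lin_add[OF f sc vc] lin_add[OF g sc vc] lin_smult[OF f ex one_closed] lin_smult[OF g ex one_closed]
      one eq[OF reduced_in_V(1)[OF x]] ..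
  then show ?thesis unfolding reduced_in_V(2)[OF x] .
qed

lemma incl_lin: "tens_alg_incl K V \<in> lin K V T"
  unfolding envT_def by (rule tensor_alg.incl_lin[OF tensor_alg.intro[OF V_module]])

lemma i_lin: "i \<in> lin K C T"
proof -
  interpret C: module K C by (rule coalg_module)
  interpret T: module K T by (rule T_module)
  have V1: "(\<lambda>x. counit C x \<odot>\<^bsub>C\<^esub> \<one>\<^bsub>C\<^esub>) \<in> lin K C C"
    by (rule bilin_lin_l[OF smult_bilin[OF coalg_module] counit_lin one_closed])
  have sub: "(\<lambda>x. x \<ominus>\<^bsub>C\<^esub> (counit C x \<odot>\<^bsub>C\<^esub> \<one>\<^bsub>C\<^esub>)) \<in> lin K C V"
  proof -
    have m: "(\<lambda>x. \<ominus>\<^bsub>C\<^esub> x) \<in> lin K C C"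
      by (rule linI) (simp_all add: C.M.minus_add C.smult_r_minus)
    have "(\<lambda>x. x \<ominus>\<^bsub>C\<^esub> (counit C x \<odot>\<^bsub>C\<^esub> \<one>\<^bsub>C\<^esub>)) \<in> lin K C C"
      unfolding a_minus_def by (rule lin_sum[OF coalg_module lin_id lin_comp[OF m V1] coalg_module])
    \<comment> \<open>The values lie in ker \<epsilon>, which has the operations of C, so only the
      codomain changes.\<close>
    then show ?thesis
      using reduced_in_V(1) by (auto simp: lin_def counit_ker_def)
  qed
  have "(\<lambda>x. (counit C x \<odot>\<^bsub>T\<^esub> \<one>\<^bsub>T\<^esub>) \<oplus>\<^bsub>T\<^esub> tens_alg_incl K V (x \<ominus>\<^bsub>C\<^esub> (counit C x \<odot>\<^bsub>C\<^esub> \<one>\<^bsub>C\<^esub>))) \<in> lin K C T"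
    by (rule lin_sum[OF T_module bilin_lin_l[OF smult_bilin[OF T_module] counit_lin k_algebra_one_closed[OF T_algebra]]
          lin_comp[OF incl_lin sub] coalg_module])
  then show ?thesis by (simp add: envT_incl_def[abs_def])
qed

lemma i_V: "x \<in> carrier V \<Longrightarrow> i x = tens_alg_incl K V x"
proof -
  assume x: "x \<in> carrier V"
  interpret C: module K C by (rule coalg_module)
  interpret T: module K T by (rule T_module)
  have xc: "x \<in> carrier C" "counit C x = \<zero>\<^bsub>K\<^esub>" using x by (simp_all add: V_carrier)
  have "x \<ominus>\<^bsub>C\<^esub> \<zero>\<^bsub>C\<^esub> = x" using reduced_in_V(2)[OF xc(1)] xc one_closed C.M.minus_closed[OF xc(1) C.M.zero_closed] by simp
  then show "i x = tens_alg_incl K V x"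
    using xc one_closed k_algebra_one_closed[OF T_algebra] lin_closed[OF incl_lin x] by (simp add: envT_incl_def)
qed

lemma i_one: "i \<one>\<^bsub>C\<^esub> = \<one>\<^bsub>T\<^esub>"
proof -
  interpret C: module K C by (rule coalg_module)
  interpret T: module K T by (rule T_module)
  have "\<one>\<^bsub>C\<^esub> \<ominus>\<^bsub>C\<^esub> \<one>\<^bsub>C\<^esub> = \<zero>\<^bsub>V\<^esub>"
    using C.M.diff_self[OF one_closed] by (simp add: counit_ker_def)
  then show ?thesis
    using one_closed k_algebra_one_closed[OF T_algebra] lin_zero[OF V_module T_module incl_lin]
    by (simp add: envT_incl_def counit_one)
qed

lemma T_induct [consumes 1, case_names one incl add smult mult]:
  assumes "t \<in> carrier T" and "P \<one>\<^bsub>T\<^esub>" and incl: "\<And>x. x \<in> carrier V \<Longrightarrow> P (i x)"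
    and "\<And>x y. \<lbrakk>x \<in> carrier T; y \<in> carrier T; P x; P y\<rbrakk> \<Longrightarrow> P (x \<oplus>\<^bsub>T\<^esub> y)"
    and "\<And>a x. \<lbrakk>a \<in> carrier K; x \<in> carrier T; P x\<rbrakk> \<Longrightarrow> P (a \<odot>\<^bsub>T\<^esub> x)"
    and "\<And>x y. \<lbrakk>x \<in> carrier T; y \<in> carrier T; P x; P y\<rbrakk> \<Longrightarrow> P (x \<otimes>\<^bsub>T\<^esub> y)"
  shows "P t"
proof (rule tensor_alg.alg_induct[OF tensor_alg.intro[OF V_module], folded envT_def])
  show "P (tens_alg_incl K V v)" if "v \<in> carrier V" for v
    using incl[OF that] unfolding i_V[OF that] .
qed (fact assms)+

lemma T_hom_eq:
  assumes g: "g \<in> alg_hom K T A" and h: "h \<in> alg_hom K T A"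
    and eq: "\<And>x. x \<in> carrier V \<Longrightarrow> g (i x) = h (i x)" and t: "t \<in> carrier T"
  shows "g t = h t"
  using t
  by (induction rule: T_induct)
    (simp_all add: eq alg_hom_one[OF g] alg_hom_one[OF h] alg_hom_mult[OF g] alg_hom_mult[OF h]
      lin_add[OF alg_hom_lin[OF g]] lin_add[OF alg_hom_lin[OF h]] lin_smult[OF alg_hom_lin[OF g]] lin_smult[OF alg_hom_lin[OF h]])

text \<open>Extensionality turns agreement on T into equality of functions, as the definite
  descriptions of the structure maps demand.\<close>

lemma T_hom_eqI:
  assumes g: "g \<in> alg_hom K T A" "g \<in> extensional (carrier T)"
    and h: "h \<in> alg_hom K T A" "h \<in> extensional (carrier T)"
    and eq: "\<And>x. x \<in> carrier V \<Longrightarrow> g (i x) = h (i x)"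
  shows "g = h"
  by (rule extensionalityI[OF g(2) h(2)]) (rule T_hom_eq[OF g(1) h(1) eq])

text \<open>The universal property uses f on ker \<epsilon>. The condition at 1 makes the formula
  hold on all of C, because \<open>i\<close> sends 1 to the unit.\<close>

lemma T_hom_exists:
  assumes A: "k_algebra K A" and f: "f \<in> lin K C A" and one: "f \<one>\<^bsub>C\<^esub> = \<one>\<^bsub>A\<^esub>"
  obtains h where "h \<in> alg_hom K T A" "h \<in> extensional (carrier T)" "\<And>x. x \<in> carrier C \<Longrightarrow> h (i x) = f x"
proof -
  obtain h where h: "h \<in> alg_hom K T A" and hv: "\<And>v. v \<in> carrier V \<Longrightarrow> h (tens_alg_incl K V v) = f v"
    using tensor_alg.alg_hom_exists[OF tensor_alg.intro[OF V_module] A V_lin[OF f], folded envT_def] by blast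
  show ?thesis
  proof
    show "restrict h (carrier T) \<in> alg_hom K T A"
      by (rule alg_hom_cong[OF h T_algebra]) simp
    fix x assume x: "x \<in> carrier C"
    have "h (i x) = f x"
      by (rule lin_eq_via_V[OF lin_comp[OF alg_hom_lin[OF h] i_lin] f _ _ x])
        (simp_all add: i_one one alg_hom_one[OF h] i_V hv)
    then show "restrict h (carrier T) (i x) = f x"
      using lin_closed[OF i_lin x] by simp
  qed auto
qed

text \<open>The prescription is made on ker \<epsilon>, but since 1 is group-like the same formula
  gives the unit at 1; hence it holds on C.\<close>

lemma envT_comult_props:
  shows "envT_comult K C \<in> alg_hom K T (tensor K T T)"
    and "x \<in> carrier C \<Longrightarrow> envT_comult K C (i x) = tlift K (tensor K T T) (\<lambda>x1 x2. tens K T T (i x1) (i x2)) (comult C x)"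
proof -
  let ?f = "\<lambda>x. tlift K (tensor K T T) (\<lambda>x1 x2. tens K T T (i x1) (i x2)) (comult C x)"
  note b = tmap_bilin[OF T_module T_module i_lin i_lin]
  note TT = tensor_module[OF T_module T_module]
  have f: "?f \<in> lin K C (tensor K T T)"
    by (rule tlift_arg_lin[OF coalg_module coalg_module TT b comult_lin])
  have one: "?f \<one>\<^bsub>C\<^esub> = \<one>\<^bsub>tensor K T T\<^esub>"
    unfolding comult_one tlift_tens[OF coalg_module coalg_module TT b one_closed one_closed] i_one
    by (rule one_tens[OF T_algebra T_algebra, symmetric])
  obtain \<Delta> where \<Delta>: "\<Delta> \<in> alg_hom K T (tensor K T T)" "\<Delta> \<in> extensional (carrier T)"
    "\<And>x. x \<in> carrier C \<Longrightarrow> \<Delta> (i x) = ?f x"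
    using T_hom_exists[OF tensor_algebra[OF T_algebra T_algebra] f one] by blast
  have "envT_comult K C = \<Delta>"
    unfolding envT_comult_def Let_def sweedler_def
  proof (rule the_equality)
    show "\<Delta> \<in> alg_hom K T (tensor K T T) \<and> \<Delta> \<in> extensional (carrier T) \<and> (\<forall>x\<in>carrier V. \<Delta> (i x) = ?f x)"
      using \<Delta> by (simp add: V_carrier)
    fix \<Delta>' assume \<Delta>': "\<Delta>' \<in> alg_hom K T (tensor K T T) \<and> \<Delta>' \<in> extensional (carrier T) \<and> (\<forall>x\<in>carrier V. \<Delta>' (i x) = ?f x)"
    show "\<Delta>' = \<Delta>"
      using \<Delta>' by (intro T_hom_eqI[OF _ _ \<Delta>(1,2)]) (simp_all add: V_carrier \<Delta>(3))
  qed
  then show "envT_comult K C \<in> alg_hom K T (tensor K T T)"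
    "x \<in> carrier C \<Longrightarrow> envT_comult K C (i x) = ?f x"
    using \<Delta> by auto
qed

text \<open>A map that vanishes on ker \<epsilon> agrees there with \<epsilon>, and \<epsilon>(1) =
  1, so \<epsilon> itself is the map to be extended.\<close>

lemma envT_counit_props:
  shows "envT_counit K C \<in> alg_hom K T (base_alg K)"
    and "x \<in> carrier C \<Longrightarrow> envT_counit K C (i x) = counit C x"
proof -
  obtain e where e: "e \<in> alg_hom K T (base_alg K)" "e \<in> extensional (carrier T)"
    "\<And>x. x \<in> carrier C \<Longrightarrow> e (i x) = counit C x"
    using T_hom_exists[OF base_alg_algebra[OF K_cring] counit_lin] by (auto simp: counit_one)
  have "envT_counit K C = e"
    unfolding envT_counit_def
  proof (rule the_equality)
    show "e \<in> alg_hom K T (base_alg K) \<and> e \<in> extensional (carrier T) \<and> (\<forall>x\<in>carrier V. e (i x) = \<zero>\<^bsub>K\<^esub>)"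
      using e by (simp add: V_carrier)
    fix e' assume e': "e' \<in> alg_hom K T (base_alg K) \<and> e' \<in> extensional (carrier T) \<and> (\<forall>x\<in>carrier V. e' (i x) = \<zero>\<^bsub>K\<^esub>)"
    show "e' = e"
      using e' by (intro T_hom_eqI[OF _ _ e(1,2)]) (simp_all add: V_carrier e(3))
  qed
  then show "envT_counit K C \<in> alg_hom K T (base_alg K)"
    "x \<in> carrier C \<Longrightarrow> envT_counit K C (i x) = counit C x"
    using e by auto
qed

lemma act_eq_on_T:
  assumes "right_module K T C act" and "right_module K T C act'"
    and eq: "\<And>y x. \<lbrakk>y \<in> carrier C; x \<in> carrier V\<rbrakk> \<Longrightarrow> act y (i x) = act' y (i x)"
    and t: "t \<in> carrier T" and y: "y \<in> carrier C"
  shows "act y t = act' y t"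
proof -
  interpret a: right_module K T C act by fact
  interpret b: right_module K T C act' by fact
  show ?thesis
    using t y
  \<comment> \<open>y varies: for a product st the hypothesis on t is needed at y acted on by
    s.\<close>
  proof (induction arbitrary: y rule: T_induct)
    case (add s t)
    then show ?case
      by (simp add: lin_add[OF bilin_right[OF a.act_bilin]] lin_add[OF bilin_right[OF b.act_bilin]])
  next
    case (smult a t)
    then show ?case
      by (simp add: lin_smult[OF bilin_right[OF a.act_bilin]] lin_smult[OF bilin_right[OF b.act_bilin]])
  next
    case (mult s t)
    then show ?case
      by (simp add: a.act_mult b.act_mult bilin_closed[OF b.act_bilin])
  qed (simp_all add: a.act_one b.act_one eq)
qed

lemma envT_act_props:
  shows "right_module K T C (envT_act K C)"
    and "\<lbrakk>y \<in> carrier C; x \<in> carrier C\<rbrakk> \<Longrightarrow> envT_act K C y (i x) = y \<lhd>\<^bsub>C\<^esub> x"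
proof -
  have r: "rack C \<in> bilin K C V C"
    using rack_bilin V_lin[OF bilin_right[OF rack_bilin]] by (auto simp: bilin_def V_carrier)
  obtain a where a: "right_module K T C a"
    "\<And>y v. \<lbrakk>y \<in> carrier C; v \<in> carrier V\<rbrakk> \<Longrightarrow> a y (tens_alg_incl K V v) = y \<lhd>\<^bsub>C\<^esub> v"
    using tensor_alg.act_exists[OF tensor_alg.intro[OF V_module] coalg_module r, folded envT_def] by blast
  \<comment> \<open>The description in \<open>envT_act\<close> fixes the function outside the
    carriers, so the action has to be restricted in both arguments to be the unique
    solution.\<close>
  define a' where "a' = (\<lambda>y\<in>carrier C. \<lambda>t\<in>carrier T. a y t)"
  have a': "right_module K T C a'"
    by (rule right_module_cong[OF a(1)]) (simp add: a'_def)
  have a'V: "a' y (i v) = y \<lhd>\<^bsub>C\<^esub> v" if "y \<in> carrier C" "v \<in> carrier V" for y v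
    using that a(2) i_V lin_closed[OF incl_lin] by (simp add: a'_def)
  have eq: "envT_act K C = a'"
    unfolding envT_act_def
  proof (rule the_equality)
    show "right_module K T C a' \<and> a' = (\<lambda>y\<in>carrier C. \<lambda>t\<in>carrier T. a' y t) \<and>
        (\<forall>y\<in>carrier C. \<forall>x\<in>carrier V. a' y (i x) = y \<lhd>\<^bsub>C\<^esub> x)"
      using a' a'V by (auto simp: a'_def fun_eq_iff)
    fix b assume b: "right_module K T C b \<and> b = (\<lambda>y\<in>carrier C. \<lambda>t\<in>carrier T. b y t) \<and>
        (\<forall>y\<in>carrier C. \<forall>x\<in>carrier V. b y (i x) = y \<lhd>\<^bsub>C\<^esub> x)"
    have "b y t = a' y t" if "y \<in> carrier C" "t \<in> carrier T" for y t
      by (rule act_eq_on_T[OF _ a' _ that(2,1)]) (use b a'V in auto)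
    then have "(\<lambda>y\<in>carrier C. \<lambda>t\<in>carrier T. b y t) = (\<lambda>y\<in>carrier C. \<lambda>t\<in>carrier T. a' y t)"
      by (intro restrict_ext)
    then show "b = a'" using b by (simp add: a'_def fun_eq_iff)
  qed
  show "right_module K T C (envT_act K C)" using a' eq by simp
  interpret a': right_module K T C a' by (rule a')
  show "envT_act K C y (i x) = y \<lhd>\<^bsub>C\<^esub> x" if y: "y \<in> carrier C" and x: "x \<in> carrier C"
    unfolding eq
    \<comment> \<open>At the element 1 both sides are y, by the unit law of the action and by
      \<open>rack_one\<close>.\<close>
    by (rule lin_eq_via_V[OF lin_comp[OF bilin_right[OF a'.act_bilin y] i_lin] bilin_right[OF rack_bilin y] _ _ x])
      (simp_all add: i_one a'.act_one rack_one y a'V)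
qed

end

section \<open>The universal enveloping algebra\<close>

context rack_bialgebra
begin

abbreviation "U \<equiv> env_bialg K C"
abbreviation "q \<equiv> env_map K C"
abbreviation "\<pi> \<equiv> env_proj K C"
abbreviation "J \<equiv> env_ideal K C"

text \<open>Setting this to zero is the Yetter-Drinfel'd condition for \<open>a = x\<close> and h
  the image of y, with the action of the second leg of h written as \<lhd>.\<close>

definition env_rel :: "'a \<Rightarrow> 'a \<Rightarrow> ('a list \<Rightarrow> 'k) set" where
  "env_rel x y = tlift K T (\<lambda>y1 y2. i y1 \<otimes>\<^bsub>T\<^esub> i (x \<lhd>\<^bsub>C\<^esub> y2)) (comult C y) \<ominus>\<^bsub>T\<^esub> (i x \<otimes>\<^bsub>T\<^esub> i y)"

lemma J_eq: "J = Idl\<^bsub>T\<^esub> {env_rel x y | x y. x \<in> carrier C \<and> y \<in> carrier C}"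
  by (simp add: env_ideal_def Let_def env_rel_def sweedler_def)

lemmas mult_T = mult_bilin[OF T_algebra]

text \<open>General in f, because the relation is evaluated under \<open>i\<close>, under algebra
  maps composed with \<open>i\<close>, under \<open>q\<close> and \<open>qq\<close>, and under the
  map into another Yetter-Drinfel'd structure.\<close>

lemma rel_bilin:
  assumes A: "k_algebra K A" and f: "f \<in> lin K C A" and x: "x \<in> carrier C"
  shows "(\<lambda>y1 y2. f y1 \<otimes>\<^bsub>A\<^esub> f (x \<lhd>\<^bsub>C\<^esub> y2)) \<in> bilin K C C A"
  by (assumption | rule bilinI bilin_lin_l[OF mult_bilin[OF A]] bilin_lin_r[OF mult_bilin[OF A]] f lin_comp[OF f]
      lin_closed[OF f] bilin_right[OF rack_bilin] bilin_closed[OF rack_bilin] x)+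

lemma env_rel_closed:
  assumes x: "x \<in> carrier C" and y: "y \<in> carrier C"
  shows "tlift K T (\<lambda>y1 y2. i y1 \<otimes>\<^bsub>T\<^esub> i (x \<lhd>\<^bsub>C\<^esub> y2)) (comult C y) \<in> carrier T"
    and "i x \<otimes>\<^bsub>T\<^esub> i y \<in> carrier T" and "env_rel x y \<in> carrier T"
proof -
  interpret T: module K T by (rule T_module)
  show 1: "tlift K T (\<lambda>y1 y2. i y1 \<otimes>\<^bsub>T\<^esub> i (x \<lhd>\<^bsub>C\<^esub> y2)) (comult C y) \<in> carrier T"
    by (rule tlift_closed[OF coalg_module coalg_module T_module rel_bilin[OF T_algebra i_lin x] comult_closed[OF y]])
  show 2: "i x \<otimes>\<^bsub>T\<^esub> i y \<in> carrier T"
    by (rule bilin_closed[OF mult_T lin_closed[OF i_lin x] lin_closed[OF i_lin y]])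
  show "env_rel x y \<in> carrier T"
    unfolding env_rel_def by (rule T.M.minus_closed[OF 1 2])
qed

lemma J_gens: "{env_rel x y | x y. x \<in> carrier C \<and> y \<in> carrier C} \<subseteq> carrier T"
  using env_rel_closed(3) by blast

lemma T_ring: "ring T"
  by (rule k_algebra.alg_ring[OF T_algebra])

lemma J_ideal: "ideal J T"
  unfolding J_eq by (rule ring.genideal_ideal[OF T_ring J_gens])

lemma J_minimal:
  assumes I: "ideal I T" and g: "\<And>x y. \<lbrakk>x \<in> carrier C; y \<in> carrier C\<rbrakk> \<Longrightarrow> env_rel x y \<in> I"
  shows "J \<subseteq> I"
  unfolding J_eq by (rule ring.genideal_minimal[OF T_ring I]) (use g in blast)

lemma env_rel_in_J: "\<lbrakk>x \<in> carrier C; y \<in> carrier C\<rbrakk> \<Longrightarrow> env_rel x y \<in> J"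
  unfolding J_eq using ring.genideal_self[OF T_ring J_gens] by blast

lemma U_quotient: "quotient_algebra K T J"
  by (intro quotient_algebra.intro T_algebra J_ideal)

lemma U_algebra: "k_algebra K U"
  using quotient_algebra.Q_algebra[OF U_quotient] by (simp add: env_bialg_def env_alg_def)

lemmas U_module = k_algebra.alg_module[OF U_algebra]

lemma pi_hom: "\<pi> \<in> alg_hom K T U"
  using quotient_algebra.proj_alg_hom[OF U_quotient]
  by (simp add: env_bialg_def env_alg_def env_proj_def[abs_def])

lemma U_quotient_module: "quotient_module K T J"
  using U_quotient by (simp add: quotient_algebra.axioms quotient_module.intro T_module
      k_algebra.ideal_submodule[OF T_algebra J_ideal])

lemma U_carrier: "carrier U = \<pi> ` carrier T"
  using quotient_module.Q_carrier[OF U_quotient_module] by (simp add: env_bialg_def env_alg_def env_proj_def[abs_def])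

lemma q_lin: "q \<in> lin K C U"
  using lin_comp[OF alg_hom_lin[OF pi_hom] i_lin] by (simp add: env_map_def[abs_def])

lemma q_one: "q \<one>\<^bsub>C\<^esub> = \<one>\<^bsub>U\<^esub>"
  by (simp add: env_map_def i_one alg_hom_one[OF pi_hom])

lemma q_closed: "x \<in> carrier C \<Longrightarrow> q x \<in> carrier U"
  by (rule lin_closed[OF q_lin])

section \<open>Descent from T to U(C)\<close>

lemma hom_rel:
  assumes A: "k_algebra K A" and h: "h \<in> alg_hom K T A" and x: "x \<in> carrier C" and y: "y \<in> carrier C"
  shows "h (env_rel x y) = tlift K A (\<lambda>y1 y2. h (i y1) \<otimes>\<^bsub>A\<^esub> h (i (x \<lhd>\<^bsub>C\<^esub> y2))) (comult C y)
    \<ominus>\<^bsub>A\<^esub> (h (i x) \<otimes>\<^bsub>A\<^esub> h (i y))"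
proof -
  note mA = k_algebra.alg_module[OF A] and hl = alg_hom_lin[OF h]
  note b = rel_bilin[OF A lin_comp[OF hl i_lin] x]
  have "h (tlift K T (\<lambda>y1 y2. i y1 \<otimes>\<^bsub>T\<^esub> i (x \<lhd>\<^bsub>C\<^esub> y2)) (comult C y))
      = tlift K A (\<lambda>y1 y2. h (i y1) \<otimes>\<^bsub>A\<^esub> h (i (x \<lhd>\<^bsub>C\<^esub> y2))) (comult C y)"
    unfolding tlift_comp[OF coalg_module coalg_module T_module mA rel_bilin[OF T_algebra i_lin x] hl comult_closed[OF y]]
    by (rule tlift_cong[OF coalg_module coalg_module mA comult_closed[OF y] b])
      (rule alg_hom_mult[OF h lin_closed[OF i_lin] lin_closed[OF i_lin bilin_closed[OF rack_bilin x]]])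
  then show ?thesis
    unfolding env_rel_def lin_diff[OF T_module mA hl env_rel_closed(1,2)[OF x y]]
    by (simp add: alg_hom_mult[OF h] lin_closed[OF i_lin] x y)
qed

lemma q_rel:
  assumes x: "x \<in> carrier C" and y: "y \<in> carrier C"
  shows "tlift K U (\<lambda>y1 y2. q y1 \<otimes>\<^bsub>U\<^esub> q (x \<lhd>\<^bsub>C\<^esub> y2)) (comult C y) = q x \<otimes>\<^bsub>U\<^esub> q y"
proof -
  interpret Q: quotient_module K T J by (rule U_quotient_module)
  interpret U: module K U by (rule U_module)
  note hr = hom_rel[OF U_algebra pi_hom x y, folded env_map_def]
  \<comment> \<open>The relation lies in J, so its coset is J itself, the coset of zero.\<close>
  have "\<pi> (env_rel x y) = \<pi> \<zero>\<^bsub>T\<^esub>"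
    using abelian_subgroup.a_rcos_const[OF Q.abelian_subgroup_N env_rel_in_J[OF x y]]
      Q.M.a_coset_add_zero[of J] Q.subset by (simp add: env_proj_def)
  then have "\<pi> (env_rel x y) = \<zero>\<^bsub>U\<^esub>"
    using lin_zero[OF T_module U_module alg_hom_lin[OF pi_hom]] by simp
  then show ?thesis
    unfolding hr
    by (rule U.M.diff_zero_imp_eq[rotated 2])
      (intro tlift_closed[OF coalg_module coalg_module U_module] rel_bilin[OF U_algebra q_lin] comult_closed x y
        bilin_closed[OF mult_bilin[OF U_algebra]] q_closed)+
qed

text \<open>The kernel of an algebra map is a two-sided ideal, so it contains J as soon as it
  contains the generators. The induced map is stated by choice of a representative because
  \<open>env_bialg\<close> defines coproduct and counit in this form.\<close>

lemma hom_factor: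
  assumes A: "k_algebra K A" and h: "h \<in> alg_hom K T A"
    and rel: "\<And>x y. \<lbrakk>x \<in> carrier C; y \<in> carrier C\<rbrakk> \<Longrightarrow>
      tlift K A (\<lambda>y1 y2. h (i y1) \<otimes>\<^bsub>A\<^esub> h (i (x \<lhd>\<^bsub>C\<^esub> y2))) (comult C y) = h (i x) \<otimes>\<^bsub>A\<^esub> h (i y)"
  shows "(\<lambda>s. h (SOME t. t \<in> s)) \<in> alg_hom K U A"
    and "t \<in> carrier T \<Longrightarrow> h (SOME t'. t' \<in> \<pi> t) = h t"
proof -
  interpret Q: quotient_module K T J by (rule U_quotient_module)
  interpret A: module K A by (rule k_algebra.alg_module[OF A])
  note mA = k_algebra.alg_module[OF A] and hl = alg_hom_lin[OF h]
  have "h (env_rel x y) = \<zero>\<^bsub>A\<^esub>" if "x \<in> carrier C" "y \<in> carrier C" for x y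
    unfolding hom_rel[OF A h that] rel[OF that]
    by (rule A.M.diff_self[OF bilin_closed[OF mult_bilin[OF A]]]) (intro lin_closed[OF hl] lin_closed[OF i_lin] that)+
  then have "J \<subseteq> {t \<in> carrier T. h t = \<zero>\<^bsub>A\<^esub>}"
    by (intro J_minimal kernel_ideal[OF T_algebra A h]) (simp add: env_rel_closed)
  then have k: "\<And>n. n \<in> J \<Longrightarrow> h n = \<zero>\<^bsub>A\<^esub>" by auto
  show f: "h (SOME t'. t' \<in> \<pi> t) = h t" if "t \<in> carrier T" for t
    unfolding env_proj_def by (rule Q.lin_factor[OF mA hl k that])
  show "(\<lambda>s. h (SOME t. t \<in> s)) \<in> alg_hom K U A"
  proof (rule alg_homI)
    show "(\<lambda>s. h (SOME t. t \<in> s)) \<in> lin K U A"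
      using Q.lin_factor_lin[OF mA hl k] by (simp add: env_bialg_def env_alg_def)
    show "h (SOME t. t \<in> \<one>\<^bsub>U\<^esub>) = \<one>\<^bsub>A\<^esub>"
      using f[OF k_algebra_one_closed[OF T_algebra]] by (simp add: alg_hom_one[OF pi_hom] alg_hom_one[OF h])
    fix s s' assume "s \<in> carrier U" "s' \<in> carrier U"
    then obtain t t' where t: "t \<in> carrier T" "t' \<in> carrier T" "s = \<pi> t" "s' = \<pi> t'"
      by (auto simp: U_carrier)
    then have "s \<otimes>\<^bsub>U\<^esub> s' = \<pi> (t \<otimes>\<^bsub>T\<^esub> t')" by (simp add: alg_hom_mult[OF pi_hom])
    then show "h (SOME t. t \<in> s \<otimes>\<^bsub>U\<^esub> s') = h (SOME t. t \<in> s) \<otimes>\<^bsub>A\<^esub> h (SOME t. t \<in> s')"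
      using t by (simp add: f k_algebra_mult_closed[OF T_algebra] alg_hom_mult[OF h])
  qed
qed

lemma U_induct [consumes 1, case_names one incl add smult mult]:
  assumes s: "s \<in> carrier U" and one: "P \<one>\<^bsub>U\<^esub>" and incl: "\<And>x. x \<in> carrier C \<Longrightarrow> P (q x)"
    and add: "\<And>x y. \<lbrakk>x \<in> carrier U; y \<in> carrier U; P x; P y\<rbrakk> \<Longrightarrow> P (x \<oplus>\<^bsub>U\<^esub> y)"
    and smult: "\<And>a x. \<lbrakk>a \<in> carrier K; x \<in> carrier U; P x\<rbrakk> \<Longrightarrow> P (a \<odot>\<^bsub>U\<^esub> x)"
    and mult: "\<And>x y. \<lbrakk>x \<in> carrier U; y \<in> carrier U; P x; P y\<rbrakk> \<Longrightarrow> P (x \<otimes>\<^bsub>U\<^esub> y)"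
  shows "P s"
proof -
  obtain t where t: "t \<in> carrier T" "s = \<pi> t" using s by (auto simp: U_carrier)
  note l = alg_hom_lin[OF pi_hom]
  have "P (\<pi> t)" using t(1)
  proof (induction rule: T_induct)
    case one
    then show ?case using assms(2) by (simp add: alg_hom_one[OF pi_hom])
  next
    case (incl x)
    then show ?case using assms(3)[of x] by (simp add: V_carrier env_map_def)
  next
    case (add x y)
    then show ?case using assms(4)[of "\<pi> x" "\<pi> y"] by (simp add: lin_add[OF l] lin_closed[OF l])
  next
    case (smult a x)
    then show ?case using assms(5)[of a "\<pi> x"] by (simp add: lin_smult[OF l] lin_closed[OF l])
  next
    case (mult x y)
    then show ?case using assms(6)[of "\<pi> x" "\<pi> y"] by (simp add: alg_hom_mult[OF pi_hom] lin_closed[OF l])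
  qed
  then show ?thesis by (simp add: t)
qed

lemma U_hom_eq:
  assumes g: "g \<in> alg_hom K U A" and h: "h \<in> alg_hom K U A"
    and eq: "\<And>x. x \<in> carrier C \<Longrightarrow> g (q x) = h (q x)" and s: "s \<in> carrier U"
  shows "g s = h s"
  using s
  by (induction rule: U_induct)
    (simp_all add: eq alg_hom_one[OF g] alg_hom_one[OF h] alg_hom_mult[OF g] alg_hom_mult[OF h]
      lin_add[OF alg_hom_lin[OF g]] lin_add[OF alg_hom_lin[OF h]] lin_smult[OF alg_hom_lin[OF g]] lin_smult[OF alg_hom_lin[OF h]])

section \<open>The coproduct and the relations\<close>

lemma comult_rack:
  assumes x: "x \<in> carrier C" and y: "y \<in> carrier C"
  shows "comult C (x \<lhd>\<^bsub>C\<^esub> y) = tlift K (tensor K C C) (\<lambda>x1 x2. tlift K (tensor K C C)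
    (\<lambda>y1 y2. tens K C C (x1 \<lhd>\<^bsub>C\<^esub> y1) (x2 \<lhd>\<^bsub>C\<^esub> y2)) (comult C y)) (comult C x)"
  using rack_coalg_hom x y
  unfolding tensor_coalg_hom_iff[OF coalgebra_axioms coalgebra_axioms coalgebra_axioms rack_bilin] by simp

text \<open>The future coproduct of \<^term>\<open>q x\<close>.\<close>

definition qq where
  "qq x = tlift K (tensor K U U) (\<lambda>x1 x2. tens K U U (q x1) (q x2)) (comult C x)"

lemmas UU_algebra = tensor_algebra[OF U_algebra U_algebra]
lemmas UU_module = tensor_module[OF U_module U_module]
lemmas mult_U = mult_bilin[OF U_algebra]
lemmas mult_UU = mult_bilin[OF UU_algebra]
lemmas tens_UU = tens_bilin[OF U_module U_module]
lemmas tens_qq = tmap_bilin[OF U_module U_module q_lin q_lin]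
lemmas C_tlift_param = tlift_param_lin[OF coalg_module coalg_module]
lemmas C_tlift_arg = tlift_arg_lin[OF coalg_module coalg_module]
lemmas C_tlift_cong = tlift_cong[OF coalg_module coalg_module]
lemmas C_tlift_comp = tlift_comp[OF coalg_module coalg_module]
lemmas C_tlift_exchange = tlift_exchange[OF coalg_module coalg_module coalg_module coalg_module]

text \<open>The rules follow the shape of a term: \<open>bilinI\<close> leaves one variable free,
  the \<open>bilin_lin\<close> rules descend to its occurrence, \<open>lin_id\<close> ends there,
  and the closure rules settle the arguments kept fixed. Repeated resolution thus meets the
  bilinearity obligations of Sweedler sums.\<close>

lemmas C_rules = bilinI lin_id coalg_module comult_closed comult_lin
  bilin_lin_l[OF rack_bilin] bilin_lin_r[OF rack_bilin] bilin_closed[OF rack_bilin]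

lemmas U_rules = C_rules U_module UU_module q_closed lin_comp[OF q_lin]
  bilin_lin_l[OF tens_UU] bilin_lin_r[OF tens_UU] bilin_closed[OF tens_UU]
  bilin_lin_l[OF mult_U] bilin_lin_r[OF mult_U] bilin_closed[OF mult_U]
  bilin_lin_l[OF mult_UU] bilin_lin_r[OF mult_UU] bilin_closed[OF mult_UU]

lemma qq_lin: "qq \<in> lin K C (tensor K U U)"
  unfolding qq_def[abs_def] by (rule C_tlift_arg[OF UU_module tens_qq comult_lin])

text \<open>The coproduct of a rack product is known since \<lhd> is a coalgebra morphism; q
  \<otimes> q is pulled through its two Sweedler sums.\<close>

lemma qq_rack:
  assumes x: "x \<in> carrier C" and y: "y \<in> carrier C"
  shows "qq (x \<lhd>\<^bsub>C\<^esub> y) = tlift K (tensor K U U) (\<lambda>x1 x2. tlift K (tensor K U U)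
    (\<lambda>y1 y2. tens K U U (q (x1 \<lhd>\<^bsub>C\<^esub> y1)) (q (x2 \<lhd>\<^bsub>C\<^esub> y2))) (comult C y)) (comult C x)"
proof -
  note CC = tensor_module[OF coalg_module coalg_module] and tCC = tens_bilin[OF coalg_module coalg_module]
  note L = tlift_lin[OF coalg_module coalg_module UU_module tens_qq]
  note rules = U_rules CC bilin_lin_l[OF tCC] bilin_lin_r[OF tCC] bilin_closed[OF tCC]
    C_tlift_param[OF CC] C_tlift_param[OF UU_module]
  have b1: "(\<lambda>x1 x2. tlift K (tensor K C C) (\<lambda>y1 y2. tens K C C (x1 \<lhd>\<^bsub>C\<^esub> y1) (x2 \<lhd>\<^bsub>C\<^esub> y2)) (comult C y))
      \<in> bilin K C C (tensor K C C)"
    by (assumption | rule rules y)+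
  have b2: "(\<lambda>y1 y2. tens K C C (x1 \<lhd>\<^bsub>C\<^esub> y1) (x2 \<lhd>\<^bsub>C\<^esub> y2)) \<in> bilin K C C (tensor K C C)"
    if "x1 \<in> carrier C" "x2 \<in> carrier C" for x1 x2
    by (assumption | rule rules that)+
  have b3: "(\<lambda>y1 y2. tens K U U (q (x1 \<lhd>\<^bsub>C\<^esub> y1)) (q (x2 \<lhd>\<^bsub>C\<^esub> y2))) \<in> bilin K C C (tensor K U U)"
    if "x1 \<in> carrier C" "x2 \<in> carrier C" for x1 x2
    by (assumption | rule rules that)+
  have b4: "(\<lambda>x1 x2. tlift K (tensor K U U) (\<lambda>y1 y2. tens K U U (q (x1 \<lhd>\<^bsub>C\<^esub> y1)) (q (x2 \<lhd>\<^bsub>C\<^esub> y2))) (comult C y))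
      \<in> bilin K C C (tensor K U U)"
    by (assumption | rule rules y)+
  show ?thesis
    unfolding qq_def comult_rack[OF x y]
  proof (rule trans[OF C_tlift_comp[OF CC UU_module b1 L comult_closed[OF x]] C_tlift_cong[OF UU_module comult_closed[OF x] b4]])
    fix x1 x2 assume x12: "x1 \<in> carrier C" "x2 \<in> carrier C"
    show "tlift K (tensor K U U) (\<lambda>x1 x2. tens K U U (q x1) (q x2))
        (tlift K (tensor K C C) (\<lambda>y1 y2. tens K C C (x1 \<lhd>\<^bsub>C\<^esub> y1) (x2 \<lhd>\<^bsub>C\<^esub> y2)) (comult C y)) =
      tlift K (tensor K U U) (\<lambda>y1 y2. tens K U U (q (x1 \<lhd>\<^bsub>C\<^esub> y1)) (q (x2 \<lhd>\<^bsub>C\<^esub> y2))) (comult C y)"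
      by (rule trans[OF C_tlift_comp[OF CC UU_module b2[OF x12] L comult_closed[OF y]]
            C_tlift_cong[OF UU_module comult_closed[OF y] b3[OF x12]]])
        (simp only: tlift_tens[OF coalg_module coalg_module UU_module tens_qq] bilin_closed[OF rack_bilin] x12)
  qed
qed

text \<open>Cocommutativity is what allows the coproduct of \<open>T\<close> to descend to \<open>U(C)\<close>.\<close>

lemma qq_rel:
  assumes cc: "cocommutative K C" and x: "x \<in> carrier C" and y: "y \<in> carrier C"
  shows "tlift K (tensor K U U) (\<lambda>y1 y2. qq y1 \<otimes>\<^bsub>tensor K U U\<^esub> qq (x \<lhd>\<^bsub>C\<^esub> y2)) (comult C y)
    = qq x \<otimes>\<^bsub>tensor K U U\<^esub> qq y"
proof -
  let ?UU = "tensor K U U"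
  note rules = U_rules C_tlift_param[OF UU_module] C_tlift_arg[OF UU_module]
    C_tlift_param[OF U_module] C_tlift_arg[OF U_module]
    tlift_closed[OF coalg_module coalg_module U_module] tlift_closed[OF coalg_module coalg_module UU_module]
  \<comment> \<open>a and b stand for the legs of the first leg of y, c and d for those of the
    second. In iterated Sweedler notation they are y1, y2, y3, y4, so b and c are the ones to be
    exchanged.\<close>
  define \<tau> where "\<tau> = (\<lambda>x1 x2 a b c d. tens K U U (q a \<otimes>\<^bsub>U\<^esub> q (x1 \<lhd>\<^bsub>C\<^esub> c)) (q b \<otimes>\<^bsub>U\<^esub> q (x2 \<lhd>\<^bsub>C\<^esub> d)))"
  have \<tau>cd: "\<tau> x1 x2 a b \<in> bilin K C C ?UU"
    if "x1 \<in> carrier C" "x2 \<in> carrier C" "a \<in> carrier C" "b \<in> carrier C" for x1 x2 a b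
    unfolding \<tau>_def by (assumption | rule rules that)+
  have \<tau>ab: "(\<lambda>a b. \<tau> x1 x2 a b c d) \<in> bilin K C C ?UU"
    if "x1 \<in> carrier C" "x2 \<in> carrier C" "c \<in> carrier C" "d \<in> carrier C" for x1 x2 c d
    unfolding \<tau>_def by (assumption | rule rules that)+
  have \<tau>x: "(\<lambda>x1 x2. \<tau> x1 x2 a b c d) \<in> bilin K C C ?UU"
    if "a \<in> carrier C" "b \<in> carrier C" "c \<in> carrier C" "d \<in> carrier C" for a b c d
    unfolding \<tau>_def by (assumption | rule rules that)+
  note \<tau>r = bilinI \<tau>cd \<tau>ab \<tau>x bilin_left[OF \<tau>cd] bilin_left[OF \<tau>ab] bilin_left[OF \<tau>x]
    bilin_right[OF \<tau>cd] bilin_right[OF \<tau>ab] bilin_right[OF \<tau>x] rules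
  \<comment> \<open>Both factors are expanded, with the sum over the legs of x placed outside those
    over the legs of y1 and y2.\<close>
  have prod: "qq y1 \<otimes>\<^bsub>?UU\<^esub> qq (x \<lhd>\<^bsub>C\<^esub> y2)
      = tlift K ?UU (\<lambda>x1 x2. tlift K ?UU (\<lambda>a b. tlift K ?UU (\<tau> x1 x2 a b) (comult C y2)) (comult C y1)) (comult C x)"
    if y1: "y1 \<in> carrier C" and y2: "y2 \<in> carrier C" for y1 y2
  proof -
    note qy = lin_closed[OF qq_lin y1]
    note L = bilin_right[OF mult_UU qy]
    have c1: "(\<lambda>x1 x2. tlift K ?UU (\<lambda>c d. tens K U U (q (x1 \<lhd>\<^bsub>C\<^esub> c)) (q (x2 \<lhd>\<^bsub>C\<^esub> d))) (comult C y2)) \<in> bilin K C C ?UU"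
      by (assumption | rule rules y2)+
    have c2: "(\<lambda>c d. tens K U U (q (x1 \<lhd>\<^bsub>C\<^esub> c)) (q (x2 \<lhd>\<^bsub>C\<^esub> d))) \<in> bilin K C C ?UU"
      if "x1 \<in> carrier C" "x2 \<in> carrier C" for x1 x2
      by (assumption | rule rules that)+
    have c3: "(\<lambda>x1 x2. tlift K ?UU (\<lambda>a b. tlift K ?UU (\<tau> x1 x2 a b) (comult C y2)) (comult C y1)) \<in> bilin K C C ?UU"
      by (assumption | rule \<tau>r y1 y2)+
    have c4: "(\<lambda>c d. tlift K ?UU (\<lambda>a b. \<tau> x1 x2 a b c d) (comult C y1)) \<in> bilin K C C ?UU"
      if "x1 \<in> carrier C" "x2 \<in> carrier C" for x1 x2
      by (assumption | rule \<tau>r y1 that)+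
    have t: "qq y1 \<otimes>\<^bsub>?UU\<^esub> tens K U U (q (x1 \<lhd>\<^bsub>C\<^esub> c)) (q (x2 \<lhd>\<^bsub>C\<^esub> d)) = tlift K ?UU (\<lambda>a b. \<tau> x1 x2 a b c d) (comult C y1)"
      if xc: "x1 \<in> carrier C" "x2 \<in> carrier C" "c \<in> carrier C" "d \<in> carrier C" for x1 x2 c d
    proof -
      have tc: "tens K U U (q (x1 \<lhd>\<^bsub>C\<^esub> c)) (q (x2 \<lhd>\<^bsub>C\<^esub> d)) \<in> carrier ?UU"
        by (assumption | rule rules xc)+
      show ?thesis
        unfolding qq_def
        by (rule trans[OF C_tlift_comp[OF UU_module UU_module tens_qq bilin_left[OF mult_UU tc] comult_closed[OF y1]]
              C_tlift_cong[OF UU_module comult_closed[OF y1] \<tau>ab[OF xc]]])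
          (simp add: tens_mult[OF U_algebra U_algebra] q_closed bilin_closed[OF rack_bilin] xc \<tau>_def)
    qed
    show ?thesis
      unfolding qq_rack[OF x y2]
    proof (rule trans[OF C_tlift_comp[OF UU_module UU_module c1 L comult_closed[OF x]]
          C_tlift_cong[OF UU_module comult_closed[OF x] c3]])
      fix x1 x2 assume x12: "x1 \<in> carrier C" "x2 \<in> carrier C"
      have "qq y1 \<otimes>\<^bsub>?UU\<^esub> tlift K ?UU (\<lambda>c d. tens K U U (q (x1 \<lhd>\<^bsub>C\<^esub> c)) (q (x2 \<lhd>\<^bsub>C\<^esub> d))) (comult C y2)
          = tlift K ?UU (\<lambda>c d. tlift K ?UU (\<lambda>a b. \<tau> x1 x2 a b c d) (comult C y1)) (comult C y2)"
        by (rule trans[OF C_tlift_comp[OF UU_module UU_module c2[OF x12] L comult_closed[OF y2]]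
              C_tlift_cong[OF UU_module comult_closed[OF y2] c4[OF x12]]]) (rule t[OF x12])
      also have "\<dots> = tlift K ?UU (\<lambda>a b. tlift K ?UU (\<tau> x1 x2 a b) (comult C y2)) (comult C y1)"
        by (rule C_tlift_exchange[OF UU_module comult_closed[OF y1] comult_closed[OF y2], symmetric])
          (assumption | rule \<tau>cd \<tau>ab x12)+
      finally show "qq y1 \<otimes>\<^bsub>?UU\<^esub> tlift K ?UU (\<lambda>c d. tens K U U (q (x1 \<lhd>\<^bsub>C\<^esub> c)) (q (x2 \<lhd>\<^bsub>C\<^esub> d))) (comult C y2)
          = tlift K ?UU (\<lambda>a b. tlift K ?UU (\<tau> x1 x2 a b) (comult C y2)) (comult C y1)" .
    qed
  qed
  have inner: "tlift K ?UU (\<lambda>y1 y2. tlift K ?UU (\<lambda>a b. tlift K ?UU (\<tau> x1 x2 a b) (comult C y2)) (comult C y1)) (comult C y)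
      = tens K U U (q x1) (q x2) \<otimes>\<^bsub>?UU\<^esub> qq y" if x12: "x1 \<in> carrier C" "x2 \<in> carrier C" for x1 x2
  proof -
    have tx: "tens K U U (q x1) (q x2) \<in> carrier ?UU"
      by (assumption | rule rules x12)+
    have e1: "(\<lambda>y1 y2. tens K U U (q x1) (q x2) \<otimes>\<^bsub>?UU\<^esub> tens K U U (q y1) (q y2)) \<in> bilin K C C ?UU"
      by (assumption | rule rules x12)+
    \<comment> \<open>After the exchange both legs of y1 occur in the first tensor factor and both
      legs of y2 in the second, so \<open>q_rel\<close> applies in each factor separately.\<close>
    have s: "tlift K ?UU (\<lambda>a b. tlift K ?UU (\<lambda>c d. \<tau> x1 x2 a c b d) (comult C y2)) (comult C y1)
        = tens K U U (q x1) (q x2) \<otimes>\<^bsub>?UU\<^esub> tens K U U (q y1) (q y2)"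
      if y1: "y1 \<in> carrier C" and y2: "y2 \<in> carrier C" for y1 y2
    proof -
      note r1 = rel_bilin[OF U_algebra q_lin x12(1)] and r2 = rel_bilin[OF U_algebra q_lin x12(2)]
      have "tens K U U (q x1) (q x2) \<otimes>\<^bsub>?UU\<^esub> tens K U U (q y1) (q y2)
          = tens K U U (tlift K U (\<lambda>a b. q a \<otimes>\<^bsub>U\<^esub> q (x1 \<lhd>\<^bsub>C\<^esub> b)) (comult C y1))
              (tlift K U (\<lambda>c d. q c \<otimes>\<^bsub>U\<^esub> q (x2 \<lhd>\<^bsub>C\<^esub> d)) (comult C y2))"
        by (simp add: tens_mult[OF U_algebra U_algebra] q_closed q_rel x12 y1 y2)
      also have "\<dots> = tlift K ?UU (\<lambda>a b. tens K U U (q a \<otimes>\<^bsub>U\<^esub> q (x1 \<lhd>\<^bsub>C\<^esub> b))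
              (tlift K U (\<lambda>c d. q c \<otimes>\<^bsub>U\<^esub> q (x2 \<lhd>\<^bsub>C\<^esub> d)) (comult C y2))) (comult C y1)"
        by (rule C_tlift_comp[OF U_module UU_module r1 bilin_left[OF tens_UU] comult_closed[OF y1]])
          (rule tlift_closed[OF coalg_module coalg_module U_module r2 comult_closed[OF y2]])
      also have "\<dots> = tlift K ?UU (\<lambda>a b. tlift K ?UU (\<lambda>c d. \<tau> x1 x2 a c b d) (comult C y2)) (comult C y1)"
      proof (rule C_tlift_cong[OF UU_module comult_closed[OF y1]])
        show "(\<lambda>a b. tlift K ?UU (\<lambda>c d. \<tau> x1 x2 a c b d) (comult C y2)) \<in> bilin K C C ?UU"
          by (assumption | rule \<tau>r x12 y2)+
        fix a b assume ab: "a \<in> carrier C" "b \<in> carrier C"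
        have "q a \<otimes>\<^bsub>U\<^esub> q (x1 \<lhd>\<^bsub>C\<^esub> b) \<in> carrier U" by (assumption | rule rules x12 ab)+
        from C_tlift_comp[OF U_module UU_module r2 bilin_right[OF tens_UU this] comult_closed[OF y2]]
        show "tens K U U (q a \<otimes>\<^bsub>U\<^esub> q (x1 \<lhd>\<^bsub>C\<^esub> b)) (tlift K U (\<lambda>c d. q c \<otimes>\<^bsub>U\<^esub> q (x2 \<lhd>\<^bsub>C\<^esub> d)) (comult C y2))
            = tlift K ?UU (\<lambda>c d. \<tau> x1 x2 a c b d) (comult C y2)"
          by (simp only: \<tau>_def)
      qed
      finally show ?thesis by simp
    qed
    have "tlift K ?UU (\<lambda>y1 y2. tlift K ?UU (\<lambda>a b. tlift K ?UU (\<lambda>c d. \<tau> x1 x2 a b c d) (comult C y2)) (comult C y1)) (comult C y)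
        = tlift K ?UU (\<lambda>y1 y2. tlift K ?UU (\<lambda>a b. tlift K ?UU (\<lambda>c d. \<tau> x1 x2 a c b d) (comult C y2)) (comult C y1)) (comult C y)"
      by (rule cocomm_swap_middle[OF cc UU_module y]) (assumption | rule \<tau>cd \<tau>ab x12)+
    also have "\<dots> = tlift K ?UU (\<lambda>y1 y2. tens K U U (q x1) (q x2) \<otimes>\<^bsub>?UU\<^esub> tens K U U (q y1) (q y2)) (comult C y)"
      by (rule C_tlift_cong[OF UU_module comult_closed[OF y] e1]) (rule s)
    also have "\<dots> = tens K U U (q x1) (q x2) \<otimes>\<^bsub>?UU\<^esub> qq y"
      unfolding qq_def
      by (rule C_tlift_comp[OF UU_module UU_module tens_qq bilin_right[OF mult_UU tx] comult_closed[OF y], symmetric])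
    finally show ?thesis .
  qed
  have "tlift K ?UU (\<lambda>y1 y2. qq y1 \<otimes>\<^bsub>?UU\<^esub> qq (x \<lhd>\<^bsub>C\<^esub> y2)) (comult C y)
      = tlift K ?UU (\<lambda>y1 y2. tlift K ?UU (\<lambda>x1 x2. tlift K ?UU (\<lambda>a b. tlift K ?UU (\<tau> x1 x2 a b) (comult C y2)) (comult C y1)) (comult C x)) (comult C y)"
    by (rule C_tlift_cong[OF UU_module comult_closed[OF y]]) ((assumption | rule \<tau>r x)+, (rule prod; assumption))
  \<comment> \<open>With x1 and x2 outermost, the remaining sums split y alone into four legs, as
    \<open>cocomm_swap_middle\<close> requires.\<close>
  also have "\<dots> = tlift K ?UU (\<lambda>x1 x2. tlift K ?UU (\<lambda>y1 y2. tlift K ?UU (\<lambda>a b. tlift K ?UU (\<tau> x1 x2 a b) (comult C y2)) (comult C y1)) (comult C y)) (comult C x)"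
    by (rule C_tlift_exchange[OF UU_module comult_closed[OF y] comult_closed[OF x]]) (assumption | rule \<tau>r)+
  also have "\<dots> = tlift K ?UU (\<lambda>x1 x2. tens K U U (q x1) (q x2) \<otimes>\<^bsub>?UU\<^esub> qq y) (comult C x)"
    by (rule C_tlift_cong[OF UU_module comult_closed[OF x]])
      ((assumption | rule rules lin_closed[OF qq_lin] y)+, (rule inner; assumption))
  also have "\<dots> = qq x \<otimes>\<^bsub>?UU\<^esub> qq y"
    unfolding qq_def[of x]
    by (rule C_tlift_comp[OF UU_module UU_module tens_qq bilin_left[OF mult_UU lin_closed[OF qq_lin y]] comult_closed[OF x], symmetric])
  finally show ?thesis .
qed

end

section \<open>Bialgebra structure of U(C)\<close>

locale cocommutative_rack_bialgebra = rack_bialgebra +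
  assumes cocomm: "cocommutative K C"
begin

lemma pi_lin: "\<pi> \<in> lin K T U"
  by (rule alg_hom_lin[OF pi_hom])

text \<open>The coproduct of T followed by \<pi> \<otimes> \<pi> is the map that has to factor
  through U(C); its values on generators are the elements for which \<open>qq_rel\<close> was
  shown.\<close>

lemma descended_comult:
  shows "(\<lambda>t. tmap K U U \<pi> \<pi> (envT_comult K C t)) \<in> alg_hom K T (tensor K U U)"
    and "x \<in> carrier C \<Longrightarrow> tmap K U U \<pi> \<pi> (envT_comult K C (i x)) = qq x"
proof -
  show "(\<lambda>t. tmap K U U \<pi> \<pi> (envT_comult K C t)) \<in> alg_hom K T (tensor K U U)"
    by (rule alg_hom_comp[OF tmap_alg_hom[OF T_algebra T_algebra U_algebra U_algebra pi_hom pi_hom] envT_comult_props(1)])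
  note b = tmap_bilin[OF T_module T_module i_lin i_lin]
  note M = tmap_lin[OF T_module T_module U_module U_module pi_lin pi_lin]
  assume x: "x \<in> carrier C"
  show "tmap K U U \<pi> \<pi> (envT_comult K C (i x)) = qq x"
    unfolding envT_comult_props(2)[OF x] qq_def
    by (rule trans[OF C_tlift_comp[OF tensor_module[OF T_module T_module] UU_module b M comult_closed[OF x]]
          C_tlift_cong[OF UU_module comult_closed[OF x] tens_qq]])
      (simp add: tmap_tens[OF T_module T_module U_module U_module pi_lin pi_lin] lin_closed[OF i_lin] env_map_def)
qed

lemma comult_U: "comult U = (\<lambda>s. tmap K U U \<pi> \<pi> (envT_comult K C (SOME t. t \<in> s)))"
  by (simp add: env_bialg_def)

lemma counit_U: "counit U = (\<lambda>s. envT_counit K C (SOME t. t \<in> s))"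
  by (simp add: env_bialg_def)

lemma descended_comult_rel:
  assumes x: "x \<in> carrier C" and y: "y \<in> carrier C"
  shows "tlift K (tensor K U U) (\<lambda>y1 y2. tmap K U U \<pi> \<pi> (envT_comult K C (i y1))
      \<otimes>\<^bsub>tensor K U U\<^esub> tmap K U U \<pi> \<pi> (envT_comult K C (i (x \<lhd>\<^bsub>C\<^esub> y2)))) (comult C y)
    = tmap K U U \<pi> \<pi> (envT_comult K C (i x)) \<otimes>\<^bsub>tensor K U U\<^esub> tmap K U U \<pi> \<pi> (envT_comult K C (i y))"
  unfolding descended_comult(2)[OF x] descended_comult(2)[OF y] qq_rel[OF cocomm x y, symmetric]
  by (rule C_tlift_cong[OF UU_module comult_closed[OF y] rel_bilin[OF UU_algebra qq_lin x]])
    (simp only: descended_comult(2) bilin_closed[OF rack_bilin x])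

lemma comult_U_hom: "comult U \<in> alg_hom K U (tensor K U U)"
  unfolding comult_U by (rule hom_factor(1)[OF UU_algebra descended_comult(1) descended_comult_rel])

lemma comult_U_pi: "t \<in> carrier T \<Longrightarrow> comult U (\<pi> t) = tmap K U U \<pi> \<pi> (envT_comult K C t)"
  unfolding comult_U by (rule hom_factor(2)[OF UU_algebra descended_comult(1) descended_comult_rel])

lemma comult_U_q: "x \<in> carrier C \<Longrightarrow> comult U (q x) = qq x"
  unfolding env_map_def using comult_U_pi[OF lin_closed[OF i_lin]] descended_comult(2) by simp

lemma counit_rel:
  assumes x: "x \<in> carrier C" and y: "y \<in> carrier C"
  shows "tlift K (base_alg K) (\<lambda>y1 y2. envT_counit K C (i y1) \<otimes>\<^bsub>base_alg K\<^esub> envT_counit K C (i (x \<lhd>\<^bsub>C\<^esub> y2))) (comult C y)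
    = envT_counit K C (i x) \<otimes>\<^bsub>base_alg K\<^esub> envT_counit K C (i y)"
proof -
  interpret K: cring K by (rule K_cring)
  note B = base_alg_algebra[OF K_cring]
  have ec: "counit C z \<in> carrier K" if "z \<in> carrier C" for z
    using lin_closed[OF counit_lin that] by simp
  have L: "(\<lambda>z. counit C x \<otimes>\<^bsub>base_alg K\<^esub> counit C z) \<in> lin K C (base_alg K)"
    by (rule bilin_lin_r[OF mult_bilin[OF B] counit_lin lin_closed[OF counit_lin x]])
  have s: "(\<lambda>y1 y2. counit C y1 \<odot>\<^bsub>C\<^esub> y2) \<in> bilin K C C C"
    by (assumption | rule C_rules bilin_lin_l[OF smult_bilin[OF coalg_module]] bilin_lin_r[OF smult_bilin[OF coalg_module]]
        counit_lin lin_closed[OF counit_lin])+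
  have b: "(\<lambda>y1 y2. counit C x \<otimes>\<^bsub>base_alg K\<^esub> counit C (counit C y1 \<odot>\<^bsub>C\<^esub> y2)) \<in> bilin K C C (base_alg K)"
    by (intro bilinI lin_comp[OF L] bilin_left[OF s] bilin_right[OF s])
  \<comment> \<open>Counitality is inserted into \<open>counit C y\<close> and multiplication by
    \<epsilon>(x) is pulled inside. The summands then differ only in the order of \<epsilon>(x) and
    \<epsilon>(y1).\<close>
  have "counit C x \<otimes>\<^bsub>K\<^esub> counit C y = counit C x \<otimes>\<^bsub>base_alg K\<^esub> counit C (tlift K C (\<lambda>y1 y2. counit C y1 \<odot>\<^bsub>C\<^esub> y2) (comult C y))"
    using counit_left[OF y] by (simp add: sweedler_def)
  also have "\<dots> = tlift K (base_alg K) (\<lambda>y1 y2. counit C x \<otimes>\<^bsub>base_alg K\<^esub> counit C (counit C y1 \<odot>\<^bsub>C\<^esub> y2)) (comult C y)"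
    by (rule C_tlift_comp[OF coalg_module base_module s L comult_closed[OF y]])
  also have "\<dots> = tlift K (base_alg K) (\<lambda>y1 y2. envT_counit K C (i y1) \<otimes>\<^bsub>base_alg K\<^esub> envT_counit K C (i (x \<lhd>\<^bsub>C\<^esub> y2))) (comult C y)"
    by (rule C_tlift_cong[OF base_module comult_closed[OF y] b, symmetric])
      (simp add: envT_counit_props(2) bilin_closed[OF rack_bilin] x counit_rack lin_smult[OF counit_lin] ec K.m_ac)
  finally show ?thesis by (simp add: envT_counit_props(2) x y)
qed

lemma counit_U_hom: "counit U \<in> alg_hom K U (base_alg K)"
  unfolding counit_U by (rule hom_factor(1)[OF base_alg_algebra[OF K_cring] envT_counit_props(1) counit_rel])

lemma counit_U_pi: "t \<in> carrier T \<Longrightarrow> counit U (\<pi> t) = envT_counit K C t"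
  unfolding counit_U by (rule hom_factor(2)[OF base_alg_algebra[OF K_cring] envT_counit_props(1) counit_rel])

lemma counit_U_q: "x \<in> carrier C \<Longrightarrow> counit U (q x) = counit C x"
  unfolding env_map_def using counit_U_pi[OF lin_closed[OF i_lin]] envT_counit_props(2) by simp

lemmas comult_U_lin = alg_hom_lin[OF comult_U_hom]
lemmas counit_U_lin = alg_hom_lin[OF counit_U_hom]

lemma comult_U_closed: "s \<in> carrier U \<Longrightarrow> comult U s \<in> carrier (tensor K U U)"
  by (rule lin_closed[OF comult_U_lin])

text \<open>By \<open>comult_U_q\<close> the legs of q x are the images of the legs of x. This
  brings identities on generators of U(C) back to C.\<close>

lemma tlift_comult_q:
  assumes P: "module K P" and \<beta>: "\<beta> \<in> bilin K U U P" and x: "x \<in> carrier C"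
  shows "tlift K P \<beta> (comult U (q x)) = tlift K P (\<lambda>x1 x2. \<beta> (q x1) (q x2)) (comult C x)"
  unfolding comult_U_q[OF x] qq_def
  by (rule tlift_tmap[OF coalg_module coalg_module U_module U_module P q_lin q_lin \<beta> comult_closed[OF x], unfolded tmap_def])

lemma q_bilin:
  assumes "\<beta> \<in> bilin K U U P"
  shows "(\<lambda>x1 x2. \<beta> (q x1) (q x2)) \<in> bilin K C C P"
  by (intro bilinI bilin_lin_l[OF assms q_lin] bilin_lin_r[OF assms q_lin] q_closed)

lemmas UUU_algebra = tensor_algebra[OF U_algebra UU_algebra]
lemmas UUU_module = tensor_module[OF U_module UU_module]
lemmas tens_UUU = tens_bilin[OF U_module UU_module]
lemmas UUU_rules = U_rules bilin_lin_l[OF tens_UUU] bilin_lin_r[OF tens_UUU] bilin_closed[OF tens_UUU]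
  tlift_param_lin[OF U_module U_module UUU_module] tlift_arg_lin[OF U_module U_module UUU_module]
  tlift_closed[OF U_module U_module UUU_module]
  comult_U_lin lin_comp[OF comult_U_lin] comult_U_closed UUU_module

text \<open>Both sides are values of algebra maps at s: the coproduct is multiplicative, and so are
  the maps induced by \<open>l\<close> and \<open>r\<close>, which apply it to one tensor factor and
  rebracket. They need only be compared on q(C), where coassociativity of C applies.\<close>

lemma U_coassoc:
  assumes s: "s \<in> carrier U"
  shows "tlift K (tensor K U (tensor K U U)) (\<lambda>s1 s2. tlift K (tensor K U (tensor K U U))
      (\<lambda>s11 s12. tens K U (tensor K U U) s11 (tens K U U s12 s2)) (comult U s1)) (comult U s)
    = tlift K (tensor K U (tensor K U U)) (\<lambda>s1 s2. tens K U (tensor K U U) s1 (comult U s2)) (comult U s)"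
proof -
  let ?UU = "tensor K U U" and ?UUU = "tensor K U (tensor K U U)"
  note mU = bilin_closed[OF mult_U] and one = k_algebra_one_closed[OF U_algebra]
    and tUU = bilin_closed[OF tens_UU]
  have b: "(\<lambda>s11 s12. tens K U ?UU s11 (tens K U U s12 s2)) \<in> bilin K U U ?UUU" if "s2 \<in> carrier U" for s2
    by (assumption | rule UUU_rules that)+
  define l where "l = (\<lambda>s1 s2. tlift K ?UUU (\<lambda>s11 s12. tens K U ?UU s11 (tens K U U s12 s2)) (comult U s1))"
  define r where "r = (\<lambda>s1 s2. tens K U ?UU s1 (comult U s2))"
  have l: "l \<in> bilin K U U ?UUU"
    unfolding l_def by (assumption | rule UUU_rules)+
  have r: "r \<in> bilin K U U ?UUU"
    unfolding r_def by (assumption | rule UUU_rules)+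
  have lh: "tlift K ?UUU l \<in> alg_hom K ?UU ?UUU"
  proof (rule tlift_alg_hom[OF U_algebra U_algebra UUU_algebra l])
    show "l \<one>\<^bsub>U\<^esub> \<one>\<^bsub>U\<^esub> = \<one>\<^bsub>?UUU\<^esub>"
      by (simp add: l_def alg_hom_one[OF comult_U_hom] one_tens[OF U_algebra U_algebra] one_tens[OF U_algebra UU_algebra]
          tlift_tens[OF U_module U_module UUU_module b] one)
    fix a b' a' b'' assume h: "a \<in> carrier U" "b' \<in> carrier U" "a' \<in> carrier U" "b'' \<in> carrier U"
    show "l (a \<otimes>\<^bsub>U\<^esub> a') (b' \<otimes>\<^bsub>U\<^esub> b'') = l a b' \<otimes>\<^bsub>?UUU\<^esub> l a' b''"
      unfolding l_def alg_hom_mult[OF comult_U_hom h(1,3)]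
      \<comment> \<open>The three maps carry b', b'' and their product as the factor that the
        coproduct leaves untouched.\<close>
      by (rule tlift_mult[OF U_algebra U_algebra UUU_algebra b[OF h(2)] b[OF h(4)] b[OF mU[OF h(2,4)]] _
            comult_U_closed[OF h(1)] comult_U_closed[OF h(3)]])
        (simp add: tens_mult[OF U_algebra UU_algebra] tens_mult[OF U_algebra U_algebra] tUU h)
  qed
  have rh: "tlift K ?UUU r \<in> alg_hom K ?UU ?UUU"
  proof (rule tlift_alg_hom[OF U_algebra U_algebra UUU_algebra r])
    show "r \<one>\<^bsub>U\<^esub> \<one>\<^bsub>U\<^esub> = \<one>\<^bsub>?UUU\<^esub>"
      by (simp add: r_def alg_hom_one[OF comult_U_hom] one_tens[OF U_algebra UU_algebra])
    fix a b a' b' assume h: "a \<in> carrier U" "b \<in> carrier U" "a' \<in> carrier U" "b' \<in> carrier U"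
    show "r (a \<otimes>\<^bsub>U\<^esub> a') (b \<otimes>\<^bsub>U\<^esub> b') = r a b \<otimes>\<^bsub>?UUU\<^esub> r a' b'"
      by (simp add: r_def alg_hom_mult[OF comult_U_hom] tens_mult[OF U_algebra UU_algebra] comult_U_closed h)
  qed
  have "tlift K ?UUU l (comult U s) = tlift K ?UUU r (comult U s)"
  proof (rule U_hom_eq[OF alg_hom_comp[OF lh comult_U_hom] alg_hom_comp[OF rh comult_U_hom] _ s])
    fix x assume x: "x \<in> carrier C"
    define \<tau> where "\<tau> = (\<lambda>a b c. tens K U ?UU (q a) (tens K U U (q b) (q c)))"
    have \<tau>1: "\<tau> a \<in> bilin K C C ?UUU" if "a \<in> carrier C" for a
      unfolding \<tau>_def by (assumption | rule UUU_rules that)+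
    have \<tau>2: "(\<lambda>a. \<tau> a b c) \<in> lin K C ?UUU" if "b \<in> carrier C" "c \<in> carrier C" for b c
      unfolding \<tau>_def by (assumption | rule UUU_rules that)+
    have ql: "l (q x1) (q x2) = tlift K ?UUU (\<lambda>x11 x12. \<tau> x11 x12 x2) (comult C x1)"
      if "x1 \<in> carrier C" "x2 \<in> carrier C" for x1 x2
      unfolding l_def \<tau>_def by (rule tlift_comult_q[OF UUU_module b[OF q_closed[OF that(2)]] that(1)])
    have qr: "r (q x1) (q x2) = tlift K ?UUU (\<tau> x1) (comult C x2)"
      if "x1 \<in> carrier C" "x2 \<in> carrier C" for x1 x2
      unfolding r_def \<tau>_def comult_U_q[OF that(2)] qq_def
      by (rule C_tlift_comp[OF UU_module UUU_module tens_qq bilin_right[OF tens_UUU q_closed[OF that(1)]] comult_closed[OF that(2)]])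
    have "tlift K ?UUU l (comult U (q x)) = tlift K ?UUU (\<lambda>x1 x2. l (q x1) (q x2)) (comult C x)"
      by (rule tlift_comult_q[OF UUU_module l x])
    also have "\<dots> = tlift K ?UUU (\<lambda>x1 x2. tlift K ?UUU (\<lambda>x11 x12. \<tau> x11 x12 x2) (comult C x1)) (comult C x)"
      by (rule C_tlift_cong[OF UUU_module comult_closed[OF x] q_bilin[OF l], symmetric]) (rule ql[symmetric])
    also have "\<dots> = tlift K ?UUU (\<lambda>x1 x2. tlift K ?UUU (\<tau> x1) (comult C x2)) (comult C x)"
      by (rule coassoc_trilin[OF UUU_module x \<tau>1 \<tau>2])
    also have "\<dots> = tlift K ?UUU (\<lambda>x1 x2. r (q x1) (q x2)) (comult C x)"
      by (rule C_tlift_cong[OF UUU_module comult_closed[OF x] q_bilin[OF r]]) (rule qr[symmetric])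
    also have "\<dots> = tlift K ?UUU r (comult U (q x))"
      by (rule tlift_comult_q[OF UUU_module r x, symmetric])
    finally show "tlift K ?UUU l (comult U (q x)) = tlift K ?UUU r (comult U (q x))" .
  qed
  then show ?thesis by (simp only: l_def r_def)
qed

lemmas smult_U = smult_bilin[OF U_module]

text \<open>Left and right counit law at once: \<beta> will scale one leg by the counit of the other
  in U(C), and \<gamma> does so in C. As \<beta> is multiplicative, both sides are algebra maps in
  s, and on q(C) the law is that of C.\<close>

lemma U_counit_law:
  assumes \<beta>: "\<beta> \<in> bilin K U U U" and one: "\<beta> \<one>\<^bsub>U\<^esub> \<one>\<^bsub>U\<^esub> = \<one>\<^bsub>U\<^esub>"
    and mult: "\<And>a b a' b'. \<lbrakk>a \<in> carrier U; b \<in> carrier U; a' \<in> carrier U; b' \<in> carrier U\<rbrakk> \<Longrightarrow>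
      \<beta> (a \<otimes>\<^bsub>U\<^esub> a') (b \<otimes>\<^bsub>U\<^esub> b') = \<beta> a b \<otimes>\<^bsub>U\<^esub> \<beta> a' b'"
    and \<gamma>: "\<gamma> \<in> bilin K C C C" and \<beta>\<gamma>: "\<And>a b. \<lbrakk>a \<in> carrier C; b \<in> carrier C\<rbrakk> \<Longrightarrow> \<beta> (q a) (q b) = q (\<gamma> a b)"
    and law: "\<And>x. x \<in> carrier C \<Longrightarrow> tlift K C \<gamma> (comult C x) = x"
    and s: "s \<in> carrier U"
  shows "tlift K U \<beta> (comult U s) = s"
proof (rule U_hom_eq[OF alg_hom_comp[OF tlift_alg_hom[OF U_algebra U_algebra U_algebra \<beta> one mult] comult_U_hom] alg_hom_id _ s])
  fix x assume x: "x \<in> carrier C"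
  have "tlift K U \<beta> (comult U (q x)) = tlift K U (\<lambda>x1 x2. \<beta> (q x1) (q x2)) (comult C x)"
    by (rule tlift_comult_q[OF U_module \<beta> x])
  also have "\<dots> = tlift K U (\<lambda>x1 x2. q (\<gamma> x1 x2)) (comult C x)"
    by (rule C_tlift_cong[OF U_module comult_closed[OF x] q_bilin[OF \<beta>], symmetric]) (rule \<beta>\<gamma>[symmetric])
  also have "\<dots> = q x"
    using C_tlift_comp[OF coalg_module U_module \<gamma> q_lin comult_closed[OF x]] law[OF x] by simp
  finally show "tlift K U \<beta> (comult U (q x)) = q x" .
qed

lemma U_bialgebra: "bialgebra K U"
proof -
  interpret U: k_algebra K U by (rule U_algebra)
  interpret UR: ring U by (rule U.alg_ring)
  interpret UM: module K U by (rule U_module)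
  have ec: "counit U s \<in> carrier K" if "s \<in> carrier U" for s
    using lin_closed[OF counit_U_lin that] by simp
  have em: "counit U (a \<otimes>\<^bsub>U\<^esub> b) = counit U a \<otimes>\<^bsub>K\<^esub> counit U b" if "a \<in> carrier U" "b \<in> carrier U" for a b
    using alg_hom_mult[OF counit_U_hom that] by simp
  note e1 = alg_hom_one[OF counit_U_hom, simplified]
  note rulesU = U_rules bilin_lin_l[OF smult_U] bilin_lin_r[OF smult_U] counit_U_lin lin_closed[OF counit_U_lin]
  note rulesC = C_rules bilin_lin_l[OF smult_bilin[OF coalg_module]] bilin_lin_r[OF smult_bilin[OF coalg_module]]
    counit_lin lin_closed[OF counit_lin]
  have ecC: "counit C x \<in> carrier K" if "x \<in> carrier C" for x
    using lin_closed[OF counit_lin that] by simp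
  \<comment> \<open>This yields the multiplicativity of \<beta> in \<open>U_counit_law\<close>, the
    counit being multiplicative itself.\<close>
  have sm: "(a \<otimes>\<^bsub>K\<^esub> b) \<odot>\<^bsub>U\<^esub> (x \<otimes>\<^bsub>U\<^esub> y) = (a \<odot>\<^bsub>U\<^esub> x) \<otimes>\<^bsub>U\<^esub> (b \<odot>\<^bsub>U\<^esub> y)"
    if "a \<in> carrier K" "b \<in> carrier K" "x \<in> carrier U" "y \<in> carrier U" for a b x y
    using that by (simp add: U.smult_mult_left U.smult_mult_right UM.smult_assoc1[symmetric] UM.m_comm)
  have left: "tlift K U (\<lambda>s1 s2. counit U s1 \<odot>\<^bsub>U\<^esub> s2) (comult U s) = s" if s: "s \<in> carrier U" for s
  proof (rule U_counit_law[OF _ _ _ _ _ _ s])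
    show "(\<lambda>s1 s2. counit U s1 \<odot>\<^bsub>U\<^esub> s2) \<in> bilin K U U U"
      by (assumption | rule rulesU)+
    show "(\<lambda>x1 x2. counit C x1 \<odot>\<^bsub>C\<^esub> x2) \<in> bilin K C C C"
      by (assumption | rule rulesC)+
    show "tlift K C (\<lambda>x1 x2. counit C x1 \<odot>\<^bsub>C\<^esub> x2) (comult C x) = x" if "x \<in> carrier C" for x
      using counit_left[OF that] by (simp add: sweedler_def)
  qed (simp_all add: e1 em ec sm counit_U_q lin_smult[OF q_lin] ecC)
  have right: "tlift K U (\<lambda>s1 s2. counit U s2 \<odot>\<^bsub>U\<^esub> s1) (comult U s) = s" if s: "s \<in> carrier U" for s
  proof (rule U_counit_law[OF _ _ _ _ _ _ s])
    show "(\<lambda>s1 s2. counit U s2 \<odot>\<^bsub>U\<^esub> s1) \<in> bilin K U U U"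
      by (assumption | rule rulesU)+
    show "(\<lambda>x1 x2. counit C x2 \<odot>\<^bsub>C\<^esub> x1) \<in> bilin K C C C"
      by (assumption | rule rulesC)+
    show "tlift K C (\<lambda>x1 x2. counit C x2 \<odot>\<^bsub>C\<^esub> x1) (comult C x) = x" if "x \<in> carrier C" for x
      using counit_right[OF that] by (simp add: sweedler_def)
  qed (simp_all add: e1 em ec sm counit_U_q lin_smult[OF q_lin] ecC)
  have "coalgebra K U"
    by (intro coalgebra.intro) (simp_all add: U_module comult_U_lin counit_U_lin sweedler_def U_coassoc left right)
  then show ?thesis
    by (intro bialgebra.intro U_algebra bialgebra_axioms.intro comult_U_hom counit_U_hom)
qed

section \<open>The action of U(C) on C\<close>

lemma act_kills_J:
  assumes n: "n \<in> J" and z: "z \<in> carrier C"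
  shows "envT_act K C z n = \<zero>\<^bsub>C\<^esub>"
proof -
  interpret A: right_module K T C "envT_act K C" by (rule envT_act_props(1))
  interpret C: module K C by (rule coalg_module)
  interpret T: ring T by (rule T_ring)
  interpret TM: module K T by (rule T_module)
  note l = bilin_left[OF A.act_bilin] and r = bilin_right[OF A.act_bilin] and c = bilin_closed[OF A.act_bilin]
  note ai = envT_act_props(2)
  \<comment> \<open>The annihilator of C takes the part that the kernel plays for algebra maps.
    Quantifying over all z makes it absorb factors on the left, as z.(t.n) = (z.t).n; on the right,
    z.(n.t) = (z.n).t with z.n = 0.\<close>
  let ?I = "{n \<in> carrier T. \<forall>z\<in>carrier C. envT_act K C z n = \<zero>\<^bsub>C\<^esub>}"
  have sub: "submodule ?I K T"
    by (rule TM.submoduleI_add_smult)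
      (auto simp: lin_zero[OF T_module coalg_module r] lin_add[OF r] lin_smult[OF r])
  have "ideal ?I T"
  proof (rule idealI[OF T_ring submodule.axioms(1)[OF sub]])
    show "t \<otimes>\<^bsub>T\<^esub> n \<in> ?I" if "n \<in> ?I" "t \<in> carrier T" for n t
      using that by (auto simp: A.act_mult c)
    show "n \<otimes>\<^bsub>T\<^esub> t \<in> ?I" if "n \<in> ?I" "t \<in> carrier T" for n t
      using that by (auto simp: A.act_mult c lin_zero[OF coalg_module coalg_module l])
  qed
  moreover have "env_rel x y \<in> ?I" if x: "x \<in> carrier C" and y: "y \<in> carrier C" for x y
  proof -
    have "envT_act K C z (env_rel x y) = \<zero>\<^bsub>C\<^esub>" if z: "z \<in> carrier C" for z
    proof -
      have b: "(\<lambda>y1 y2. (z \<lhd>\<^bsub>C\<^esub> y1) \<lhd>\<^bsub>C\<^esub> (x \<lhd>\<^bsub>C\<^esub> y2)) \<in> bilin K C C C"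
        by (assumption | rule C_rules x z)+
      have "envT_act K C z (tlift K T (\<lambda>y1 y2. i y1 \<otimes>\<^bsub>T\<^esub> i (x \<lhd>\<^bsub>C\<^esub> y2)) (comult C y))
          = tlift K C (\<lambda>y1 y2. (z \<lhd>\<^bsub>C\<^esub> y1) \<lhd>\<^bsub>C\<^esub> (x \<lhd>\<^bsub>C\<^esub> y2)) (comult C y)"
        by (rule trans[OF C_tlift_comp[OF T_module coalg_module rel_bilin[OF T_algebra i_lin x] r[OF z] comult_closed[OF y]]
              C_tlift_cong[OF coalg_module comult_closed[OF y] b]])
          (simp add: A.act_mult ai z x lin_closed[OF i_lin] bilin_closed[OF rack_bilin])
      also have "\<dots> = (z \<lhd>\<^bsub>C\<^esub> x) \<lhd>\<^bsub>C\<^esub> y"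
        using self_distrib[OF z x y] by (simp add: sweedler_def)
      finally have "envT_act K C z (env_rel x y) = ((z \<lhd>\<^bsub>C\<^esub> x) \<lhd>\<^bsub>C\<^esub> y) \<ominus>\<^bsub>C\<^esub> ((z \<lhd>\<^bsub>C\<^esub> x) \<lhd>\<^bsub>C\<^esub> y)"
        unfolding env_rel_def lin_diff[OF T_module coalg_module r[OF z] env_rel_closed(1,2)[OF x y]]
        by (simp add: A.act_mult ai z x y lin_closed[OF i_lin] bilin_closed[OF rack_bilin])
      then show ?thesis
        using C.M.diff_self[OF bilin_closed[OF rack_bilin bilin_closed[OF rack_bilin z x] y]] by simp
    qed
    then show ?thesis by (simp add: env_rel_closed x y)
  qed
  ultimately have "J \<subseteq> ?I" by (rule J_minimal)
  then show ?thesis using n z by auto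
qed

lemma env_act_pi:
  assumes x: "x \<in> carrier C" and t: "t \<in> carrier T"
  shows "env_act K C x (\<pi> t) = envT_act K C x t"
proof -
  interpret Q: quotient_module K T J by (rule U_quotient_module)
  note r = bilin_right[OF right_module.act_bilin[OF envT_act_props(1)]]
  show ?thesis
    unfolding env_act_def env_proj_def by (rule Q.lin_factor[OF coalg_module r[OF x] act_kills_J[OF _ x] t])
qed

lemma env_act_module: "right_module K U C (env_act K C)"
proof -
  interpret A: right_module K T C "envT_act K C" by (rule envT_act_props(1))
  interpret Q: quotient_module K T J by (rule U_quotient_module)
  note l = bilin_left[OF A.act_bilin] and r = bilin_right[OF A.act_bilin] and c = bilin_closed[OF A.act_bilin]
  show ?thesis
  proof (intro right_module.intro U_algebra coalg_module bilinI)
    show "(\<lambda>s. env_act K C x s) \<in> lin K U C" if x: "x \<in> carrier C" for x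
      using Q.lin_factor_lin[OF coalg_module r[OF x] act_kills_J[OF _ x]]
      by (simp add: env_act_def env_bialg_def env_alg_def)
    show "(\<lambda>x. env_act K C x s) \<in> lin K C C" if s: "s \<in> carrier U" for s
    proof -
      \<comment> \<open>One representative t serves for all x, so linearity in x is inherited from
        the action of T.\<close>
      obtain t where t: "t \<in> carrier T" "s = \<pi> t" using s by (auto simp: U_carrier)
      show ?thesis
        by (rule lin_cong[OF l[OF t(1)] coalg_module]) (simp add: t env_act_pi)
    qed
    fix x assume x: "x \<in> carrier C"
    show "env_act K C x \<one>\<^bsub>U\<^esub> = x"
      using env_act_pi[OF x k_algebra_one_closed[OF T_algebra]] by (simp add: alg_hom_one[OF pi_hom] A.act_one x)
    fix s t assume "s \<in> carrier U" "t \<in> carrier U"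
    then obtain s' t' where st: "s' \<in> carrier T" "s = \<pi> s'" "t' \<in> carrier T" "t = \<pi> t'"
      by (auto simp: U_carrier)
    show "env_act K C x (s \<otimes>\<^bsub>U\<^esub> t) = env_act K C (env_act K C x s) t"
      by (simp add: st env_act_pi x c A.act_mult k_algebra_mult_closed[OF T_algebra] flip: alg_hom_mult[OF pi_hom])
  qed
qed

lemma env_act_q: "\<lbrakk>x \<in> carrier C; y \<in> carrier C\<rbrakk> \<Longrightarrow> env_act K C x (q y) = x \<lhd>\<^bsub>C\<^esub> y"
  by (simp add: env_map_def env_act_pi envT_act_props(2) lin_closed[OF i_lin])

end

section \<open>The Yetter-Drinfel'd structure on C\<close>

context cocommutative_rack_bialgebra
begin

lemmas act_bilin_U = right_module.act_bilin[OF env_act_module]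
lemmas act_mult_U = right_module.act_mult[OF env_act_module]
lemmas act_one_U = right_module.act_one[OF env_act_module]
lemmas CC_module = tensor_module[OF coalg_module coalg_module]
lemmas tens_CC = tens_bilin[OF coalg_module coalg_module]
lemmas U_tlift_param = tlift_param_lin[OF U_module U_module]
lemmas U_tlift_arg = tlift_arg_lin[OF U_module U_module]
lemmas U_tlift_cong = tlift_cong[OF U_module U_module]
lemmas U_tlift_comp = tlift_comp[OF U_module U_module]
lemmas act_rules = U_rules CC_module bilin_lin_l[OF act_bilin_U] bilin_lin_r[OF act_bilin_U] bilin_closed[OF act_bilin_U]
  bilin_lin_l[OF tens_CC] bilin_lin_r[OF tens_CC] bilin_closed[OF tens_CC] comult_U_lin comult_U_closed
  tlift_closed[OF coalg_module coalg_module CC_module] tlift_closed[OF U_module U_module CC_module]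
  C_tlift_param[OF CC_module] C_tlift_arg[OF CC_module] U_tlift_param[OF CC_module] U_tlift_arg[OF CC_module]

text \<open>On q(C) this is the compatibility of \<lhd> with the coproduct. For products it amounts
  to associativity of the action of U(C) on C \<otimes> C through the coproduct of U(C).\<close>

lemma comult_act:
  assumes "c \<in> carrier C" and "s \<in> carrier U"
  shows "comult C (env_act K C c s) = tlift K (tensor K C C) (\<lambda>c1 c2. tlift K (tensor K C C)
    (\<lambda>s1 s2. tens K C C (env_act K C c1 s1) (env_act K C c2 s2)) (comult U s)) (comult C c)"
proof -
  let ?CC = "tensor K C C"
  let ?a = "env_act K C"
  \<comment> \<open>\<Psi> s c1 c2 is the result of s acting on c1 \<otimes> c2 through its
    coproduct; \<Phi> c s will be s acting on the coproduct of c.\<close>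
  define \<Psi> where "\<Psi> = (\<lambda>s c1 c2. tlift K ?CC (\<lambda>s1 s2. tens K C C (?a c1 s1) (?a c2 s2)) (comult U s))"
  \<comment> \<open>Serves to unfold \<Psi> at s alone where \<Psi> at t occurs as well.\<close>
  have \<Psi>_eq: "\<Psi> s c1 c2 = tlift K ?CC (\<lambda>s1 s2. tens K C C (?a c1 s1) (?a c2 s2)) (comult U s)" for s c1 c2
    by (simp only: \<Psi>_def)
  have \<beta>: "(\<lambda>s1 s2. tens K C C (?a c1 s1) (?a c2 s2)) \<in> bilin K U U ?CC"
    if "c1 \<in> carrier C" "c2 \<in> carrier C" for c1 c2
    by (assumption | rule act_rules that)+
  have \<Psi>: "\<Psi> s \<in> bilin K C C ?CC" if "s \<in> carrier U" for s
    unfolding \<Psi>_def by (assumption | rule act_rules that)+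
  have \<Psi>s: "(\<lambda>s. \<Psi> s c1 c2) \<in> lin K U ?CC" if "c1 \<in> carrier C" "c2 \<in> carrier C" for c1 c2
    unfolding \<Psi>_def by (assumption | rule act_rules that)+
  define \<Phi> where "\<Phi> = (\<lambda>c s. tlift K ?CC (\<Psi> s) (comult C c))"
  have \<Phi>: "(\<lambda>s. \<Phi> c s) \<in> lin K U ?CC" if c: "c \<in> carrier C" for c
    unfolding \<Phi>_def by (rule C_tlift_param[OF CC_module U_module comult_closed[OF c] \<Psi> \<Psi>s])
  have LHS: "(\<lambda>s. comult C (?a c s)) \<in> lin K U ?CC" if "c \<in> carrier C" for c
    by (rule lin_comp[OF comult_lin bilin_right[OF act_bilin_U that]])
  have "comult C (?a c s) = \<Phi> c s"
    using assms(2,1)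
  proof (induction arbitrary: c rule: U_induct)
    case one
    have "\<Phi> c \<one>\<^bsub>U\<^esub> = tlift K ?CC (tens K C C) (comult C c)"
      unfolding \<Phi>_def
      by (rule C_tlift_cong[OF CC_module comult_closed[OF one] tens_CC])
        (simp add: \<Psi>_def alg_hom_one[OF comult_U_hom] one_tens[OF U_algebra U_algebra]
          tlift_tens[OF U_module U_module CC_module \<beta>] k_algebra_one_closed[OF U_algebra] act_one_U)
    also have "\<dots> = comult C c"
      \<comment> \<open>The linear map induced by the pure tensor map is the identity of C \<otimes>
        C.\<close>
      by (rule tensor_lin_eq[OF coalg_module coalg_module tlift_lin[OF coalg_module coalg_module CC_module tens_CC] lin_id _ comult_closed[OF one]])
        (rule tlift_tens[OF coalg_module coalg_module CC_module tens_CC])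
    finally show ?case by (simp add: act_one_U one)
  next
    case (incl x)
    have b: "(\<lambda>x1 x2. tlift K ?CC (\<lambda>y1 y2. tens K C C (x1 \<lhd>\<^bsub>C\<^esub> y1) (x2 \<lhd>\<^bsub>C\<^esub> y2)) (comult C x)) \<in> bilin K C C ?CC"
      by (assumption | rule act_rules incl(1))+
    have b': "(\<lambda>y1 y2. tens K C C (x1 \<lhd>\<^bsub>C\<^esub> y1) (x2 \<lhd>\<^bsub>C\<^esub> y2)) \<in> bilin K C C ?CC"
      if "x1 \<in> carrier C" "x2 \<in> carrier C" for x1 x2
      by (assumption | rule act_rules that)+
    show ?case
      unfolding env_act_q[OF incl(2,1)] comult_rack[OF incl(2,1)] \<Phi>_def
    proof (rule C_tlift_cong[OF CC_module comult_closed[OF incl(2)] b, symmetric])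
      fix x1 x2 assume x12: "x1 \<in> carrier C" "x2 \<in> carrier C"
      show "\<Psi> (q x) x1 x2 = tlift K ?CC (\<lambda>y1 y2. tens K C C (x1 \<lhd>\<^bsub>C\<^esub> y1) (x2 \<lhd>\<^bsub>C\<^esub> y2)) (comult C x)"
        unfolding \<Psi>_def tlift_comult_q[OF CC_module \<beta>[OF x12] incl(1)]
        by (rule C_tlift_cong[OF CC_module comult_closed[OF incl(1)] b'[OF x12]]) (simp add: env_act_q x12)
    qed
  next
    case (add s t)
    then show ?case by (simp add: lin_add[OF LHS] lin_add[OF \<Phi>])
  next
    case (smult a s)
    then show ?case by (simp add: lin_smult[OF LHS] lin_smult[OF \<Phi>])
  next
    case (mult s t)
    have cs: "?a c s \<in> carrier C" by (rule bilin_closed[OF act_bilin_U mult(5,1)])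
    note L = tlift_lin[OF coalg_module coalg_module CC_module \<Psi>[OF mult(2)]]
    have st: "s \<otimes>\<^bsub>U\<^esub> t \<in> carrier U" by (rule bilin_closed[OF mult_U mult(1,2)])
    \<comment> \<open>Acting by s and then by t is acting by st: the module law moves the product
      into each factor, and multiplicativity of the coproduct collects the two sums by
      \<open>tlift_prod\<close>.\<close>
    have inner: "tlift K ?CC (\<Psi> t) (\<Psi> s c1 c2) = \<Psi> (s \<otimes>\<^bsub>U\<^esub> t) c1 c2"
      if c12: "c1 \<in> carrier C" "c2 \<in> carrier C" for c1 c2
    proof -
      have b: "(\<lambda>s1 s2. \<Psi> t (?a c1 s1) (?a c2 s2)) \<in> bilin K U U ?CC"
        by (intro bilinI bilin_lin_l[OF \<Psi>[OF mult(2)]] bilin_lin_r[OF \<Psi>[OF mult(2)]]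
            bilin_right[OF act_bilin_U] bilin_closed[OF act_bilin_U] c12)
      have "tlift K ?CC (\<Psi> t) (\<Psi> s c1 c2) = tlift K ?CC (\<lambda>s1 s2. \<Psi> t (?a c1 s1) (?a c2 s2)) (comult U s)"
        unfolding \<Psi>_eq[of s]
        by (rule trans[OF U_tlift_comp[OF CC_module CC_module \<beta>[OF c12] L comult_U_closed[OF mult(1)]]
              U_tlift_cong[OF CC_module comult_U_closed[OF mult(1)] b]])
          (simp add: tlift_tens[OF coalg_module coalg_module CC_module \<Psi>[OF mult(2)]] bilin_closed[OF act_bilin_U] c12)
      also have "\<dots> = tlift K ?CC (\<lambda>s1 s2. tlift K ?CC (\<lambda>t1 t2. tens K C C (?a c1 (s1 \<otimes>\<^bsub>U\<^esub> t1)) (?a c2 (s2 \<otimes>\<^bsub>U\<^esub> t2))) (comult U t)) (comult U s)"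
      proof (rule U_tlift_cong[OF CC_module comult_U_closed[OF mult(1)] b, symmetric])
        fix s1 s2 assume s12: "s1 \<in> carrier U" "s2 \<in> carrier U"
        show "tlift K ?CC (\<lambda>t1 t2. tens K C C (?a c1 (s1 \<otimes>\<^bsub>U\<^esub> t1)) (?a c2 (s2 \<otimes>\<^bsub>U\<^esub> t2))) (comult U t) = \<Psi> t (?a c1 s1) (?a c2 s2)"
          unfolding \<Psi>_def
          by (rule U_tlift_cong[OF CC_module comult_U_closed[OF mult(2)] \<beta>[OF bilin_closed[OF act_bilin_U c12(1) s12(1)]
                bilin_closed[OF act_bilin_U c12(2) s12(2)]]])
            (simp add: act_mult_U c12 s12)
      qed
      also have "\<dots> = \<Psi> (s \<otimes>\<^bsub>U\<^esub> t) c1 c2"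
        unfolding \<Psi>_def alg_hom_mult[OF comult_U_hom mult(1,2)]
        by (rule tlift_prod[OF U_algebra U_algebra CC_module \<beta>[OF c12] comult_U_closed[OF mult(1)] comult_U_closed[OF mult(2)], symmetric])
      finally show ?thesis .
    qed
    have "comult C (?a c (s \<otimes>\<^bsub>U\<^esub> t)) = \<Phi> (?a c s) t"
      by (simp add: act_mult_U mult cs)
    also have "\<dots> = tlift K ?CC (\<Psi> t) (tlift K ?CC (\<Psi> s) (comult C c))"
      unfolding \<Phi>_def mult(3)[OF mult(5)] ..
    also have "\<dots> = \<Phi> c (s \<otimes>\<^bsub>U\<^esub> t)"
      unfolding \<Phi>_def
      by (rule trans[OF C_tlift_comp[OF CC_module CC_module \<Psi>[OF mult(1)] L comult_closed[OF mult(5)]]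
            C_tlift_cong[OF CC_module comult_closed[OF mult(5)] \<Psi>[OF st]]]) (rule inner)
    finally show ?case .
  qed
  then show ?thesis by (simp only: \<Phi>_def \<Psi>_def)
qed

lemma counit_act:
  assumes "c \<in> carrier C" and "s \<in> carrier U"
  shows "counit C (env_act K C c s) = counit C c \<otimes>\<^bsub>K\<^esub> counit U s"
proof -
  interpret K: cring K by (rule K_cring)
  note L = lin_comp[OF counit_lin bilin_right[OF act_bilin_U]]
  have e: "counit C c \<in> carrier K" if "c \<in> carrier C" for c using lin_closed[OF counit_lin that] by simp
  have eU: "counit U s \<in> carrier K" if "s \<in> carrier U" for s using lin_closed[OF counit_U_lin that] by simp
  show ?thesis
    using assms(2,1)
  proof (induction arbitrary: c rule: U_induct)
    case one
    then show ?case using alg_hom_one[OF counit_U_hom] by (simp add: act_one_U e)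
  next
    case (incl x)
    then show ?case by (simp add: env_act_q counit_rack counit_U_q)
  next
    case (add s t)
    then show ?case by (simp add: lin_add[OF L] lin_add[OF counit_U_lin] e eU K.r_distr)
  next
    case (smult a s)
    then show ?case by (simp add: lin_smult[OF L] lin_smult[OF counit_U_lin] e eU K.m_lcomm)
  next
    case (mult s t)
    then show ?case
      using alg_hom_mult[OF counit_U_hom mult(1,2)]
      by (simp add: act_mult_U bilin_closed[OF act_bilin_U] e eU K.m_assoc)
  qed
qed

text \<open>For h in q(C) this is the defining relation. The elements h that satisfy it for every a
  are closed under products: by the module law the condition for t can be used at a moved by the
  second leg of s, and what remains is the condition for s at a.\<close>

lemma env_yetter_drinfeld:
  assumes "a \<in> carrier C" and "h \<in> carrier U"
  shows "tlift K U (\<lambda>h1 h2. h1 \<otimes>\<^bsub>U\<^esub> q (env_act K C a h2)) (comult U h) = q a \<otimes>\<^bsub>U\<^esub> h"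
proof -
  interpret U: k_algebra K U by (rule U_algebra)
  interpret UR: ring U by (rule U.alg_ring)
  note one_U = k_algebra_one_closed[OF U_algebra]
  let ?a = "env_act K C"
  have b: "(\<lambda>h1 h2. h1 \<otimes>\<^bsub>U\<^esub> q (?a a h2)) \<in> bilin K U U U" if "a \<in> carrier C" for a
    by (assumption | rule act_rules that)+
  have L: "(\<lambda>h. tlift K U (\<lambda>h1 h2. h1 \<otimes>\<^bsub>U\<^esub> q (?a a h2)) (comult U h)) \<in> lin K U U" if "a \<in> carrier C" for a
    by (rule U_tlift_arg[OF U_module b[OF that] comult_U_lin])
  show ?thesis
    using assms(2,1)
  proof (induction arbitrary: a rule: U_induct)
    case one
    then show ?case
      by (simp add: alg_hom_one[OF comult_U_hom] one_tens[OF U_algebra U_algebra]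
          tlift_tens[OF U_module U_module U_module b] one_U act_one_U q_closed)
  next
    case (incl x)
    have "tlift K U (\<lambda>y1 y2. q y1 \<otimes>\<^bsub>U\<^esub> q (?a a (q y2))) (comult C x)
        = tlift K U (\<lambda>y1 y2. q y1 \<otimes>\<^bsub>U\<^esub> q (a \<lhd>\<^bsub>C\<^esub> y2)) (comult C x)"
      by (rule C_tlift_cong[OF U_module comult_closed[OF incl(1)] rel_bilin[OF U_algebra q_lin incl(2)]])
        (simp add: env_act_q incl)
    then show ?case
      unfolding tlift_comult_q[OF U_module b[OF incl(2)] incl(1)] by (simp add: q_rel incl)
  next
    case (add s t)
    then show ?case by (simp add: lin_add[OF L] q_closed UR.r_distr)
  next
    case (smult k s)
    then show ?case by (simp add: lin_smult[OF L] q_closed U.smult_mult_right)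
  next
    case (mult s t)
    have qa: "q (?a a h2) \<in> carrier U" if "h2 \<in> carrier U" for h2
      using that mult(5) by (simp add: q_closed bilin_closed[OF act_bilin_U])
    have b2: "(\<lambda>h1 h2. (h1 \<otimes>\<^bsub>U\<^esub> q (?a a h2)) \<otimes>\<^bsub>U\<^esub> t) \<in> bilin K U U U"
      by (assumption | rule act_rules mult(2,5))+
    have "tlift K U (\<lambda>h1 h2. h1 \<otimes>\<^bsub>U\<^esub> q (?a a h2)) (comult U (s \<otimes>\<^bsub>U\<^esub> t))
        = tlift K U (\<lambda>h1 h2. tlift K U (\<lambda>h1' h2'. (h1 \<otimes>\<^bsub>U\<^esub> h1') \<otimes>\<^bsub>U\<^esub> q (?a a (h2 \<otimes>\<^bsub>U\<^esub> h2'))) (comult U t)) (comult U s)"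
      unfolding alg_hom_mult[OF comult_U_hom mult(1,2)]
      by (rule tlift_prod[OF U_algebra U_algebra U_module b[OF mult(5)] comult_U_closed[OF mult(1)] comult_U_closed[OF mult(2)]])
    also have "\<dots> = tlift K U (\<lambda>h1 h2. (h1 \<otimes>\<^bsub>U\<^esub> q (?a a h2)) \<otimes>\<^bsub>U\<^esub> t) (comult U s)"
    proof (rule U_tlift_cong[OF U_module comult_U_closed[OF mult(1)] b2])
      fix h1 h2 assume h12: "h1 \<in> carrier U" "h2 \<in> carrier U"
      have ah: "?a a h2 \<in> carrier C" by (rule bilin_closed[OF act_bilin_U mult(5) h12(2)])
      note l = bilin_right[OF mult_U h12(1)]
      have b3: "(\<lambda>h1' h2'. h1 \<otimes>\<^bsub>U\<^esub> (h1' \<otimes>\<^bsub>U\<^esub> q (?a (?a a h2) h2'))) \<in> bilin K U U U"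
        by (intro bilinI lin_comp[OF l] bilin_left[OF b[OF ah]] bilin_right[OF b[OF ah]])
      have "tlift K U (\<lambda>h1' h2'. (h1 \<otimes>\<^bsub>U\<^esub> h1') \<otimes>\<^bsub>U\<^esub> q (?a a (h2 \<otimes>\<^bsub>U\<^esub> h2'))) (comult U t)
          = tlift K U (\<lambda>h1' h2'. h1 \<otimes>\<^bsub>U\<^esub> (h1' \<otimes>\<^bsub>U\<^esub> q (?a (?a a h2) h2'))) (comult U t)"
        by (rule U_tlift_cong[OF U_module comult_U_closed[OF mult(2)] b3])
          (simp add: act_mult_U mult(5) h12 UR.m_assoc q_closed bilin_closed[OF act_bilin_U])
      also have "\<dots> = h1 \<otimes>\<^bsub>U\<^esub> tlift K U (\<lambda>h1' h2'. h1' \<otimes>\<^bsub>U\<^esub> q (?a (?a a h2) h2')) (comult U t)"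
        by (rule U_tlift_comp[OF U_module U_module b[OF ah] l comult_U_closed[OF mult(2)], symmetric])
      also have "\<dots> = (h1 \<otimes>\<^bsub>U\<^esub> q (?a a h2)) \<otimes>\<^bsub>U\<^esub> t"
        using mult(4)[OF ah] by (simp add: UR.m_assoc h12 qa mult(2))
      finally show "tlift K U (\<lambda>h1' h2'. (h1 \<otimes>\<^bsub>U\<^esub> h1') \<otimes>\<^bsub>U\<^esub> q (?a a (h2 \<otimes>\<^bsub>U\<^esub> h2'))) (comult U t)
          = (h1 \<otimes>\<^bsub>U\<^esub> q (?a a h2)) \<otimes>\<^bsub>U\<^esub> t" .
    qed
    also have "\<dots> = tlift K U (\<lambda>h1 h2. h1 \<otimes>\<^bsub>U\<^esub> q (?a a h2)) (comult U s) \<otimes>\<^bsub>U\<^esub> t"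
      by (rule U_tlift_comp[OF U_module U_module b[OF mult(5)] bilin_left[OF mult_U mult(2)] comult_U_closed[OF mult(1)], symmetric])
    also have "\<dots> = q a \<otimes>\<^bsub>U\<^esub> (s \<otimes>\<^bsub>U\<^esub> t)"
      using mult(3)[OF mult(5)] by (simp add: UR.m_assoc mult q_closed)
    finally show ?case .
  qed
qed

lemma U_yetter_drinfeld_rack: "yetter_drinfeld_rack K U C (env_act K C) q"
proof (intro yetter_drinfeld_rack.intro rack_bialgebra_axioms U_bialgebra env_act_module yetter_drinfeld_rack_axioms.intro)
  show "tlift K C (env_act K C) \<in> coalg_hom K (tensor_coalg K C U) C"
    unfolding tensor_coalg_hom_iff[OF coalgebra_axioms bialgebra.axioms(2)[OF U_bialgebra] coalgebra_axioms act_bilin_U]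
    using comult_act counit_act by simp
  show "q \<in> coalg_hom K C U"
    by (simp add: coalg_hom_def q_lin comult_U_q counit_U_q qq_def tmap_def)
  show "sweedler K U U (\<lambda>h1 h2. h1 \<otimes>\<^bsub>U\<^esub> q (env_act K C a h2)) h = q a \<otimes>\<^bsub>U\<^esub> h"
    if "a \<in> carrier C" "h \<in> carrier U" for a h
    using env_yetter_drinfeld[OF that] by (simp add: sweedler_def)
qed (simp_all add: q_one env_act_q)

section \<open>Universal property of U(C)\<close>

lemma universal_hom:
  assumes "yetter_drinfeld_rack K H C actH qH"
  obtains u where "u \<in> bialg_hom K U H" "u \<in> extensional (carrier U)" "\<And>x. x \<in> carrier C \<Longrightarrow> u (q x) = qH x"
proof -
  interpret Y: yetter_drinfeld_rack K H C actH qH by fact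
  note H = Y.k_algebra_axioms
  note mH = Y.alg_module
  note HH = tensor_algebra[OF H H]
  have ql: "qH \<in> lin K C H" using Y.q_coalg_hom by (simp add: coalg_hom_def)
  have qc: "comult H (qH x) = tmap K H H qH qH (comult C x)" "counit H (qH x) = counit C x"
    if "x \<in> carrier C" for x
    using Y.q_coalg_hom that by (simp_all add: coalg_hom_def)
  obtain h where h: "h \<in> alg_hom K T H" and hi: "\<And>x. x \<in> carrier C \<Longrightarrow> h (i x) = qH x"
    using T_hom_exists[OF H ql Y.q_one] by blast
  note aH = bilin_right[OF Y.act_bilin]
  \<comment> \<open>In H the relation is the Yetter-Drinfel'd condition for \<open>h = qH y\<close>;
    that \<open>qH\<close> is a coalgebra morphism turns the legs of y into the legs of
    \<open>qH y\<close>.\<close>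
  have rel: "tlift K H (\<lambda>y1 y2. h (i y1) \<otimes>\<^bsub>H\<^esub> h (i (x \<lhd>\<^bsub>C\<^esub> y2))) (comult C y) = h (i x) \<otimes>\<^bsub>H\<^esub> h (i y)"
    if x: "x \<in> carrier C" and y: "y \<in> carrier C" for x y
  proof -
    have b: "(\<lambda>h1 h2. h1 \<otimes>\<^bsub>H\<^esub> qH (actH x h2)) \<in> bilin K H H H"
      by (assumption | rule bilinI bilin_lin_l[OF mult_bilin[OF H]] bilin_lin_r[OF mult_bilin[OF H]] lin_id
          lin_comp[OF ql] aH lin_closed[OF ql] bilin_closed[OF Y.act_bilin] x)+
    have "tlift K H (\<lambda>y1 y2. h (i y1) \<otimes>\<^bsub>H\<^esub> h (i (x \<lhd>\<^bsub>C\<^esub> y2))) (comult C y)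
        = tlift K H (\<lambda>y1 y2. qH y1 \<otimes>\<^bsub>H\<^esub> qH (x \<lhd>\<^bsub>C\<^esub> y2)) (comult C y)"
      by (rule C_tlift_cong[OF mH comult_closed[OF y] rel_bilin[OF H ql x]])
        (simp add: hi bilin_closed[OF rack_bilin] x)
    also have "\<dots> = tlift K H (\<lambda>y1 y2. qH y1 \<otimes>\<^bsub>H\<^esub> qH (actH x (qH y2))) (comult C y)"
      by (rule C_tlift_cong[OF mH comult_closed[OF y] rel_bilin[OF H ql x], symmetric])
        (simp add: Y.rack_act x)
    also have "\<dots> = tlift K H (\<lambda>h1 h2. h1 \<otimes>\<^bsub>H\<^esub> qH (actH x h2)) (comult H (qH y))"
      unfolding qc(1)[OF y]
      by (rule tlift_tmap[OF coalg_module coalg_module mH mH mH ql ql b comult_closed[OF y], symmetric])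
    also have "\<dots> = qH x \<otimes>\<^bsub>H\<^esub> qH y"
      using Y.yetter_drinfeld[OF x lin_closed[OF ql y]] by (simp add: sweedler_def)
    finally show ?thesis by (simp add: hi x y)
  qed
  \<comment> \<open>Restricted to the carrier, because uniqueness is asserted among extensional
    functions.\<close>
  define u where "u = (\<lambda>s\<in>carrier U. h (SOME t. t \<in> s))"
  have u: "u \<in> alg_hom K U H"
    by (rule alg_hom_cong[OF hom_factor(1)[OF H h rel] U_algebra]) (simp_all add: u_def)
  have uq: "u (q x) = qH x" if x: "x \<in> carrier C" for x
    using hom_factor(2)[OF H h rel, of "i x"] lin_closed[OF i_lin x] q_closed[OF x] hi[OF x]
    by (simp add: u_def env_map_def)
  note ul = alg_hom_lin[OF u]
  note M = tmap_lin[OF U_module U_module mH mH ul ul]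
  \<comment> \<open>Both sides are algebra maps in s, so comparison on q(C) suffices; there it says
    that \<open>qH\<close> preserves coproducts.\<close>
  have "comult H (u s) = tmap K H H u u (comult U s)" if s: "s \<in> carrier U" for s
  proof (rule U_hom_eq[OF alg_hom_comp[OF Y.comult_alg_hom u]
        alg_hom_comp[OF tmap_alg_hom[OF U_algebra U_algebra H H u u] comult_U_hom] _ s])
    fix x assume x: "x \<in> carrier C"
    have "tmap K H H u u (comult U (q x)) = tlift K (tensor K H H) (\<lambda>x1 x2. tens K H H (u (q x1)) (u (q x2))) (comult C x)"
      unfolding tmap_def[of K H H]
      by (rule tlift_comult_q[OF tensor_module[OF mH mH] tmap_bilin[OF mH mH ul ul] x])
    also have "\<dots> = tmap K H H qH qH (comult C x)"
      unfolding tmap_def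
      by (rule C_tlift_cong[OF tensor_module[OF mH mH] comult_closed[OF x] tmap_bilin[OF mH mH ql ql]]) (simp add: uq)
    finally show "comult H (u (q x)) = tmap K H H u u (comult U (q x))" by (simp add: uq qc x)
  qed
  moreover have "counit H (u s) = counit U s" if s: "s \<in> carrier U" for s
    by (rule U_hom_eq[OF alg_hom_comp[OF Y.counit_alg_hom u] counit_U_hom _ s]) (simp add: uq qc counit_U_q)
  ultimately have "u \<in> bialg_hom K U H"
    by (simp add: bialg_hom_def coalg_hom_def u ul)
  moreover have "u \<in> extensional (carrier U)" by (simp add: u_def)
  ultimately show ?thesis using that uq by blast
qed

text \<open>On q(C) both actions are the rack product, and multiplicativity of u carries this to
  U(C). x varies because the second factor of a product acts on an element moved by the
  first.\<close>

lemma act_via_hom: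
  assumes "yetter_drinfeld_rack K H C actH qH" and u: "u \<in> alg_hom K U H"
    and uq: "\<And>x. x \<in> carrier C \<Longrightarrow> u (q x) = qH x" and "x \<in> carrier C" and "s \<in> carrier U"
  shows "env_act K C x s = actH x (u s)"
proof -
  interpret Y: yetter_drinfeld_rack K H C actH qH by fact
  note ul = alg_hom_lin[OF u] and l = bilin_right[OF act_bilin_U] and r = bilin_right[OF Y.act_bilin]
  show ?thesis
    using assms(5,4)
  proof (induction arbitrary: x rule: U_induct)
    case one
    then show ?case by (simp add: act_one_U alg_hom_one[OF u] Y.act_one)
  next
    case (incl y)
    then show ?case by (simp add: env_act_q uq Y.rack_act)
  next
    case (add s t)
    then show ?case by (simp add: lin_add[OF l] lin_add[OF r] lin_add[OF ul] lin_closed[OF ul])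
  next
    case (smult a s)
    then show ?case by (simp add: lin_smult[OF l] lin_smult[OF r] lin_smult[OF ul] lin_closed[OF ul])
  next
    case (mult s t)
    then show ?case
      by (simp add: act_mult_U alg_hom_mult[OF u] Y.act_mult lin_closed[OF ul] bilin_closed[OF Y.act_bilin])
  qed
qed

text \<open>q(C) generates U(C) as an algebra, which determines the map on the carrier;
  extensionality determines it elsewhere.\<close>

lemma universal_hom_unique:
  assumes "u \<in> alg_hom K U H" "u \<in> extensional (carrier U)" "v \<in> alg_hom K U H" "v \<in> extensional (carrier U)"
    and "\<And>x. x \<in> carrier C \<Longrightarrow> u (q x) = v (q x)"
  shows "u = v"
  by (rule extensionalityI[OF assms(2,4)]) (rule U_hom_eq[OF assms(1,3,5)])

end

theorem theorem1:
  fixes K :: "'k ring" and C :: "('k, 'c) rack_coalg"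
  assumes "field K" and "rack_bialgebra K C" and "cocommutative K C"
  shows
    "((\<forall>t\<in>carrier (envT K C).
         comult (env_bialg K C) (env_proj K C t)
           = tmap K (env_bialg K C) (env_bialg K C) (env_proj K C) (env_proj K C) (envT_comult K C t)) \<and>
      (\<forall>t\<in>carrier (envT K C). counit (env_bialg K C) (env_proj K C t) = envT_counit K C t) \<and>
      bialgebra K (env_bialg K C) \<and>
      (\<forall>x\<in>carrier C. \<forall>t\<in>carrier (envT K C).
         env_act K C x (env_proj K C t) = envT_act K C x t) \<and>
      yetter_drinfeld_rack K (env_bialg K C) C (env_act K C) (env_map K C))
     \<and>
     (\<forall>(H :: ('k, 'h) coalg) actH qH.
        bialgebra K H \<and> yetter_drinfeld_rack K H C actH qH \<longrightarrow>
          (\<exists>!u. u \<in> bialg_hom K (env_bialg K C) H \<and> u \<in> extensional (carrier (env_bialg K C)) \<and>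
                (\<forall>x\<in>carrier C. u (env_map K C x) = qH x)) \<and>
          (\<forall>u\<in>bialg_hom K (env_bialg K C) H.
             (\<forall>x\<in>carrier C. u (env_map K C x) = qH x) \<longrightarrow>
             (\<forall>x\<in>carrier C. \<forall>s\<in>carrier (env_bialg K C).
                env_act K C x s = actH x (u s))))"
proof -
  interpret cocommutative_rack_bialgebra K C
    using assms(2,3) by (intro cocommutative_rack_bialgebra.intro cocommutative_rack_bialgebra_axioms.intro)
  show ?thesis
  proof (intro conjI allI impI ballI)
    fix H :: "('k, 'h) coalg" and actH qH
    assume "bialgebra K H \<and> yetter_drinfeld_rack K H C actH qH"
    then have Y: "yetter_drinfeld_rack K H C actH qH" by simp
    show "\<exists>!u. u \<in> bialg_hom K U H \<and> u \<in> extensional (carrier U) \<and> (\<forall>x\<in>carrier C. u (q x) = qH x)"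
    proof (rule ex_ex1I)
      show "\<exists>u. u \<in> bialg_hom K U H \<and> u \<in> extensional (carrier U) \<and> (\<forall>x\<in>carrier C. u (q x) = qH x)"
        by (rule universal_hom[OF Y]) blast
    qed (auto simp: bialg_hom_def intro!: universal_hom_unique[of _ H])
    fix u x s assume "u \<in> bialg_hom K U H" "\<forall>x\<in>carrier C. u (q x) = qH x" "x \<in> carrier C" "s \<in> carrier U"
    then show "env_act K C x s = actH x (u s)"
      by (intro act_via_hom[OF Y]) (simp_all add: bialg_hom_def)
  qed (simp_all add: comult_U_pi counit_U_pi U_bialgebra env_act_pi U_yetter_drinfeld_rack)
qed

end
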